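(* Let $\mathbf P$ be a full additive subcategory of an abelian category $\mathbf C$. 1. If $\mathbf P$ is generating in $\mathbf C$, then for any $X_\bullet\in Ch^{\ge0}(\mathbf C)$ there exists a Cartan–Eilenberg $\mathbf P$-resolution $P_{\bullet\bullet}\to X_\bullet$. 2. Let $P_{\bullet\bullet}\to X_\bullet$ be a Cartan–Eilenberg $\mathbf P$-resolution, and let $(Tot(P_{\bullet\bullet}),D_\bullet)$ be the total complex: $$(Tot(P_{\bullet\bullet}))_n=\bigoplus_{s=0}^nP_{s,n-s},\qquad D_n=\sum_{s=0}^n\big(d_{s,n-s}+(-1)^s\delta_{s,n-s}\big).$$ Then the morphism $Tot(P_{\bullet\bullet})\to X_\bullet$ induced by the augmentation $\delta_{\bullet,0}$ is a quasi-isomorphism.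
   Context: $Ch^{\ge0}(\mathbf C)$ is the category of chain complexes $X_\bullet$ in $\mathbf C$ with $X_n=0$ for $n<0$. $\mathbf P$ is generating if for every $X\in\mathbf C$ there is an epimorphism $P\twoheadrightarrow X$ with $P\in\mathbf P$. A bounded below complex $(P_\bullet,d_\bullet)$ is called $\mathbf P$-projective if all $P_s\in\mathbf P$ and $\coker(d_s:P_s\to P_{s-1})\in\mathbf P$ for all $s$. A Cartan–Eilenberg $\mathbf P$-resolution of $(X_\bullet,d_\bullet)\in Ch^{\ge0}(\mathbf C)$ is a first quadrant bicomplex $(P_{\bullet\bullet},d,\delta)$ with all $P_{s,t}\in\mathbf P$, with commuting differentials $d_{s,t}:P_{s,t}\to P_{s-1,t}$ and $\delta_{s,t}:P_{s,t}\to P_{s,t-1}$ ($t\ge1$), together with an augmentation morphism of complexes $\delta_{\bullet,0}:P_{\bullet,0}\to X_\bullet$, such that: (i) for each $t\ge0$ the row $P_{\bullet,t}$ is a $\mathbf P$-projective complex; (ii) for each $s\ge0$ the sequence $0\leftarrow X_s\xleftarrow{\delta_{s,0}}P_{s,0}\xleftarrow{\delta_{s,1}}P_{s,1}\leftarrow\cdots$ is exact; (iii) for each $s\ge0$ the sequence of homologies of rows $0\leftarrow H_s(X_\bullet)\leftarrow H_s(P_{\bullet,0})\leftarrow H_s(P_{\bullet,1})\leftarrow\cdots$ is exact. In the formula for $D_n$ only the components landing in $P_{\bullet\bullet}$ are taken (i.e. the terms $d_{0,t}$ and $\delta_{s,0}$ are read as zero); the map $Tot(P_{\bullet\bullet})_n\to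 X_n$ is $\delta_{n,0}$ on $P_{n,0}$ and zero on the other summands. *)

theory Defs
  imports "HOL-Algebra.FiniteProduct"
begin

section \<open>Abelian categories\<close>

record ('o, 'm) precategory =
  Obj :: "'o set"
  Arr :: "'m set"
  Dom :: "'m \<Rightarrow> 'o"
  Cod :: "'m \<Rightarrow> 'o"
  Ident :: "'o \<Rightarrow> 'm"
  Comp :: "'m \<Rightarrow> 'm \<Rightarrow> 'm"  (infixr "\<cdot>\<index>" 75)
  Plus :: "'m \<Rightarrow> 'm \<Rightarrow> 'm"  (infixl "\<boxplus>\<index>" 65)
  Zero :: "'o \<Rightarrow> 'o \<Rightarrow> 'm"

definition Hom :: "('o, 'm, 'b) precategory_scheme \<Rightarrow> 'o \<Rightarrow> 'o \<Rightarrow> 'm set" where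
  "Hom C a b = {f \<in> Arr C. Dom C f = a \<and> Cod C f = b}"

text \<open>The group structure on a hom-set; the multiplicative group operations of
  \<^locale>\<open>comm_group\<close> stand for addition, zero and negation of arrows.\<close>

definition hom_group :: "('o, 'm, 'b) precategory_scheme \<Rightarrow> 'o \<Rightarrow> 'o \<Rightarrow> 'm monoid" where
  "hom_group C a b = \<lparr>carrier = Hom C a b, mult = Plus C, one = Zero C a b\<rparr>"

definition arr_neg :: "('o, 'm, 'b) precategory_scheme \<Rightarrow> 'm \<Rightarrow> 'm" where
  "arr_neg C f = inv\<^bsub>hom_group C (Dom C f) (Cod C f)\<^esub> f"

definition arr_sum ::
  "('o, 'm, 'b) precategory_scheme \<Rightarrow> 'o \<Rightarrow> 'o \<Rightarrow> ('i \<Rightarrow> 'm) \<Rightarrow> 'i set \<Rightarrow> 'm" where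
  "arr_sum C a b F I = finprod (hom_group C a b) F I"

locale category =
  fixes C :: "('o, 'm, 'b) precategory_scheme" (structure)
  assumes Dom_closed: "f \<in> Arr C \<Longrightarrow> Dom C f \<in> Obj C"
    and Cod_closed: "f \<in> Arr C \<Longrightarrow> Cod C f \<in> Obj C"
    and Ident_closed: "a \<in> Obj C \<Longrightarrow> Ident C a \<in> Hom C a a"
    and Comp_closed: "\<lbrakk>f \<in> Hom C a b; g \<in> Hom C b c\<rbrakk> \<Longrightarrow> g \<cdot> f \<in> Hom C a c"
    and Ident_left: "f \<in> Hom C a b \<Longrightarrow> Ident C b \<cdot> f = f"
    and Ident_right: "f \<in> Hom C a b \<Longrightarrow> f \<cdot> Ident C a = f"
    and Comp_assoc: "\<lbrakk>f \<in> Hom C a b; g \<in> Hom C b c; h \<in> Hom C c d\<rbrakk>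
      \<Longrightarrow> (h \<cdot> g) \<cdot> f = h \<cdot> (g \<cdot> f)"

locale preadditive_category = category +
  assumes hom_comm_group: "\<lbrakk>a \<in> Obj C; b \<in> Obj C\<rbrakk> \<Longrightarrow> comm_group (hom_group C a b)"
    and Comp_Plus_left: "\<lbrakk>f \<in> Hom C a b; g \<in> Hom C b c; h \<in> Hom C b c\<rbrakk>
      \<Longrightarrow> (g \<boxplus> h) \<cdot> f = (g \<cdot> f) \<boxplus> (h \<cdot> f)"
    and Comp_Plus_right: "\<lbrakk>f \<in> Hom C a b; g \<in> Hom C a b; h \<in> Hom C b c\<rbrakk>
      \<Longrightarrow> h \<cdot> (f \<boxplus> g) = (h \<cdot> f) \<boxplus> (h \<cdot> g)"

definition is_direct_sum ::
  "('o, 'm, 'b) precategory_scheme \<Rightarrow> 'i set \<Rightarrow> ('i \<Rightarrow> 'o) \<Rightarrow> 'o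
    \<Rightarrow> ('i \<Rightarrow> 'm) \<Rightarrow> ('i \<Rightarrow> 'm) \<Rightarrow> bool" where
  "is_direct_sum C I X S \<iota> \<pi> \<longleftrightarrow>
    finite I \<and> S \<in> Obj C \<and>
    (\<forall>i\<in>I. X i \<in> Obj C \<and> \<iota> i \<in> Hom C (X i) S \<and> \<pi> i \<in> Hom C S (X i)) \<and>
    (\<forall>i\<in>I. \<forall>j\<in>I. \<pi> i \<cdot>\<^bsub>C\<^esub> \<iota> j = (if i = j then Ident C (X i) else Zero C (X j) (X i))) \<and>
    arr_sum C S S (\<lambda>i. \<iota> i \<cdot>\<^bsub>C\<^esub> \<pi> i) I = Ident C S"

text \<open>The case \<open>n = 0\<close> below provides a zero object.\<close>

locale additive_category = preadditive_category +
  assumes has_direct_sums: "(\<And>i. i < n \<Longrightarrow> X i \<in> Obj C)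
      \<Longrightarrow> \<exists>S \<iota> \<pi>. is_direct_sum C {..<n::nat} X S \<iota> \<pi>"

definition is_zero_obj :: "('o, 'm, 'b) precategory_scheme \<Rightarrow> 'o \<Rightarrow> bool" where
  "is_zero_obj C Z \<longleftrightarrow>
    Z \<in> Obj C \<and> (\<forall>X\<in>Obj C. (\<exists>!f. f \<in> Hom C X Z) \<and> (\<exists>!f. f \<in> Hom C Z X))"

definition is_mono :: "('o, 'm, 'b) precategory_scheme \<Rightarrow> 'm \<Rightarrow> bool" where
  "is_mono C f \<longleftrightarrow> f \<in> Arr C \<and>
    (\<forall>X. \<forall>g\<in>Hom C X (Dom C f). \<forall>h\<in>Hom C X (Dom C f). f \<cdot>\<^bsub>C\<^esub> g = f \<cdot>\<^bsub>C\<^esub> h \<longrightarrow> g = h)"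

definition is_epi :: "('o, 'm, 'b) precategory_scheme \<Rightarrow> 'm \<Rightarrow> bool" where
  "is_epi C f \<longleftrightarrow> f \<in> Arr C \<and>
    (\<forall>Y. \<forall>g\<in>Hom C (Cod C f) Y. \<forall>h\<in>Hom C (Cod C f) Y. g \<cdot>\<^bsub>C\<^esub> f = h \<cdot>\<^bsub>C\<^esub> f \<longrightarrow> g = h)"

definition is_iso :: "('o, 'm, 'b) precategory_scheme \<Rightarrow> 'm \<Rightarrow> bool" where
  "is_iso C f \<longleftrightarrow> f \<in> Arr C \<and>
    (\<exists>g\<in>Hom C (Cod C f) (Dom C f).
      g \<cdot>\<^bsub>C\<^esub> f = Ident C (Dom C f) \<and> f \<cdot>\<^bsub>C\<^esub> g = Ident C (Cod C f))"

definition is_kernel :: "('o, 'm, 'b) precategory_scheme \<Rightarrow> 'm \<Rightarrow> 'm \<Rightarrow> bool" where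
  "is_kernel C f k \<longleftrightarrow> f \<in> Arr C \<and> k \<in> Arr C \<and> Cod C k = Dom C f \<and>
    f \<cdot>\<^bsub>C\<^esub> k = Zero C (Dom C k) (Cod C f) \<and>
    (\<forall>X. \<forall>h\<in>Hom C X (Dom C f). f \<cdot>\<^bsub>C\<^esub> h = Zero C X (Cod C f) \<longrightarrow>
      (\<exists>!u. u \<in> Hom C X (Dom C k) \<and> k \<cdot>\<^bsub>C\<^esub> u = h))"

definition is_cokernel :: "('o, 'm, 'b) precategory_scheme \<Rightarrow> 'm \<Rightarrow> 'm \<Rightarrow> bool" where
  "is_cokernel C f c \<longleftrightarrow> f \<in> Arr C \<and> c \<in> Arr C \<and> Dom C c = Cod C f \<and>
    c \<cdot>\<^bsub>C\<^esub> f = Zero C (Dom C f) (Cod C c) \<and>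
    (\<forall>Y. \<forall>h\<in>Hom C (Cod C f) Y. h \<cdot>\<^bsub>C\<^esub> f = Zero C (Dom C f) Y \<longrightarrow>
      (\<exists>!u. u \<in> Hom C (Cod C c) Y \<and> u \<cdot>\<^bsub>C\<^esub> c = h))"

locale abelian_category = additive_category +
  assumes has_kernels: "f \<in> Arr C \<Longrightarrow> \<exists>k. is_kernel C f k"
    and has_cokernels: "f \<in> Arr C \<Longrightarrow> \<exists>c. is_cokernel C f c"
    and mono_normal: "is_mono C f \<Longrightarrow> \<exists>g. is_kernel C g f"
    and epi_normal: "is_epi C f \<Longrightarrow> \<exists>g. is_cokernel C g f"

text \<open>A full subcategory is given by its set of objects, which need not be closed under
  isomorphism.\<close>

definition full_subcategory ::
  "('o, 'm, 'b) precategory_scheme \<Rightarrow> 'o set \<Rightarrow> ('o, 'm, 'b) precategory_scheme" where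
  "full_subcategory C P =
    C\<lparr>Obj := P, Arr := {f \<in> Arr C. Dom C f \<in> P \<and> Cod C f \<in> P}\<rparr>"

definition full_additive_subcategory ::
  "('o, 'm, 'b) precategory_scheme \<Rightarrow> 'o set \<Rightarrow> bool" where
  "full_additive_subcategory C P \<longleftrightarrow> P \<subseteq> Obj C \<and> additive_category (full_subcategory C P)"

definition generating :: "('o, 'm, 'b) precategory_scheme \<Rightarrow> 'o set \<Rightarrow> bool" where
  "generating C P \<longleftrightarrow> (\<forall>X\<in>Obj C. \<exists>Q\<in>P. \<exists>p\<in>Hom C Q X. is_epi C p)"


section \<open>Exactness\<close>

definition is_image :: "('o, 'm, 'b) precategory_scheme \<Rightarrow> 'm \<Rightarrow> 'm \<Rightarrow> bool" where
  "is_image C f m \<longleftrightarrow> (\<exists>c. is_cokernel C f c \<and> is_kernel C c m)"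

text \<open>Exactness of \<open>A \<rightarrow> B \<rightarrow> D\<close> at \<open>B\<close>: the image of \<open>f\<close> and the kernel of \<open>g\<close> are the same
  subobject of \<open>B\<close>, that is, they are represented by a common monomorphism.\<close>

definition exact_at :: "('o, 'm, 'b) precategory_scheme \<Rightarrow> 'm \<Rightarrow> 'm \<Rightarrow> bool" where
  "exact_at C f g \<longleftrightarrow> Cod C f = Dom C g \<and> (\<exists>m. is_image C f m \<and> is_kernel C g m)"

text \<open>Exactness of \<open>0 \<leftarrow> Y \<leftarrow> Z\<^sub>0 \<leftarrow> Z\<^sub>1 \<leftarrow> \<dots>\<close>, where the arrow out of \<open>Z\<^sub>t\<close> is \<open>f t\<close>.\<close>

definition exact_augmented :: "('o, 'm, 'b) precategory_scheme \<Rightarrow> (nat \<Rightarrow> 'm) \<Rightarrow> bool" where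
  "exact_augmented C f \<longleftrightarrow>
    (\<exists>O'. is_zero_obj C O' \<and> exact_at C (f 0) (Zero C (Cod C (f 0)) O')) \<and>
    (\<forall>t. exact_at C (f (Suc t)) (f t))"


section \<open>Complexes and homology\<close>

text \<open>Complexes are indexed by the integers and have differentials of degree \<open>-1\<close>,
  \<open>d n : X n \<rightarrow> X (n - 1)\<close>.\<close>

definition is_complex ::
  "('o, 'm, 'b) precategory_scheme \<Rightarrow> (int \<Rightarrow> 'o) \<Rightarrow> (int \<Rightarrow> 'm) \<Rightarrow> bool" where
  "is_complex C X d \<longleftrightarrow>
    (\<forall>n. X n \<in> Obj C \<and> d n \<in> Hom C (X n) (X (n - 1)) \<and>
      d (n - 1) \<cdot>\<^bsub>C\<^esub> d n = Zero C (X n) (X (n - 2)))"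

definition is_nonneg_complex ::
  "('o, 'm, 'b) precategory_scheme \<Rightarrow> (int \<Rightarrow> 'o) \<Rightarrow> (int \<Rightarrow> 'm) \<Rightarrow> bool" where
  "is_nonneg_complex C X d \<longleftrightarrow> is_complex C X d \<and> (\<forall>n<0. is_zero_obj C (X n))"

definition is_chain_map ::
  "('o, 'm, 'b) precategory_scheme \<Rightarrow> (int \<Rightarrow> 'o) \<Rightarrow> (int \<Rightarrow> 'm) \<Rightarrow> (int \<Rightarrow> 'o) \<Rightarrow> (int \<Rightarrow> 'm)
    \<Rightarrow> (int \<Rightarrow> 'm) \<Rightarrow> bool" where
  "is_chain_map C X d Y e f \<longleftrightarrow>
    (\<forall>n. f n \<in> Hom C (X n) (Y n) \<and> e n \<cdot>\<^bsub>C\<^esub> f n = f (n - 1) \<cdot>\<^bsub>C\<^esub> d n)"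

definition ker :: "('o, 'm, 'b) precategory_scheme \<Rightarrow> 'm \<Rightarrow> 'm" where
  "ker C f = (SOME k. is_kernel C f k)"

definition coker :: "('o, 'm, 'b) precategory_scheme \<Rightarrow> 'm \<Rightarrow> 'm" where
  "coker C f = (SOME c. is_cokernel C f c)"

text \<open>\<open>boundary C d n\<close> is the corestriction \<open>X (n + 1) \<rightarrow> Ker (d n)\<close> of \<open>d (n + 1)\<close>. Its
  cokernel is the projection from the cycles \<open>Ker (d n)\<close> onto \<open>H\<^sub>n = Ker (d n) / Im (d (n + 1))\<close>.\<close>

definition boundary :: "('o, 'm, 'b) precategory_scheme \<Rightarrow> (int \<Rightarrow> 'm) \<Rightarrow> int \<Rightarrow> 'm" where
  "boundary C d n =
    (THE u. u \<in> Hom C (Dom C (d (n + 1))) (Dom C (ker C (d n))) \<and>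
      ker C (d n) \<cdot>\<^bsub>C\<^esub> u = d (n + 1))"

definition homology_proj :: "('o, 'm, 'b) precategory_scheme \<Rightarrow> (int \<Rightarrow> 'm) \<Rightarrow> int \<Rightarrow> 'm" where
  "homology_proj C d n = coker C (boundary C d n)"

definition homology :: "('o, 'm, 'b) precategory_scheme \<Rightarrow> (int \<Rightarrow> 'm) \<Rightarrow> int \<Rightarrow> 'o" where
  "homology C d n = Cod C (homology_proj C d n)"

definition cycles_map ::
  "('o, 'm, 'b) precategory_scheme \<Rightarrow> (int \<Rightarrow> 'm) \<Rightarrow> (int \<Rightarrow> 'm) \<Rightarrow> (int \<Rightarrow> 'm) \<Rightarrow> int \<Rightarrow> 'm" where
  "cycles_map C d e f n =
    (THE u. u \<in> Hom C (Dom C (ker C (d n))) (Dom C (ker C (e n))) \<and>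
      ker C (e n) \<cdot>\<^bsub>C\<^esub> u = f n \<cdot>\<^bsub>C\<^esub> ker C (d n))"

definition homology_map ::
  "('o, 'm, 'b) precategory_scheme \<Rightarrow> (int \<Rightarrow> 'm) \<Rightarrow> (int \<Rightarrow> 'm) \<Rightarrow> (int \<Rightarrow> 'm) \<Rightarrow> int \<Rightarrow> 'm" where
  "homology_map C d e f n =
    (THE h. h \<in> Hom C (homology C d n) (homology C e n) \<and>
      h \<cdot>\<^bsub>C\<^esub> homology_proj C d n = homology_proj C e n \<cdot>\<^bsub>C\<^esub> cycles_map C d e f n)"

definition is_quasi_iso ::
  "('o, 'm, 'b) precategory_scheme \<Rightarrow> (int \<Rightarrow> 'o) \<Rightarrow> (int \<Rightarrow> 'm) \<Rightarrow> (int \<Rightarrow> 'o) \<Rightarrow> (int \<Rightarrow> 'm)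
    \<Rightarrow> (int \<Rightarrow> 'm) \<Rightarrow> bool" where
  "is_quasi_iso C X d Y e f \<longleftrightarrow>
    is_chain_map C X d Y e f \<and> (\<forall>n. is_iso C (homology_map C d e f n))"


section \<open>Cartan--Eilenberg resolutions\<close>

text \<open>As \<open>P\<close> need not be closed under isomorphism and cokernels are only defined up to
  isomorphism, the cokernel of \<open>d s\<close> belongs to \<open>P\<close> if one of its representatives does.\<close>

definition is_proj_complex ::
  "('o, 'm, 'b) precategory_scheme \<Rightarrow> 'o set \<Rightarrow> (int \<Rightarrow> 'o) \<Rightarrow> (int \<Rightarrow> 'm) \<Rightarrow> bool" where
  "is_proj_complex C P Q d \<longleftrightarrow>
    is_complex C Q d \<and> (\<exists>N. \<forall>s<N. is_zero_obj C (Q s)) \<and>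
    (\<forall>s. Q s \<in> P) \<and> (\<forall>s. \<exists>c. is_cokernel C (d s) c \<and> Cod C c \<in> P)"

text \<open>A first quadrant bicomplex is indexed by \<open>s :: int\<close> with \<open>Q s t = 0\<close> for \<open>s < 0\<close>, so that
  its rows are complexes in the sense above, and by \<open>t :: nat\<close>. The augmentation is
  \<open>\<delta> s 0 : Q s 0 \<rightarrow> X s\<close>, whereas \<open>\<delta> s (Suc t) : Q s (Suc t) \<rightarrow> Q s t\<close>.\<close>

definition is_first_quadrant_bicomplex ::
  "('o, 'm, 'b) precategory_scheme \<Rightarrow> (int \<Rightarrow> nat \<Rightarrow> 'o) \<Rightarrow> (int \<Rightarrow> nat \<Rightarrow> 'm)
    \<Rightarrow> (int \<Rightarrow> nat \<Rightarrow> 'm) \<Rightarrow> bool" where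
  "is_first_quadrant_bicomplex C Q d \<delta> \<longleftrightarrow>
    (\<forall>t. is_nonneg_complex C (\<lambda>s. Q s t) (\<lambda>s. d s t)) \<and>
    (\<forall>t. is_chain_map C (\<lambda>s. Q s (Suc t)) (\<lambda>s. d s (Suc t)) (\<lambda>s. Q s t) (\<lambda>s. d s t)
      (\<lambda>s. \<delta> s (Suc t))) \<and>
    (\<forall>s t. \<delta> s (Suc t) \<cdot>\<^bsub>C\<^esub> \<delta> s (Suc (Suc t)) = Zero C (Q s (Suc (Suc t))) (Q s t))"

definition is_CE_resolution ::
  "('o, 'm, 'b) precategory_scheme \<Rightarrow> 'o set \<Rightarrow> (int \<Rightarrow> 'o) \<Rightarrow> (int \<Rightarrow> 'm)
    \<Rightarrow> (int \<Rightarrow> nat \<Rightarrow> 'o) \<Rightarrow> (int \<Rightarrow> nat \<Rightarrow> 'm) \<Rightarrow> (int \<Rightarrow> nat \<Rightarrow> 'm) \<Rightarrow> bool" where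
  "is_CE_resolution C P X dX Q d \<delta> \<longleftrightarrow>
    is_first_quadrant_bicomplex C Q d \<delta> \<and>
    (\<forall>s t. Q s t \<in> P) \<and>
    is_chain_map C (\<lambda>s. Q s 0) (\<lambda>s. d s 0) X dX (\<lambda>s. \<delta> s 0) \<and>
    (\<forall>t. is_proj_complex C P (\<lambda>s. Q s t) (\<lambda>s. d s t)) \<and>
    (\<forall>s\<ge>0. exact_augmented C (\<delta> s)) \<and>
    (\<forall>s\<ge>0. exact_augmented C (\<lambda>t. case t of
        0 \<Rightarrow> homology_map C (\<lambda>s. d s 0) dX (\<lambda>s. \<delta> s 0) s
      | Suc t' \<Rightarrow> homology_map C (\<lambda>s. d s t) (\<lambda>s. d s t') (\<lambda>s. \<delta> s t) s))"


section \<open>The total complex\<close>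

text \<open>\<open>T n\<close>, with injections \<open>\<iota> n s\<close> and projections \<open>\<pi> n s\<close>, is a choice of the direct sum of
  the \<open>Q s (n - s)\<close> for \<open>0 \<le> s \<le> n\<close>; for negative \<open>n\<close> the sum is empty and \<open>T n\<close> is zero.\<close>

definition is_Tot ::
  "('o, 'm, 'b) precategory_scheme \<Rightarrow> (int \<Rightarrow> nat \<Rightarrow> 'o) \<Rightarrow> (int \<Rightarrow> 'o)
    \<Rightarrow> (int \<Rightarrow> int \<Rightarrow> 'm) \<Rightarrow> (int \<Rightarrow> int \<Rightarrow> 'm) \<Rightarrow> bool" where
  "is_Tot C Q T \<iota> \<pi> \<longleftrightarrow>
    (\<forall>n. is_direct_sum C {0..n} (\<lambda>s. Q s (nat (n - s))) (T n) (\<iota> n) (\<pi> n))"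

text \<open>The two conditionals read \<open>d 0 t\<close> and \<open>\<delta> s 0\<close> as zero; the inner one is the sign
  \<open>(-1)\<^sup>s\<close>.\<close>

definition Tot_diff ::
  "('o, 'm, 'b) precategory_scheme \<Rightarrow> (int \<Rightarrow> nat \<Rightarrow> 'm) \<Rightarrow> (int \<Rightarrow> nat \<Rightarrow> 'm) \<Rightarrow> (int \<Rightarrow> 'o)
    \<Rightarrow> (int \<Rightarrow> int \<Rightarrow> 'm) \<Rightarrow> (int \<Rightarrow> int \<Rightarrow> 'm) \<Rightarrow> int \<Rightarrow> 'm" where
  "Tot_diff C d \<delta> T \<iota> \<pi> n = arr_sum C (T n) (T (n - 1)) (\<lambda>s.
      (if s = 0 then Zero C (T n) (T (n - 1))
       else \<iota> (n - 1) (s - 1) \<cdot>\<^bsub>C\<^esub> d s (nat (n - s)) \<cdot>\<^bsub>C\<^esub> \<pi> n s)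
      \<boxplus>\<^bsub>C\<^esub>
      (if s = n then Zero C (T n) (T (n - 1))
       else if even s then \<iota> (n - 1) s \<cdot>\<^bsub>C\<^esub> \<delta> s (nat (n - s)) \<cdot>\<^bsub>C\<^esub> \<pi> n s
       else arr_neg C (\<iota> (n - 1) s \<cdot>\<^bsub>C\<^esub> \<delta> s (nat (n - s)) \<cdot>\<^bsub>C\<^esub> \<pi> n s))) {0..n}"

definition Tot_aug ::
  "('o, 'm, 'b) precategory_scheme \<Rightarrow> (int \<Rightarrow> 'o) \<Rightarrow> (int \<Rightarrow> nat \<Rightarrow> 'm) \<Rightarrow> (int \<Rightarrow> 'o)
    \<Rightarrow> (int \<Rightarrow> int \<Rightarrow> 'm) \<Rightarrow> int \<Rightarrow> 'm" where
  "Tot_aug C X \<delta> T \<pi> n =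
    (if n < 0 then Zero C (T n) (X n) else \<delta> n 0 \<cdot>\<^bsub>C\<^esub> \<pi> n n)"

end

theory Submission
  imports Defs
begin

text \<open>
  Proofs chase generalized elements: an arrow \<open>x : A \<rightarrow> X\<close> is an element of \<open>X\<close>, and an existence
  claim about elements may be met after restricting along an epimorphism \<open>e : A' \<rightarrow> A\<close>. This is sound
  because epimorphisms lift elements in this sense (\<open>epi_lift\<close>, stability under pullback), and it
  is complete because exactness of \<open>f, g\<close> means that the elements killed by \<open>g\<close> locally come from
  \<open>f\<close> (\<open>exact_atI\<close>, \<open>exact_atD\<close>). A cycle \<open>x : A \<rightarrow> X\<^sub>n\<close> has a class \<open>A \<rightarrow> H\<^sub>n\<close>; every element of \<open>H\<^sub>n\<close>
  locally is such a class, and it vanishes iff the cycle locally is a boundary. So statements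
  about \<open>H\<^sub>n\<close> reduce to statements about cycles (\<open>exact_homologyI\<close>, \<open>quasi_isoI\<close>).

  Existence. The objects of \<open>P\<close> need not be projective, so resolutions of cycles and homology cannot be
  glued by a horseshoe lemma. Instead \<open>X\<close> is covered by an explicit \<open>P\<close>-projective complex: choose
  epimorphisms \<open>R\<^sub>s \<rightarrow> Ker d\<^sub>s\<close> and, for \<open>s > 0\<close>, \<open>F\<^sub>s \<rightarrow> X\<^sub>s\<close> with \<open>R\<^sub>s, F\<^sub>s\<close> in \<open>P\<close>, and take the sum of
  the complex \<open>R\<close> with zero differential and of the disks, identities \<open>F\<^sub>s \<rightarrow> F\<^sub>s\<close> placed in degrees \<open>s\<close> and
  \<open>s - 1\<close>. In degree \<open>s\<close> this is \<open>R\<^sub>s \<oplus> F\<^sub>s \<oplus> F\<^bsub>s+1\<^esub>\<close>, and the cokernel of the differential is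
  \<open>R\<^sub>s \<oplus> F\<^sub>s\<close>. The cover is epi in each degree and locally lifts cycles to cycles
  (\<open>proj_complex_cover\<close>). With \<open>K\<close> its kernel, both \<open>0 \<leftarrow> X \<leftarrow> Q \<leftarrow> K \<leftarrow> 0\<close> and the sequence of
  homologies are therefore short exact (\<open>step_homology_exact\<close>, \<open>step_homology_mono\<close>). Covering \<open>K\<close> in
  the same way and splicing the short exact sequences gives the resolution.

  Total complex. That \<open>\<epsilon> : Tot \<rightarrow> X\<close> is a quasi-isomorphism says that its cone is acyclic: if
  \<open>D z = 0\<close> and \<open>\<epsilon> z = d x\<close>, then locally \<open>z = D w\<close> and \<open>x = \<epsilon> w\<close> for some \<open>w\<close>. The components
  \<open>w\<^sub>s\<close> in \<open>Q\<^bsub>s,n+1-s\<^esub>\<close> are found for \<open>s = n + 1, n, \<dots>, 0\<close> in turn, each by exactness of the column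
  \<open>s\<close> (\<open>descending_chase\<close>).
\<close>

section \<open>Arrow calculus\<close>

text \<open>Membership in a hom-set is unfolded into equations for domain and codomain, so that the
  simplifier discharges the composability side conditions of all later rewriting.\<close>

context category
begin

lemma Hom_iff [simp]:
  "f \<in> Hom C a b \<longleftrightarrow> f \<in> Arr C \<and> Dom C f = a \<and> Cod C f = b \<and> a \<in> Obj C \<and> b \<in> Obj C"
  using Dom_closed Cod_closed by (auto simp: Hom_def)

lemma Dom_Obj [simp]: "f \<in> Arr C \<Longrightarrow> Dom C f \<in> Obj C"
  and Cod_Obj [simp]: "f \<in> Arr C \<Longrightarrow> Cod C f \<in> Obj C"
  using Dom_closed Cod_closed by auto

lemma Ident_simps [simp]:
  assumes "a \<in> Obj C"
  shows "Ident C a \<in> Arr C" "Dom C (Ident C a) = a" "Cod C (Ident C a) = a"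
  using Ident_closed[OF assms] by auto

lemma comp_simps [simp]:
  assumes "f \<in> Arr C" "g \<in> Arr C" "Dom C g = Cod C f"
  shows "g \<cdot> f \<in> Arr C" "Dom C (g \<cdot> f) = Dom C f" "Cod C (g \<cdot> f) = Cod C g"
  using Comp_closed[of f "Dom C f" "Cod C f" g "Cod C g"] assms by auto

lemma comp_ident [simp]:
  "f \<in> Arr C \<Longrightarrow> Cod C f = a \<Longrightarrow> Ident C a \<cdot> f = f"
  "f \<in> Arr C \<Longrightarrow> Dom C f = a \<Longrightarrow> f \<cdot> Ident C a = f"
  using Ident_left[of f "Dom C f" "Cod C f"] Ident_right[of f "Dom C f" "Cod C f"] by auto

lemma comp_assoc [simp]:
  assumes "f \<in> Arr C" "g \<in> Arr C" "h \<in> Arr C" "Dom C g = Cod C f" "Dom C h = Cod C g"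
  shows "(h \<cdot> g) \<cdot> f = h \<cdot> (g \<cdot> f)"
  using Comp_assoc[of f "Dom C f" "Cod C f" g "Cod C g" h "Cod C h"] assms by auto

text \<open>Composites are kept associated to the right, where an equation \<open>g \<cdot> f = k\<close> no longer matches;
  this form restores it.\<close>

lemma rewrite_prefix:
  assumes "g \<cdot> f = k" "f \<in> Arr C" "g \<in> Arr C" "Dom C g = Cod C f" "x \<in> Arr C" "Cod C x = Dom C f"
  shows "g \<cdot> (f \<cdot> x) = k \<cdot> x"
  using comp_assoc[of x f g] assms by simp

lemma epiD_arr [simp]: "is_epi C f \<Longrightarrow> f \<in> Arr C"
  and monoD_arr [simp]: "is_mono C f \<Longrightarrow> f \<in> Arr C"
  by (auto simp: is_epi_def is_mono_def)

lemma epi_cancel: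
  assumes "is_epi C e" "g \<cdot> e = h \<cdot> e" "g \<in> Arr C" "h \<in> Arr C"
    "Dom C g = Cod C e" "Dom C h = Cod C e" "Cod C g = Cod C h"
  shows "g = h"
  proof -
  have "g \<in> Hom C (Cod C e) (Cod C g)" "h \<in> Hom C (Cod C e) (Cod C g)" using assms by auto
  then show ?thesis using assms(1,2) unfolding is_epi_def by blast
qed

lemma mono_cancel:
  assumes "is_mono C m" "m \<cdot> g = m \<cdot> h" "g \<in> Arr C" "h \<in> Arr C"
    "Cod C g = Dom C m" "Cod C h = Dom C m" "Dom C g = Dom C h"
  shows "g = h"
  proof -
  have "g \<in> Hom C (Dom C g) (Dom C m)" "h \<in> Hom C (Dom C g) (Dom C m)" using assms by auto
  then show ?thesis using assms(1,2) unfolding is_mono_def by blast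
qed

lemma epi_ident: "a \<in> Obj C \<Longrightarrow> is_epi C (Ident C a)"
  unfolding is_epi_def by auto

lemma epi_comp:
  assumes "is_epi C e" "is_epi C e'" "Dom C e = Cod C e'"
  shows "is_epi C (e \<cdot> e')"
  unfolding is_epi_def
proof (intro conjI allI ballI impI)
  have [simp]: "e \<in> Arr C" "e' \<in> Arr C" using assms by simp_all
  show "e \<cdot> e' \<in> Arr C" using assms by simp
  fix Y g h
  assume gh: "g \<in> Hom C (Cod C (e \<cdot> e')) Y" "h \<in> Hom C (Cod C (e \<cdot> e')) Y"
    "g \<cdot> e \<cdot> e' = h \<cdot> e \<cdot> e'"
  have "g \<cdot> e = h \<cdot> e"
    by (rule epi_cancel[OF assms(2)]) (use gh assms in auto)
  then show "g = h"
    by (rule epi_cancel[OF assms(1)]) (use gh assms in auto)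
qed

lemma epi_of_comp:
  assumes "is_epi C (f \<cdot> u)" "f \<in> Arr C" "u \<in> Arr C" "Dom C f = Cod C u"
  shows "is_epi C f"
  unfolding is_epi_def
proof (intro conjI allI ballI impI)
  fix Y g h
  assume gh: "g \<in> Hom C (Cod C f) Y" "h \<in> Hom C (Cod C f) Y" "g \<cdot> f = h \<cdot> f"
  have *: "(g \<cdot> f) \<cdot> u = (h \<cdot> f) \<cdot> u" by (simp only: gh(3))
  show "g = h"
    by (rule epi_cancel[OF assms(1)]) (use gh(1,2) * assms in auto)
qed (use assms in auto)

end

context preadditive_category
begin

lemma hom_group_simps [simp]:
  "carrier (hom_group C a b) = Hom C a b" "mult (hom_group C a b) = Plus C"
  "one (hom_group C a b) = Zero C a b"
  by (simp_all add: hom_group_def)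

lemma zero_simps [simp]:
  assumes "a \<in> Obj C" "b \<in> Obj C"
  shows "Zero C a b \<in> Arr C" "Dom C (Zero C a b) = a" "Cod C (Zero C a b) = b"
proof -
  interpret comm_group "hom_group C a b" using hom_comm_group[OF assms] .
  show "Zero C a b \<in> Arr C" "Dom C (Zero C a b) = a" "Cod C (Zero C a b) = b"
    using one_closed by auto
qed

lemma plus_simps [simp]:
  assumes "f \<in> Arr C" "g \<in> Arr C" "Dom C g = Dom C f" "Cod C g = Cod C f"
  shows "f \<boxplus> g \<in> Arr C" "Dom C (f \<boxplus> g) = Dom C f" "Cod C (f \<boxplus> g) = Cod C f"
proof -
  interpret comm_group "hom_group C (Dom C f) (Cod C f)" using hom_comm_group assms by simp
  show "f \<boxplus> g \<in> Arr C" "Dom C (f \<boxplus> g) = Dom C f" "Cod C (f \<boxplus> g) = Cod C f"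
    using m_closed[of f g] assms by auto
qed

lemma neg_simps [simp]:
  assumes "f \<in> Arr C"
  shows "arr_neg C f \<in> Arr C" "Dom C (arr_neg C f) = Dom C f" "Cod C (arr_neg C f) = Cod C f"
proof -
  interpret comm_group "hom_group C (Dom C f) (Cod C f)" using hom_comm_group assms by simp
  show "arr_neg C f \<in> Arr C" "Dom C (arr_neg C f) = Dom C f" "Cod C (arr_neg C f) = Cod C f"
    using inv_closed[of f] assms by (auto simp: arr_neg_def)
qed

lemma plus_assoc:
  assumes "f \<in> Arr C" "g \<in> Arr C" "h \<in> Arr C" "Dom C g = Dom C f" "Cod C g = Cod C f"
    "Dom C h = Dom C f" "Cod C h = Cod C f"
  shows "(f \<boxplus> g) \<boxplus> h = f \<boxplus> (g \<boxplus> h)"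
proof -
  interpret comm_group "hom_group C (Dom C f) (Cod C f)" using hom_comm_group assms by simp
  show ?thesis using m_assoc[of f g h] assms by simp
qed

lemma plus_comm:
  assumes "f \<in> Arr C" "g \<in> Arr C" "Dom C g = Dom C f" "Cod C g = Cod C f"
  shows "f \<boxplus> g = g \<boxplus> f"
proof -
  interpret comm_group "hom_group C (Dom C f) (Cod C f)" using hom_comm_group assms by simp
  show ?thesis using m_comm[of f g] assms by simp
qed

lemma plus_lcomm:
  assumes "f \<in> Arr C" "g \<in> Arr C" "h \<in> Arr C" "Dom C g = Dom C f" "Cod C g = Cod C f"
    "Dom C h = Dom C f" "Cod C h = Cod C f"
  shows "g \<boxplus> (f \<boxplus> h) = f \<boxplus> (g \<boxplus> h)"
proof -
  have a: "(g \<boxplus> f) \<boxplus> h = g \<boxplus> (f \<boxplus> h)" "(f \<boxplus> g) \<boxplus> h = f \<boxplus> (g \<boxplus> h)"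
    using assms by (simp_all add: plus_assoc)
  have "g \<boxplus> f = f \<boxplus> g" by (rule plus_comm) (use assms in auto)
  then show ?thesis by (simp only: a[symmetric])
qed

lemma plus_zero [simp]:
  assumes "f \<in> Arr C" "Dom C f = a" "Cod C f = b"
  shows "f \<boxplus> Zero C a b = f" "Zero C a b \<boxplus> f = f"
proof -
  interpret comm_group "hom_group C a b" using hom_comm_group assms by auto
  show "f \<boxplus> Zero C a b = f" "Zero C a b \<boxplus> f = f" 
    using r_one[of f] l_one[of f] assms by auto
qed

lemma plus_neg [simp]:
  assumes "f \<in> Arr C"
  shows "f \<boxplus> arr_neg C f = Zero C (Dom C f) (Cod C f)"
    "arr_neg C f \<boxplus> f = Zero C (Dom C f) (Cod C f)"
proof -
  interpret comm_group "hom_group C (Dom C f) (Cod C f)" using hom_comm_group assms by auto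
  show "f \<boxplus> arr_neg C f = Zero C (Dom C f) (Cod C f)"
    "arr_neg C f \<boxplus> f = Zero C (Dom C f) (Cod C f)"
    using r_inv[of f] l_inv[of f] assms by (auto simp: arr_neg_def)
qed

lemma plus_neg_cancel [simp]:
  assumes "f \<in> Arr C" "g \<in> Arr C" "Dom C g = Dom C f" "Cod C g = Cod C f"
  shows "f \<boxplus> (arr_neg C f \<boxplus> g) = g" "arr_neg C f \<boxplus> (f \<boxplus> g) = g"
  by (subst plus_assoc[symmetric]; use assms in simp)+

lemma plus_cancel:
  assumes "f \<boxplus> g = f \<boxplus> h" "f \<in> Arr C" "g \<in> Arr C" "h \<in> Arr C"
    "Dom C g = Dom C f" "Cod C g = Cod C f" "Dom C h = Dom C f" "Cod C h = Cod C f"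
  shows "g = h"
proof -
  have "g = arr_neg C f \<boxplus> (f \<boxplus> g)" using assms(2-) by simp
  also have "\<dots> = h" unfolding assms(1) using assms(2-) by simp
  finally show ?thesis .
qed

lemma plus_self_zero:
  assumes "f \<boxplus> f = f" "f \<in> Arr C"
  shows "f = Zero C (Dom C f) (Cod C f)"
  by (rule plus_cancel[of f]) (use assms in auto)

lemma neg_unique:
  assumes "f \<boxplus> g = Zero C a b" "f \<in> Arr C" "g \<in> Arr C"
    "Dom C f = a" "Cod C f = b" "Dom C g = a" "Cod C g = b"
  shows "g = arr_neg C f"
  by (rule plus_cancel[of f]) (use assms in auto)

lemma eq_of_diff_zero:
  assumes "f \<boxplus> arr_neg C g = Zero C a b" "f \<in> Arr C" "g \<in> Arr C"
    "Dom C f = a" "Cod C f = b" "Dom C g = a" "Cod C g = b"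
  shows "f = g"
proof -
  have "f \<boxplus> arr_neg C g = arr_neg C g \<boxplus> f" by (rule plus_comm) (use assms in auto)
  then have "arr_neg C g \<boxplus> f = Zero C a b" using assms(1) by simp
  then show ?thesis by (intro plus_cancel[of "arr_neg C g" f g]) (use assms in auto)
qed

lemma neg_neg [simp]: "f \<in> Arr C \<Longrightarrow> arr_neg C (arr_neg C f) = f"
  by (rule neg_unique[symmetric, of _ _ "Dom C f" "Cod C f"]) auto

lemma neg_zero [simp]:
  "a \<in> Obj C \<Longrightarrow> b \<in> Obj C \<Longrightarrow> arr_neg C (Zero C a b) = Zero C a b"
  by (rule neg_unique[symmetric, of _ _ a b]) auto

lemma comp_plus_left [simp]:
  assumes "f \<in> Arr C" "g \<in> Arr C" "h \<in> Arr C" "Dom C g = Cod C f" "Dom C h = Cod C f"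
    "Cod C h = Cod C g"
  shows "(g \<boxplus> h) \<cdot> f = g \<cdot> f \<boxplus> h \<cdot> f"
  using Comp_Plus_left[of f "Dom C f" "Cod C f" g "Cod C g" h] assms by auto

lemma comp_plus_right [simp]:
  assumes "f \<in> Arr C" "g \<in> Arr C" "h \<in> Arr C" "Dom C h = Cod C f" "Dom C g = Dom C f"
    "Cod C g = Cod C f"
  shows "h \<cdot> (f \<boxplus> g) = h \<cdot> f \<boxplus> h \<cdot> g"
  using Comp_Plus_right[of f "Dom C f" "Cod C f" g h "Cod C h"] assms by auto

lemma comp_zero_left [simp]:
  assumes "f \<in> Arr C" "Cod C f = b" "c \<in> Obj C"
  shows "Zero C b c \<cdot> f = Zero C (Dom C f) c"
proof -
  have "b \<in> Obj C" using assms by auto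
  have "Zero C b c \<cdot> f \<boxplus> Zero C b c \<cdot> f = (Zero C b c \<boxplus> Zero C b c) \<cdot> f"
    using assms \<open>b \<in> Obj C\<close> by (simp del: plus_zero)
  also have "\<dots> = Zero C b c \<cdot> f" using assms \<open>b \<in> Obj C\<close> by simp
  finally show ?thesis using plus_self_zero[of "Zero C b c \<cdot> f"] assms \<open>b \<in> Obj C\<close> by simp
qed

lemma comp_zero_right [simp]:
  assumes "f \<in> Arr C" "Dom C f = b" "a \<in> Obj C"
  shows "f \<cdot> Zero C a b = Zero C a (Cod C f)"
proof -
  have "b \<in> Obj C" using assms by auto
  have "f \<cdot> Zero C a b \<boxplus> f \<cdot> Zero C a b = f \<cdot> (Zero C a b \<boxplus> Zero C a b)"
    using assms \<open>b \<in> Obj C\<close> by (simp del: plus_zero)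
  also have "\<dots> = f \<cdot> Zero C a b" using assms \<open>b \<in> Obj C\<close> by simp
  finally show ?thesis using plus_self_zero[of "f \<cdot> Zero C a b"] assms \<open>b \<in> Obj C\<close> by simp
qed

lemma comp_neg_left [simp]:
  assumes "f \<in> Arr C" "g \<in> Arr C" "Dom C g = Cod C f"
  shows "arr_neg C g \<cdot> f = arr_neg C (g \<cdot> f)"
proof (rule neg_unique[of _ _ "Dom C f" "Cod C g"])
  have "g \<cdot> f \<boxplus> arr_neg C g \<cdot> f = (g \<boxplus> arr_neg C g) \<cdot> f"
    by (rule comp_plus_left[symmetric]) (use assms in auto)
  also have "\<dots> = Zero C (Dom C f) (Cod C g)" using assms by (simp del: comp_plus_left)
  finally show "g \<cdot> f \<boxplus> arr_neg C g \<cdot> f = Zero C (Dom C f) (Cod C g)" .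
qed (use assms in auto)

lemma comp_neg_right [simp]:
  assumes "f \<in> Arr C" "g \<in> Arr C" "Dom C g = Cod C f"
  shows "g \<cdot> arr_neg C f = arr_neg C (g \<cdot> f)"
proof (rule neg_unique[of _ _ "Dom C f" "Cod C g"])
  have "g \<cdot> f \<boxplus> g \<cdot> arr_neg C f = g \<cdot> (f \<boxplus> arr_neg C f)"
    by (rule comp_plus_right[symmetric]) (use assms in auto)
  also have "\<dots> = Zero C (Dom C f) (Cod C g)" using assms by (simp del: comp_plus_right)
  finally show "g \<cdot> f \<boxplus> g \<cdot> arr_neg C f = Zero C (Dom C f) (Cod C g)" .
qed (use assms in auto)

lemma neg_plus [simp]:
  assumes "f \<in> Arr C" "g \<in> Arr C" "Dom C g = Dom C f" "Cod C g = Cod C f"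
  shows "arr_neg C (f \<boxplus> g) = arr_neg C f \<boxplus> arr_neg C g"
proof (rule neg_unique[symmetric, of _ _ "Dom C f" "Cod C f"])
  have "g \<boxplus> (arr_neg C f \<boxplus> arr_neg C g) = arr_neg C f"
    using assms plus_lcomm[of "arr_neg C f" g "arr_neg C g"] by simp
  then show "f \<boxplus> g \<boxplus> (arr_neg C f \<boxplus> arr_neg C g) = Zero C (Dom C f) (Cod C f)"
    using assms by (simp add: plus_assoc)
qed (use assms in auto)

lemma epiI:
  assumes "f \<in> Arr C"
    "\<And>v. v \<in> Arr C \<Longrightarrow> Dom C v = Cod C f \<Longrightarrow> v \<cdot> f = Zero C (Dom C f) (Cod C v)
      \<Longrightarrow> v = Zero C (Cod C f) (Cod C v)"
  shows "is_epi C f"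
  unfolding is_epi_def
proof (intro conjI allI ballI impI)
  fix Y g h
  assume gh: "g \<in> Hom C (Cod C f) Y" "h \<in> Hom C (Cod C f) Y" "g \<cdot> f = h \<cdot> f"
  have "g \<boxplus> arr_neg C h = Zero C (Cod C f) Y"
    using assms(2)[of "g \<boxplus> arr_neg C h"] assms(1) gh by simp
  then show "g = h" by (rule eq_of_diff_zero) (use gh in auto)
qed fact

lemma monoI:
  assumes "f \<in> Arr C"
    "\<And>v. v \<in> Arr C \<Longrightarrow> Cod C v = Dom C f \<Longrightarrow> f \<cdot> v = Zero C (Dom C v) (Cod C f)
      \<Longrightarrow> v = Zero C (Dom C v) (Dom C f)"
  shows "is_mono C f"
  unfolding is_mono_def
proof (intro conjI allI ballI impI)
  fix Y g h
  assume gh: "g \<in> Hom C Y (Dom C f)" "h \<in> Hom C Y (Dom C f)" "f \<cdot> g = f \<cdot> h"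
  have "g \<boxplus> arr_neg C h = Zero C Y (Dom C f)"
    using assms(2)[of "g \<boxplus> arr_neg C h"] assms(1) gh by simp
  then show "g = h" by (rule eq_of_diff_zero) (use gh in auto)
qed fact

lemma epi_cancel_zero:
  assumes "is_epi C e" "g \<cdot> e = Zero C (Dom C e) (Cod C g)" "g \<in> Arr C" "Dom C g = Cod C e"
  shows "g = Zero C (Cod C e) (Cod C g)"
  by (rule epi_cancel[OF assms(1)]) (use assms in auto)

lemma mono_cancel_zero:
  assumes "is_mono C m" "m \<cdot> g = Zero C (Dom C g) (Cod C m)" "g \<in> Arr C" "Cod C g = Dom C m"
  shows "g = Zero C (Dom C g) (Dom C m)"
  by (rule mono_cancel[OF assms(1)]) (use assms in auto)

end

section \<open>Kernels, cokernels and epimorphisms in abelian categories\<close>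

context preadditive_category
begin

lemma kernelD:
  assumes "is_kernel C f k"
  shows "f \<in> Arr C" "k \<in> Arr C" "Cod C k = Dom C f" "f \<cdot> k = Zero C (Dom C k) (Cod C f)"
  using assms unfolding is_kernel_def by auto

lemma cokernelD:
  assumes "is_cokernel C f c"
  shows "f \<in> Arr C" "c \<in> Arr C" "Dom C c = Cod C f" "c \<cdot> f = Zero C (Dom C f) (Cod C c)"
  using assms unfolding is_cokernel_def by auto

lemma kernel_lift:
  assumes "is_kernel C f k" "h \<in> Arr C" "Cod C h = Dom C f" "Dom C h = a" "f \<cdot> h = Zero C a (Cod C f)"
  obtains u where "u \<in> Arr C" "Dom C u = a" "Cod C u = Dom C k" "k \<cdot> u = h"
proof -
  have "h \<in> Hom C (Dom C h) (Dom C f)" using assms(2,3) kernelD(1)[OF assms(1)] by auto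
  with assms(1,4,5) have "\<exists>u. u \<in> Hom C (Dom C h) (Dom C k) \<and> k \<cdot> u = h"
    unfolding is_kernel_def by blast
  with that assms(4) show ?thesis by auto
qed

lemma cokernel_lift:
  assumes "is_cokernel C f c" "h \<in> Arr C" "Dom C h = Cod C f" "Cod C h = b" "h \<cdot> f = Zero C (Dom C f) b"
  obtains u where "u \<in> Arr C" "Dom C u = Cod C c" "Cod C u = b" "u \<cdot> c = h"
proof -
  have "h \<in> Hom C (Cod C f) (Cod C h)" using assms(2,3) cokernelD(1)[OF assms(1)] by auto
  with assms(1,4,5) have "\<exists>u. u \<in> Hom C (Cod C c) (Cod C h) \<and> u \<cdot> c = h"
    unfolding is_cokernel_def by blast
  with that assms(4) show ?thesis by auto
qed

lemma kernel_mono: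
  assumes "is_kernel C f k"
  shows "is_mono C k"
proof (rule monoI)
  note [simp] = kernelD[OF assms]
  fix v assume [simp]: "v \<in> Arr C" "Cod C v = Dom C k" and kv: "k \<cdot> v = Zero C (Dom C v) (Cod C k)"
  have "Zero C (Dom C v) (Dom C f) \<in> Hom C (Dom C v) (Dom C f)"
    "f \<cdot> Zero C (Dom C v) (Dom C f) = Zero C (Dom C v) (Cod C f)" by simp_all
  then have "\<exists>!u. u \<in> Hom C (Dom C v) (Dom C k) \<and> k \<cdot> u = Zero C (Dom C v) (Dom C f)"
    using assms unfolding is_kernel_def by blast
  moreover have "v \<in> Hom C (Dom C v) (Dom C k) \<and> k \<cdot> v = Zero C (Dom C v) (Dom C f)"
    using kv by simp
  moreover have "Zero C (Dom C v) (Dom C k) \<in> Hom C (Dom C v) (Dom C k)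
      \<and> k \<cdot> Zero C (Dom C v) (Dom C k) = Zero C (Dom C v) (Dom C f)"
    by simp
  ultimately show "v = Zero C (Dom C v) (Dom C k)" by blast
qed (use kernelD[OF assms] in auto)

lemma cokernel_epi:
  assumes "is_cokernel C f c"
  shows "is_epi C c"
proof (rule epiI)
  note [simp] = cokernelD[OF assms]
  fix v assume [simp]: "v \<in> Arr C" "Dom C v = Cod C c" and kv: "v \<cdot> c = Zero C (Dom C c) (Cod C v)"
  have "Zero C (Cod C f) (Cod C v) \<in> Hom C (Cod C f) (Cod C v)"
    "Zero C (Cod C f) (Cod C v) \<cdot> f = Zero C (Dom C f) (Cod C v)" by simp_all
  then have "\<exists>!u. u \<in> Hom C (Cod C c) (Cod C v) \<and> u \<cdot> c = Zero C (Cod C f) (Cod C v)"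
    using assms unfolding is_cokernel_def by blast
  moreover have "v \<in> Hom C (Cod C c) (Cod C v) \<and> v \<cdot> c = Zero C (Cod C f) (Cod C v)"
    using kv by simp
  moreover have "Zero C (Cod C c) (Cod C v) \<in> Hom C (Cod C c) (Cod C v)
      \<and> Zero C (Cod C c) (Cod C v) \<cdot> c = Zero C (Cod C f) (Cod C v)"
    by simp
  ultimately show "v = Zero C (Cod C c) (Cod C v)" by blast
qed (use cokernelD[OF assms] in auto)

lemma kernelI:
  assumes "is_mono C k" "f \<in> Arr C" "Cod C k = Dom C f" "f \<cdot> k = Zero C (Dom C k) (Cod C f)"
    and lift: "\<And>h. h \<in> Arr C \<Longrightarrow> Cod C h = Dom C f \<Longrightarrow> f \<cdot> h = Zero C (Dom C h) (Cod C f)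
      \<Longrightarrow> \<exists>u. u \<in> Hom C (Dom C h) (Dom C k) \<and> k \<cdot> u = h"
  shows "is_kernel C f k"
  unfolding is_kernel_def
proof (intro conjI allI ballI impI)
  fix X h assume "h \<in> Hom C X (Dom C f)" "f \<cdot> h = Zero C X (Cod C f)"
  then obtain u where u: "u \<in> Hom C X (Dom C k)" "k \<cdot> u = h" using lift[of h] by auto
  show "\<exists>!u. u \<in> Hom C X (Dom C k) \<and> k \<cdot> u = h"
  proof (rule ex1I[of _ u], goal_cases)
    case (2 v) then show ?case by (intro mono_cancel[OF assms(1), of v u]) (use u in auto)
  qed (use u in auto)
qed (use assms in auto)

lemma cokernelI:
  assumes "is_epi C c" "f \<in> Arr C" "Dom C c = Cod C f" "c \<cdot> f = Zero C (Dom C f) (Cod C c)"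
    and lift: "\<And>h. h \<in> Arr C \<Longrightarrow> Dom C h = Cod C f \<Longrightarrow> h \<cdot> f = Zero C (Dom C f) (Cod C h)
      \<Longrightarrow> \<exists>u. u \<in> Hom C (Cod C c) (Cod C h) \<and> u \<cdot> c = h"
  shows "is_cokernel C f c"
  unfolding is_cokernel_def
proof (intro conjI allI ballI impI)
  fix X h assume "h \<in> Hom C (Cod C f) X" "h \<cdot> f = Zero C (Dom C f) X"
  then obtain u where u: "u \<in> Hom C (Cod C c) X" "u \<cdot> c = h" using lift[of h] by auto
  show "\<exists>!u. u \<in> Hom C (Cod C c) X \<and> u \<cdot> c = h"
  proof (rule ex1I[of _ u], goal_cases)
    case (2 v) then show ?case by (intro epi_cancel[OF assms(1), of v u]) (use u in auto)
  qed (use u in auto)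
qed (use assms in auto)

end

context abelian_category
begin

lemma ker_is_kernel: "f \<in> Arr C \<Longrightarrow> is_kernel C f (ker C f)"
  unfolding ker_def using has_kernels by (rule someI_ex)

lemma coker_is_cokernel: "f \<in> Arr C \<Longrightarrow> is_cokernel C f (coker C f)"
  unfolding coker_def using has_cokernels by (rule someI_ex)

lemma ker_simps [simp]:
  assumes "f \<in> Arr C"
  shows "ker C f \<in> Arr C" "Cod C (ker C f) = Dom C f"
    "f \<cdot> ker C f = Zero C (Dom C (ker C f)) (Cod C f)"
  using kernelD[OF ker_is_kernel[OF assms]] by auto

text \<open>An epimorphism is the cokernel of some \<open>g\<close>, and \<open>g\<close> factors through the kernel: an arrow killing
  the kernel kills \<open>g\<close>.\<close>

lemma epi_is_cokernel_of_kernel: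
  assumes "is_epi C f" "is_kernel C f k"
  shows "is_cokernel C k f"
proof (rule cokernelI)
  note k = kernelD[OF assms(2)]
  obtain g where g: "is_cokernel C g f" using epi_normal[OF assms(1)] ..
  note gD = cokernelD[OF g]
  obtain g' where g': "g' \<in> Arr C" "Dom C g' = Dom C g" "Cod C g' = Dom C k" "k \<cdot> g' = g"
    by (rule kernel_lift[OF assms(2), of g]) (use gD in auto)
  fix h assume h: "h \<in> Arr C" "Dom C h = Cod C k" "h \<cdot> k = Zero C (Dom C k) (Cod C h)"
  have "h \<cdot> k \<cdot> g' = Zero C (Dom C g) (Cod C h)"
    using rewrite_prefix[OF h(3), of g'] h g' k by simp
  then have "h \<cdot> g = Zero C (Dom C g) (Cod C h)" using g' by simp
  then show "\<exists>u. u \<in> Hom C (Cod C f) (Cod C h) \<and> u \<cdot> f = h"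
    using cokernel_lift[OF g, of h] h gD k by (metis Hom_iff Cod_Obj)
qed (use assms kernelD[OF assms(2)] in auto)

lemma mono_is_kernel_of_cokernel:
  assumes "is_mono C f" "is_cokernel C f c"
  shows "is_kernel C c f"
proof (rule kernelI)
  note c = cokernelD[OF assms(2)]
  obtain g where g: "is_kernel C g f" using mono_normal[OF assms(1)] ..
  note gD = kernelD[OF g]
  obtain g' where g': "g' \<in> Arr C" "Cod C g' = Cod C g" "Dom C g' = Cod C c" "g' \<cdot> c = g"
    by (rule cokernel_lift[OF assms(2), of g]) (use gD in auto)
  fix h assume h: "h \<in> Arr C" "Cod C h = Dom C c" "c \<cdot> h = Zero C (Dom C h) (Cod C c)"
  have "g \<cdot> h = g' \<cdot> c \<cdot> h" unfolding g'(4)[symmetric] using g'(1-3) h(1,2) c by simp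
  also have "\<dots> = Zero C (Dom C h) (Cod C g)"
    using g'(1-3) h c by simp
  finally show "\<exists>u. u \<in> Hom C (Dom C h) (Dom C f) \<and> f \<cdot> u = h"
    using kernel_lift[OF g, of h] h gD c by (metis Hom_iff Dom_Obj)
qed (use assms cokernelD[OF assms(2)] in auto)

lemma iso_if_mono_epi:
  assumes "is_mono C f" "is_epi C f"
  shows "is_iso C f"
proof -
  have f: "f \<in> Arr C" using assms by simp
  have "f \<cdot> ker C f = f \<cdot> Zero C (Dom C (ker C f)) (Dom C f)" using f by simp
  then have k: "ker C f = Zero C (Dom C (ker C f)) (Dom C f)"
    by (intro mono_cancel[OF assms(1), of "ker C f"]) (use f in auto)
  have *: "is_cokernel C (ker C f) f"
    using epi_is_cokernel_of_kernel[OF assms(2) ker_is_kernel] f by simp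
  have i: "Ident C (Dom C f) \<cdot> ker C f = Zero C (Dom C (ker C f)) (Dom C f)"
    using f k by simp
  obtain u where u: "u \<in> Arr C" "Dom C u = Cod C f" "Cod C u = Dom C f" "u \<cdot> f = Ident C (Dom C f)"
    by (rule cokernel_lift[OF *, of "Ident C (Dom C f)"]) (use f i in auto)
  have "(f \<cdot> u) \<cdot> f = Ident C (Cod C f) \<cdot> f" using f u by simp
  then have "f \<cdot> u = Ident C (Cod C f)"
    by (intro epi_cancel[OF assms(2), of "f \<cdot> u"]) (use f u in auto)
  then show ?thesis unfolding is_iso_def using f u by auto
qed


lemma cokernel_of_comp_epi:
  assumes "is_epi C u" "Dom C m = Cod C u" "m \<in> Arr C" "is_cokernel C (m \<cdot> u) c"
  shows "is_cokernel C m c"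
proof (rule cokernelI)
  have u: "u \<in> Arr C" using assms by simp
  note c = cokernelD[OF assms(4)]
  have "(c \<cdot> m) \<cdot> u = Zero C (Dom C (c \<cdot> m)) (Cod C (c \<cdot> m)) \<cdot> u"
    using c assms u by simp
  then show "c \<cdot> m = Zero C (Dom C m) (Cod C c)"
    by (intro epi_cancel[OF assms(1), of "c \<cdot> m"]) (use c assms u in auto)
  fix h assume h: "h \<in> Arr C" "Dom C h = Cod C m" "h \<cdot> m = Zero C (Dom C m) (Cod C h)"
  have "h \<cdot> m \<cdot> u = Zero C (Dom C u) (Cod C h)"
    using rewrite_prefix[OF h(3), of u] h assms u by simp
  then obtain v where "v \<in> Arr C" "Dom C v = Cod C c" "Cod C v = Cod C h" "v \<cdot> c = h"
    using cokernel_lift[OF assms(4), of h "Cod C h"] h assms(2,3) u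
    by (metis comp_simps(2,3))
  then show "\<exists>v. v \<in> Hom C (Cod C c) (Cod C h) \<and> v \<cdot> c = h" using c by auto
qed (use assms cokernelD[OF assms(4)] cokernel_epi in auto)

text \<open>The factorization through the kernel \<open>m\<close> of the cokernel is the least one: if \<open>v \<cdot> u = 0\<close>, then \<open>f\<close>
  factors through the smaller subobject \<open>m \<cdot> ker v\<close>. As a monomorphism this is the kernel of some \<open>q\<close>;
  \<open>q\<close> kills \<open>f\<close>, hence factors over the cokernel and kills \<open>m\<close>, so that \<open>ker v\<close> is split epi.\<close>

lemma image_factor_epi:
  assumes "is_cokernel C f c" "is_kernel C c m" "u \<in> Arr C" "Cod C u = Dom C m" "m \<cdot> u = f"
  shows "is_epi C u"
proof (rule epiI)
  note c = cokernelD[OF assms(1)] and m = kernelD[OF assms(2)]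
  fix v assume v: "v \<in> Arr C" "Dom C v = Cod C u" "v \<cdot> u = Zero C (Dom C u) (Cod C v)"
  define k where "k = ker C v"
  have k: "is_kernel C v k" unfolding k_def using v by (intro ker_is_kernel)
  note kD = kernelD[OF k]
  obtain u' where u': "u' \<in> Arr C" "Dom C u' = Dom C u" "Cod C u' = Dom C k" "k \<cdot> u' = u"
    by (rule kernel_lift[OF k, of u]) (use assms v in auto)
  have mk: "is_mono C (m \<cdot> k)"
    unfolding is_mono_def
  proof (intro conjI allI ballI impI)
    fix X g h assume gh: "g \<in> Hom C X (Dom C (m \<cdot> k))" "h \<in> Hom C X (Dom C (m \<cdot> k))"
      "(m \<cdot> k) \<cdot> g = (m \<cdot> k) \<cdot> h"
    have "k \<cdot> g = k \<cdot> h"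
      by (rule mono_cancel[OF kernel_mono[OF assms(2)]]) (use gh m kD v assms in auto)
    then show "g = h"
      by (rule mono_cancel[OF kernel_mono[OF k]]) (use gh m kD v assms in auto)
  qed (use m kD v assms in auto)
  obtain q where q: "is_kernel C q (m \<cdot> k)" using mono_normal[OF mk] by blast
  note qD = kernelD[OF q]
  have q0: "q \<cdot> m \<cdot> k = Zero C (Dom C k) (Cod C q)" and Dq: "Dom C q = Cod C m"
    using qD m kD v assms by auto
  have "q \<cdot> m \<cdot> u = q \<cdot> m \<cdot> k \<cdot> u'" using u' by simp
  also have "\<dots> = (q \<cdot> m \<cdot> k) \<cdot> u'" using qD(1) Dq m kD v assms u'(1-3) by simp
  also have "\<dots> = Zero C (Dom C u) (Cod C q)" unfolding q0 using u' kD qD by simp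
  finally have qf: "q \<cdot> f = Zero C (Dom C f) (Cod C q)"
    using assms m by auto
  obtain q' where q': "q' \<in> Arr C" "Dom C q' = Cod C c" "Cod C q' = Cod C q" "q' \<cdot> c = q"
    by (rule cokernel_lift[OF assms(1), of q]) (use qf qD(1) Dq m c in auto)
  have "q \<cdot> m = q' \<cdot> c \<cdot> m"
    unfolding q'(4)[symmetric] using q'(1-3) m c by simp
  also have "\<dots> = Zero C (Dom C m) (Cod C q)" using q' m c by simp
  finally obtain r where r: "r \<in> Arr C" "Dom C r = Dom C m" "Cod C r = Dom C (m \<cdot> k)" "(m \<cdot> k) \<cdot> r = m"
    using kernel_lift[OF q, of m "Dom C m"] Dq m by metis
  have "m \<cdot> (k \<cdot> r) = m \<cdot> Ident C (Dom C m)"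
    using r m kD v assms by simp
  then have "k \<cdot> r = Ident C (Dom C m)"
    by (rule mono_cancel[OF kernel_mono[OF assms(2)]]) (use r m kD v assms in auto)
  then have "v = v \<cdot> (k \<cdot> r)" using v assms by simp
  also have "\<dots> = (v \<cdot> k) \<cdot> r" using kD(1-3) v assms r m by simp
  also have "\<dots> = Zero C (Cod C u) (Cod C v)" unfolding kD(4) using kD v assms r m by simp
  finally show "v = Zero C (Cod C u) (Cod C v)" .
qed fact

section \<open>Direct sums and pullbacks\<close>

lemma direct_sum_simps:
  assumes "is_direct_sum C I X S \<iota> \<pi>" "i \<in> I"
  shows "X i \<in> Obj C" "\<iota> i \<in> Arr C" "Dom C (\<iota> i) = X i" "Cod C (\<iota> i) = S"
    "\<pi> i \<in> Arr C" "Dom C (\<pi> i) = S" "Cod C (\<pi> i) = X i" "\<pi> i \<cdot> \<iota> i = Ident C (X i)"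
    "j \<in> I \<Longrightarrow> i \<noteq> j \<Longrightarrow> \<pi> i \<cdot> \<iota> j = Zero C (X j) (X i)"
  using assms unfolding is_direct_sum_def by auto

lemma arr_sum_closed:
  assumes "a \<in> Obj C" "b \<in> Obj C" "\<And>i. i \<in> I \<Longrightarrow> F i \<in> Hom C a b"
  shows "arr_sum C a b F I \<in> Hom C a b"
proof -
  interpret comm_group "hom_group C a b" using hom_comm_group assms by simp
  show ?thesis using finprod_closed[of F I] assms unfolding arr_sum_def by auto
qed

lemma arr_sum_insert:
  assumes "a \<in> Obj C" "b \<in> Obj C" "\<And>i. i \<in> insert j I \<Longrightarrow> F i \<in> Hom C a b" "finite I" "j \<notin> I"
  shows "arr_sum C a b F (insert j I) = F j \<boxplus> arr_sum C a b F I"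
proof -
  interpret comm_group "hom_group C a b" using hom_comm_group assms by simp
  show ?thesis using finprod_insert[of I j F] assms unfolding arr_sum_def by (auto simp: Pi_def)
qed

lemma arr_sum_empty: "a \<in> Obj C \<Longrightarrow> b \<in> Obj C \<Longrightarrow> arr_sum C a b F {} = Zero C a b"
proof -
  assume "a \<in> Obj C" "b \<in> Obj C"
  then interpret comm_group "hom_group C a b" using hom_comm_group by simp
  show ?thesis unfolding arr_sum_def by simp
qed

lemma comp_arr_sum:
  assumes "a \<in> Obj C" "b \<in> Obj C" "g \<in> Hom C b c" "finite I" "\<And>i. i \<in> I \<Longrightarrow> F i \<in> Hom C a b"
  shows "g \<cdot> arr_sum C a b F I = arr_sum C a c (\<lambda>i. g \<cdot> F i) I"
  using assms(4,5)
proof (induction I rule: finite_induct)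
  case (insert j I)
  have "arr_sum C a b F I \<in> Hom C a b" "F j \<in> Hom C a b"
    using insert.prems assms(1,2) by (auto intro!: arr_sum_closed simp del: Hom_iff)
  moreover have "arr_sum C a c (\<lambda>i. g \<cdot> F i) (insert j I) = g \<cdot> F j \<boxplus> arr_sum C a c (\<lambda>i. g \<cdot> F i) I"
    using insert assms by (intro arr_sum_insert) auto
  moreover have "arr_sum C a b F (insert j I) = F j \<boxplus> arr_sum C a b F I"
    using insert assms by (intro arr_sum_insert) auto
  moreover have "g \<cdot> arr_sum C a b F I = arr_sum C a c (\<lambda>i. g \<cdot> F i) I"
    by (rule insert.IH) (use insert.prems in blast)
  ultimately show ?case using assms by auto
qed (use assms in \<open>auto simp: arr_sum_empty\<close>)

lemma arr_sum_comp:
  assumes "a \<in> Obj C" "b \<in> Obj C" "g \<in> Hom C c a" "finite I" "\<And>i. i \<in> I \<Longrightarrow> F i \<in> Hom C a b"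
  shows "arr_sum C a b F I \<cdot> g = arr_sum C c b (\<lambda>i. F i \<cdot> g) I"
  using assms(4,5)
proof (induction I rule: finite_induct)
  case (insert j I)
  have "arr_sum C a b F I \<in> Hom C a b" "F j \<in> Hom C a b"
    using insert.prems assms(1,2) by (auto intro!: arr_sum_closed simp del: Hom_iff)
  moreover have "arr_sum C c b (\<lambda>i. F i \<cdot> g) (insert j I) = F j \<cdot> g \<boxplus> arr_sum C c b (\<lambda>i. F i \<cdot> g) I"
    using insert assms by (intro arr_sum_insert) auto
  moreover have "arr_sum C a b F (insert j I) = F j \<boxplus> arr_sum C a b F I"
    using insert assms by (intro arr_sum_insert) auto
  moreover have "arr_sum C a b F I \<cdot> g = arr_sum C c b (\<lambda>i. F i \<cdot> g) I"
    by (rule insert.IH) (use insert.prems in blast)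
  ultimately show ?case using assms by auto
qed (use assms in \<open>auto simp: arr_sum_empty\<close>)

lemma arr_sum_cong:
  assumes "\<And>i. i \<in> I \<Longrightarrow> F i = G i" "a \<in> Obj C" "b \<in> Obj C" "\<And>i. i \<in> I \<Longrightarrow> G i \<in> Hom C a b"
  shows "arr_sum C a b F I = arr_sum C a b G I"
proof -
  interpret comm_group "hom_group C a b" using hom_comm_group assms by simp
  show ?thesis unfolding arr_sum_def by (rule finprod_cong') (use assms in auto)
qed

lemma arr_sum_single:
  assumes "finite I" "i \<in> I" "a \<in> Obj C" "b \<in> Obj C" "F i \<in> Hom C a b"
    "\<And>j. j \<in> I \<Longrightarrow> j \<noteq> i \<Longrightarrow> F j = Zero C a b"
  shows "arr_sum C a b F I = F i"
proof -
  interpret comm_group "hom_group C a b" using hom_comm_group assms by simp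
  have "arr_sum C a b F I = arr_sum C a b (\<lambda>j. if i = j then F i else \<one>\<^bsub>hom_group C a b\<^esub>) I"
    by (rule arr_sum_cong) (use assms in auto)
  also have "\<dots> = F i"
    unfolding arr_sum_def by (rule finprod_singleton) (use assms in auto)
  finally show ?thesis .
qed

lemma arr_sum_plus:
  assumes "a \<in> Obj C" "b \<in> Obj C" "\<And>i. i \<in> I \<Longrightarrow> F i \<in> Hom C a b" "\<And>i. i \<in> I \<Longrightarrow> G i \<in> Hom C a b"
  shows "arr_sum C a b (\<lambda>i. F i \<boxplus> G i) I = arr_sum C a b F I \<boxplus> arr_sum C a b G I"
proof -
  interpret comm_group "hom_group C a b" using hom_comm_group assms by simp
  show ?thesis using finprod_multf[of F I G] assms unfolding arr_sum_def by auto
qed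

lemma into_direct_sum_eqI:
  assumes S: "is_direct_sum C I X S \<iota> \<pi>" and f: "f \<in> Hom C A S" "g \<in> Hom C A S"
    and eq: "\<And>i. i \<in> I \<Longrightarrow> \<pi> i \<cdot> f = \<pi> i \<cdot> g"
  shows "f = g"
proof -
  note s = direct_sum_simps[OF S]
  have I: "finite I" "S \<in> Obj C" "arr_sum C S S (\<lambda>i. \<iota> i \<cdot> \<pi> i) I = Ident C S"
    using S unfolding is_direct_sum_def by auto
  have *: "arr_sum C A S (\<lambda>i. (\<iota> i \<cdot> \<pi> i) \<cdot> h) I = h" if "h \<in> Hom C A S" for h
  proof -
    have "arr_sum C A S (\<lambda>i. (\<iota> i \<cdot> \<pi> i) \<cdot> h) I = arr_sum C S S (\<lambda>i. \<iota> i \<cdot> \<pi> i) I \<cdot> h"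
      by (rule arr_sum_comp[symmetric]) (use I s that in auto)
    then show ?thesis using I that by simp
  qed
  have "f = arr_sum C A S (\<lambda>i. (\<iota> i \<cdot> \<pi> i) \<cdot> f) I" using *[OF f(1)] ..
  also have "\<dots> = arr_sum C A S (\<lambda>i. (\<iota> i \<cdot> \<pi> i) \<cdot> g) I"
    by (rule arr_sum_cong) (use s eq f in auto)
  also have "\<dots> = g" using *[OF f(2)] .
  finally show ?thesis .
qed

lemma into_direct_sum:
  assumes S: "is_direct_sum C I X S \<iota> \<pi>" and "A \<in> Obj C" and w: "\<And>i. i \<in> I \<Longrightarrow> w i \<in> Hom C A (X i)"
  obtains W where "W \<in> Hom C A S" "\<And>i. i \<in> I \<Longrightarrow> \<pi> i \<cdot> W = w i"
proof
  note s = direct_sum_simps[OF S]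
  have I: "finite I" "S \<in> Obj C" using S unfolding is_direct_sum_def by auto
  have iw: "\<iota> i \<cdot> w i \<in> Hom C A S" if "i \<in> I" for i using s w that I by auto
  show "arr_sum C A S (\<lambda>i. \<iota> i \<cdot> w i) I \<in> Hom C A S"
    by (rule arr_sum_closed) (use I iw assms in auto)
  fix i assume i: "i \<in> I"
  have *: "\<pi> i \<cdot> \<iota> j \<cdot> w j = (if i = j then w i else Zero C A (X i))" if "j \<in> I" for j
  proof -
    have "\<pi> i \<cdot> \<iota> j \<cdot> w j = (\<pi> i \<cdot> \<iota> j) \<cdot> w j" using s[OF i] s[OF that] w[OF that] by simp
    also have "\<dots> = (if i = j then w i else Zero C A (X i))"
      using s(9)[OF i that] s(1,8)[OF i] w[OF that] by auto
    finally show ?thesis .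
  qed
  have "\<pi> i \<in> Hom C S (X i)" using s i I by auto
  then have "\<pi> i \<cdot> arr_sum C A S (\<lambda>i. \<iota> i \<cdot> w i) I = arr_sum C A (X i) (\<lambda>j. \<pi> i \<cdot> \<iota> j \<cdot> w j) I"
    by (intro comp_arr_sum) (use I iw assms(2) in auto)
  also have "\<dots> = \<pi> i \<cdot> \<iota> i \<cdot> w i"
    by (rule arr_sum_single) (use I i * w[OF i] in auto)
  finally show "\<pi> i \<cdot> arr_sum C A S (\<lambda>i. \<iota> i \<cdot> w i) I = w i" using *[OF i] by simp
qed

text \<open>Epimorphisms are stable under pullback. The pullback of \<open>f\<close> and \<open>h\<close> is the kernel of
  \<open>\<phi> = f \<pi>\<^sub>0 - h \<pi>\<^sub>1\<close> on the direct sum. Since \<open>\<phi>\<close> restricts to the epimorphism \<open>f\<close>, it is the cokernel of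
  that kernel; so if \<open>v \<pi>\<^sub>1\<close> vanishes on the pullback, then \<open>v \<pi>\<^sub>1 = r \<phi>\<close>, and restriction to the first
  summand gives \<open>r f = 0\<close>, whence \<open>v = 0\<close>.\<close>

lemma epi_lift:
  assumes "is_epi C f" "h \<in> Arr C" "Cod C h = Cod C f"
  obtains e a where "is_epi C e" "Cod C e = Dom C h" "a \<in> Arr C" "Dom C a = Dom C e"
    "Cod C a = Dom C f" "f \<cdot> a = h \<cdot> e"
proof -
  have f: "f \<in> Arr C" using assms by simp
  define X where "X i = (if i = (0::nat) then Dom C f else Dom C h)" for i
  obtain S \<iota> \<pi> where S: "is_direct_sum C {..<2::nat} X S \<iota> \<pi>"
    using has_direct_sums[of 2 X] f assms unfolding X_def by fastforce
  have [simp]: "X 0 = Dom C f" "X (Suc 0) = Dom C h" by (auto simp: X_def)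
  have s: "S \<in> Obj C" "\<iota> 0 \<in> Arr C" "Dom C (\<iota> 0) = Dom C f" "Cod C (\<iota> 0) = S"
    "\<pi> 0 \<in> Arr C" "Dom C (\<pi> 0) = S" "Cod C (\<pi> 0) = Dom C f"
    "\<pi> 1 \<in> Arr C" "Dom C (\<pi> 1) = S" "Cod C (\<pi> 1) = Dom C h"
    and p: "\<pi> 0 \<cdot> \<iota> 0 = Ident C (Dom C f)" "\<pi> 1 \<cdot> \<iota> 0 = Zero C (Dom C f) (Dom C h)"
    using direct_sum_simps[OF S, of 0] direct_sum_simps[OF S, of 1]
      direct_sum_simps(9)[OF S, of 1 0] S
    by (auto simp: is_direct_sum_def)
  define \<phi> where "\<phi> = f \<cdot> \<pi> 0 \<boxplus> arr_neg C (h \<cdot> \<pi> 1)"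
  have \<phi>: "\<phi> \<in> Arr C" "Dom C \<phi> = S" "Cod C \<phi> = Cod C f"
    using s f assms by (simp_all add: \<phi>_def)
  have phi0: "\<phi> \<cdot> \<iota> 0 = f" using s p f assms by (simp add: \<phi>_def)
  have "is_epi C \<phi>" by (rule epi_of_comp[of _ "\<iota> 0"]) (use phi0 assms \<phi> s in auto)
  then have ck: "is_cokernel C (ker C \<phi>) \<phi>" using epi_is_cokernel_of_kernel ker_is_kernel \<phi> by blast
  define k where "k = ker C \<phi>"
  have k: "k \<in> Arr C" "Cod C k = S" "\<phi> \<cdot> k = Zero C (Dom C k) (Cod C f)"
    using \<phi> by (auto simp: k_def)
  have "f \<cdot> \<pi> 0 \<cdot> k = h \<cdot> \<pi> 1 \<cdot> k"
  proof (rule eq_of_diff_zero[of _ _ "Dom C k" "Cod C f"])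
    have "\<phi> \<cdot> k = f \<cdot> \<pi> 0 \<cdot> k \<boxplus> arr_neg C (h \<cdot> \<pi> 1 \<cdot> k)"
      using k(1,2) s f assms by (simp add: \<phi>_def)
    then show "f \<cdot> \<pi> 0 \<cdot> k \<boxplus> arr_neg C (h \<cdot> \<pi> 1 \<cdot> k) = Zero C (Dom C k) (Cod C f)"
      using k(3) by simp
  qed (use k(1,2) s f assms in auto)
  moreover have "is_epi C (\<pi> 1 \<cdot> k)"
  proof (rule epiI)
    fix v assume v: "v \<in> Arr C" "Dom C v = Cod C (\<pi> 1 \<cdot> k)"
      "v \<cdot> \<pi> 1 \<cdot> k = Zero C (Dom C (\<pi> 1 \<cdot> k)) (Cod C v)"
    obtain r where r: "r \<in> Arr C" "Dom C r = Cod C \<phi>" "Cod C r = Cod C v" "r \<cdot> \<phi> = v \<cdot> \<pi> 1"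
      by (rule cokernel_lift[OF ck[folded k_def], of "v \<cdot> \<pi> 1"]) (use v k s in auto)
    have "r \<cdot> f = (r \<cdot> \<phi>) \<cdot> \<iota> 0" using r(1-3) phi0 \<phi> s by simp
    also have "\<dots> = Zero C (Dom C f) (Cod C v)"
      unfolding r(4) using v(1,2) p s k f assms(2) by simp
    finally have "r = Zero C (Cod C f) (Cod C v)"
      using epi_cancel_zero[OF assms(1), of r] r \<phi> by simp
    then have "v \<cdot> \<pi> 1 = Zero C S (Cod C v)" using r(4) \<phi> v(1) by simp
    moreover have "is_epi C (\<pi> 1)"
    proof -
      have "is_epi C (\<pi> 1 \<cdot> \<iota> 1)"
        using direct_sum_simps(8)[OF S, of 1] epi_ident assms by simp
      then show ?thesis by (rule epi_of_comp) (use direct_sum_simps[OF S, of 1] in auto)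
    qed
    ultimately show "v = Zero C (Cod C (\<pi> 1 \<cdot> k)) (Cod C v)"
      using epi_cancel_zero[of "\<pi> 1" v] v k s by simp
  qed (use k s in auto)
  ultimately show ?thesis using that[of "\<pi> 1 \<cdot> k" "\<pi> 0 \<cdot> k"] k s by auto
qed

section \<open>Exactness by chasing generalized elements\<close>

text \<open>It suffices to chase the universal element killed by \<open>g\<close>, its kernel \<open>m\<close>: a local lift of \<open>m\<close>
  through \<open>f\<close> shows that the factor of \<open>f\<close> over \<open>m\<close> is epi, so that \<open>m\<close> is the image of \<open>f\<close>.\<close>

lemma exact_atI:
  assumes fg: "f \<in> Arr C" "g \<in> Arr C" "Dom C g = Cod C f" "g \<cdot> f = Zero C (Dom C f) (Cod C g)"
    and chase: "\<And>x. x \<in> Arr C \<Longrightarrow> Cod C x = Dom C g \<Longrightarrow> g \<cdot> x = Zero C (Dom C x) (Cod C g) \<Longrightarrow>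
      \<exists>e a. is_epi C e \<and> Cod C e = Dom C x \<and> a \<in> Hom C (Dom C e) (Dom C f) \<and> f \<cdot> a = x \<cdot> e"
  shows "exact_at C f g"
proof -
  define m where "m = ker C g"
  have m: "is_kernel C g m" unfolding m_def using fg by (intro ker_is_kernel)
  note mD = kernelD[OF m]
  obtain u where u: "u \<in> Arr C" "Dom C u = Dom C f" "Cod C u = Dom C m" "m \<cdot> u = f"
    by (rule kernel_lift[OF m, of f]) (use fg in auto)
  obtain e a where e: "is_epi C e" "Cod C e = Dom C m" "a \<in> Hom C (Dom C e) (Dom C f)" "f \<cdot> a = m \<cdot> e"
    using chase[of m] mD by auto
  have "m \<cdot> (u \<cdot> a) = f \<cdot> a" unfolding u(4)[symmetric] using u(1-3) e(3) mD by simp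
  then have "m \<cdot> (u \<cdot> a) = m \<cdot> e" using e by simp
  then have "u \<cdot> a = e"
    by (rule mono_cancel[OF kernel_mono[OF m]]) (use e u(1-3) mD in auto)
  then have "is_epi C u" using epi_of_comp[of u a] e u(1-3) by auto
  then have "is_cokernel C m (coker C f)"
    using cokernel_of_comp_epi[of u m "coker C f"] u mD coker_is_cokernel fg by auto
  then have "is_kernel C (coker C f) m" using mono_is_kernel_of_cokernel kernel_mono[OF m] by auto
  then show ?thesis unfolding exact_at_def is_image_def using m fg coker_is_cokernel by auto
qed

lemma exact_atD:
  assumes "exact_at C f g"
  shows "f \<in> Arr C" "g \<in> Arr C" "Dom C g = Cod C f" "g \<cdot> f = Zero C (Dom C f) (Cod C g)"
    and "\<And>x thesis. x \<in> Arr C \<Longrightarrow> Cod C x = Dom C g \<Longrightarrow> g \<cdot> x = Zero C (Dom C x) (Cod C g) \<Longrightarrow>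
      (\<And>e a. is_epi C e \<Longrightarrow> Cod C e = Dom C x \<Longrightarrow> a \<in> Arr C \<Longrightarrow> Dom C a = Dom C e \<Longrightarrow>
        Cod C a = Dom C f \<Longrightarrow> f \<cdot> a = x \<cdot> e \<Longrightarrow> thesis) \<Longrightarrow> thesis"
proof -
  obtain m c where m: "is_kernel C g m" and c: "is_cokernel C f c" "is_kernel C c m" and fg: "Cod C f = Dom C g"
    using assms unfolding exact_at_def is_image_def by blast
  note mD = kernelD[OF m] and cD = cokernelD[OF c(1)] and kD = kernelD[OF c(2)]
  show *: "f \<in> Arr C" "g \<in> Arr C" "Dom C g = Cod C f" using mD cD fg by auto
  obtain u where u: "u \<in> Arr C" "Dom C u = Dom C f" "Cod C u = Dom C m" "m \<cdot> u = f"
    by (rule kernel_lift[OF c(2), of f]) (use cD in auto)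
  have u_epi: "is_epi C u" by (rule image_factor_epi[OF c u(1,3,4)])
  have "g \<cdot> f = (g \<cdot> m) \<cdot> u" unfolding u(4)[symmetric] using mD(1-3) u(1-3) by simp
  then show "g \<cdot> f = Zero C (Dom C f) (Cod C g)" using mD u(1-3) by simp
  fix x thesis
  assume x: "x \<in> Arr C" "Cod C x = Dom C g" "g \<cdot> x = Zero C (Dom C x) (Cod C g)"
    and that: "(\<And>e a. is_epi C e \<Longrightarrow> Cod C e = Dom C x \<Longrightarrow> a \<in> Arr C \<Longrightarrow> Dom C a = Dom C e \<Longrightarrow>
        Cod C a = Dom C f \<Longrightarrow> f \<cdot> a = x \<cdot> e \<Longrightarrow> thesis)"
  obtain y where y: "y \<in> Arr C" "Dom C y = Dom C x" "Cod C y = Dom C m" "m \<cdot> y = x"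
    by (rule kernel_lift[OF m, of x]) (use x in auto)
  obtain e a where e: "is_epi C e" "Cod C e = Dom C y" "a \<in> Arr C" "Dom C a = Dom C e"
    "Cod C a = Dom C u" "u \<cdot> a = y \<cdot> e"
    by (rule epi_lift[OF u_epi y(1)]) (use y u in auto)
  have "f \<cdot> a = m \<cdot> (u \<cdot> a)" unfolding u(4)[symmetric] using u(1-3) e(1-5) mD by simp
  also have "\<dots> = (m \<cdot> y) \<cdot> e" unfolding e(6) using y(1-3) e(1-5) mD by simp
  finally have "f \<cdot> a = x \<cdot> e" unfolding y(4) .
  then show thesis using that[of e a] e y u by simp
qed

end

section \<open>Homology classes of generalized cycles\<close>

lemma (in category) complexD:
  assumes "is_complex C X d"
  shows "X n \<in> Obj C" "d n \<in> Arr C" "Dom C (d n) = X n" "Cod C (d n) = X (n - 1)"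
    "d n \<cdot> d (n + 1) = Zero C (X (n + 1)) (X (n - 1))"
proof -
  have *: "\<And>n. X n \<in> Obj C \<and> d n \<in> Hom C (X n) (X (n - 1)) \<and> d (n - 1) \<cdot> d n = Zero C (X n) (X (n - 2))"
    using assms unfolding is_complex_def by blast
  show "X n \<in> Obj C" "d n \<in> Arr C" "Dom C (d n) = X n" "Cod C (d n) = X (n - 1)" using *[of n] by auto
  show "d n \<cdot> d (n + 1) = Zero C (X (n + 1)) (X (n - 1))" using *[of "n + 1"] by simp
qed

lemma (in category) chain_mapD:
  assumes "is_chain_map C X d Y e f"
  shows "f n \<in> Arr C" "Dom C (f n) = X n" "Cod C (f n) = Y n" "e n \<cdot> f n = f (n - 1) \<cdot> d n"
    "e (n + 1) \<cdot> f (n + 1) = f n \<cdot> d (n + 1)"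
proof -
  have *: "\<And>n. f n \<in> Hom C (X n) (Y n) \<and> e n \<cdot> f n = f (n - 1) \<cdot> d n"
    using assms unfolding is_chain_map_def by blast
  show "f n \<in> Arr C" "Dom C (f n) = X n" "Cod C (f n) = Y n" "e n \<cdot> f n = f (n - 1) \<cdot> d n"
    using *[of n] by auto
  show "e (n + 1) \<cdot> f (n + 1) = f n \<cdot> d (n + 1)" using *[of "n + 1"] by simp
qed

text \<open>The class \<open>A \<rightarrow> H\<^sub>n\<close> of a cycle \<open>x : A \<rightarrow> X n\<close>. If \<open>x\<close> is not a cycle, the lift to \<open>Ker (d n)\<close> does not
  exist and the value is unspecified.\<close>

definition homology_class :: "('o, 'm, 'b) precategory_scheme \<Rightarrow> (int \<Rightarrow> 'm) \<Rightarrow> int \<Rightarrow> 'm \<Rightarrow> 'm" where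
  "homology_class C d n x = homology_proj C d n \<cdot>\<^bsub>C\<^esub>
    (THE u. u \<in> Hom C (Dom C x) (Dom C (ker C (d n))) \<and> ker C (d n) \<cdot>\<^bsub>C\<^esub> u = x)"

context abelian_category
begin

lemma the_lift:
  assumes "f \<in> Arr C" "u \<in> Arr C" "Cod C u = Dom C (ker C f)" "ker C f \<cdot> u = x" "Dom C u = a"
  shows "(THE u. u \<in> Hom C a (Dom C (ker C f)) \<and> ker C f \<cdot> u = x) = u"
proof (rule the_equality)
  note k = ker_is_kernel[OF assms(1)]
  fix v assume "v \<in> Hom C a (Dom C (ker C f)) \<and> ker C f \<cdot> v = x"
  then show "v = u"
    by (intro mono_cancel[OF kernel_mono[OF k], of v u]) (use assms in auto)
qed (use assms in auto)

lemma boundary_simps: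
  assumes "is_complex C X d"
  shows "boundary C d n \<in> Arr C" "Dom C (boundary C d n) = X (n + 1)"
    "Cod C (boundary C d n) = Dom C (ker C (d n))" "ker C (d n) \<cdot> boundary C d n = d (n + 1)"
proof -
  note c = complexD[OF assms]
  note k = ker_is_kernel[OF c(2)[of n]]
  obtain u where u: "u \<in> Arr C" "Dom C u = X (n + 1)" "Cod C u = Dom C (ker C (d n))"
    "ker C (d n) \<cdot> u = d (n + 1)"
    by (rule kernel_lift[OF k, of "d (n + 1)"]) (use c[of n] c[of "n + 1"] in auto)
  have "boundary C d n = u"
    unfolding boundary_def by (rule the_lift) (use u c in auto)
  then show "boundary C d n \<in> Arr C" "Dom C (boundary C d n) = X (n + 1)"
    "Cod C (boundary C d n) = Dom C (ker C (d n))" "ker C (d n) \<cdot> boundary C d n = d (n + 1)"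
    using u by auto
qed

lemma homology_proj_cokernel:
  assumes "is_complex C X d"
  shows "is_cokernel C (boundary C d n) (homology_proj C d n)"
  unfolding homology_proj_def using boundary_simps[OF assms] by (intro coker_is_cokernel)

lemma homology_proj_simps:
  assumes "is_complex C X d"
  shows "homology_proj C d n \<in> Arr C" "Dom C (homology_proj C d n) = Dom C (ker C (d n))"
    "Cod C (homology_proj C d n) = homology C d n" "homology C d n \<in> Obj C"
    "is_epi C (homology_proj C d n)"
    "homology_proj C d n \<cdot> boundary C d n = Zero C (X (n + 1)) (homology C d n)"
  using cokernelD[OF homology_proj_cokernel[OF assms, of n]] boundary_simps[OF assms, of n]
    cokernel_epi[OF homology_proj_cokernel[OF assms, of n]]
  by (auto simp: homology_def)

lemma homology_classI:
  assumes "is_complex C X d" "u \<in> Arr C" "Cod C u = Dom C (ker C (d n))" "ker C (d n) \<cdot> u = x"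
  shows "homology_class C d n x = homology_proj C d n \<cdot> u"
  unfolding homology_class_def
  by (subst the_lift[of "d n" u]) (use assms complexD[OF assms(1)] in auto)

lemma cycle_lift:
  assumes "is_complex C X d" "x \<in> Arr C" "Cod C x = X n" "Dom C x = a" "d n \<cdot> x = Zero C a (X (n - 1))"
  obtains u where "u \<in> Arr C" "Dom C u = a" "Cod C u = Dom C (ker C (d n))" "ker C (d n) \<cdot> u = x"
  by (rule kernel_lift[OF ker_is_kernel[of "d n"], of x a]) (use assms complexD[OF assms(1)] in auto)

lemma homology_class_simps:
  assumes "is_complex C X d" "x \<in> Arr C" "Cod C x = X n" "d n \<cdot> x = Zero C (Dom C x) (X (n - 1))"
  shows "homology_class C d n x \<in> Arr C" "Dom C (homology_class C d n x) = Dom C x" "Cod C (homology_class C d n x) = homology C d n"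
proof -
  obtain u where u: "u \<in> Arr C" "Dom C u = Dom C x" "Cod C u = Dom C (ker C (d n))" "ker C (d n) \<cdot> u = x"
    by (rule cycle_lift[OF assms(1-3) refl assms(4)])
  show "homology_class C d n x \<in> Arr C" "Dom C (homology_class C d n x) = Dom C x" "Cod C (homology_class C d n x) = homology C d n"
    using homology_classI[OF assms(1) u(1,3,4)] u homology_proj_simps[OF assms(1), of n] by auto
qed

lemma homology_class_comp:
  assumes "is_complex C X d" "x \<in> Arr C" "Cod C x = X n" "d n \<cdot> x = Zero C (Dom C x) (X (n - 1))"
    "e \<in> Arr C" "Cod C e = Dom C x"
  shows "homology_class C d n (x \<cdot> e) = homology_class C d n x \<cdot> e"
proof -
  note c = complexD[OF assms(1)] and h = homology_proj_simps[OF assms(1)]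
  obtain u where u: "u \<in> Arr C" "Dom C u = Dom C x" "Cod C u = Dom C (ker C (d n))" "ker C (d n) \<cdot> u = x"
    by (rule cycle_lift[OF assms(1-3) refl assms(4)])
  have "ker C (d n) \<cdot> (u \<cdot> e) = (ker C (d n) \<cdot> u) \<cdot> e"
    using u(1-3) assms(5,6) c by simp
  then have "homology_class C d n (x \<cdot> e) = homology_proj C d n \<cdot> (u \<cdot> e)"
    by (intro homology_classI[OF assms(1)]) (use u assms(5,6) in auto)
  moreover have "homology_class C d n x = homology_proj C d n \<cdot> u"
    by (rule homology_classI[OF assms(1) u(1,3,4)])
  ultimately show ?thesis using u(1-3) h assms(5,6) by simp
qed

lemma homology_class_plus:
  assumes "is_complex C X d" "x \<in> Arr C" "Cod C x = X n" "d n \<cdot> x = Zero C (Dom C x) (X (n - 1))"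
    "y \<in> Arr C" "Cod C y = X n" "Dom C y = Dom C x" "d n \<cdot> y = Zero C (Dom C y) (X (n - 1))"
  shows "homology_class C d n (x \<boxplus> y) = homology_class C d n x \<boxplus> homology_class C d n y"
proof -
  note c = complexD[OF assms(1)] and h = homology_proj_simps[OF assms(1)]
  obtain u where u: "u \<in> Arr C" "Dom C u = Dom C x" "Cod C u = Dom C (ker C (d n))" "ker C (d n) \<cdot> u = x"
    by (rule cycle_lift[OF assms(1-3) refl assms(4)])
  obtain v where v: "v \<in> Arr C" "Dom C v = Dom C y" "Cod C v = Dom C (ker C (d n))" "ker C (d n) \<cdot> v = y"
    by (rule cycle_lift[OF assms(1,5,6) refl assms(8)])
  have "homology_class C d n (x \<boxplus> y) = homology_proj C d n \<cdot> (u \<boxplus> v)"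
    by (intro homology_classI[OF assms(1)]) (use u v assms(7) c in auto)
  moreover have "homology_class C d n x = homology_proj C d n \<cdot> u"
    by (rule homology_classI[OF assms(1) u(1,3,4)])
  moreover have "homology_class C d n y = homology_proj C d n \<cdot> v"
    by (rule homology_classI[OF assms(1) v(1,3,4)])
  ultimately show ?thesis using u(1-3) v(1-3) h assms(7) by simp
qed

lemma homology_class_boundary:
  assumes "is_complex C X d" "y \<in> Arr C" "Cod C y = X (n + 1)"
  shows "homology_class C d n (d (n + 1) \<cdot> y) = Zero C (Dom C y) (homology C d n)"
proof -
  note h = homology_proj_simps[OF assms(1)] and b = boundary_simps[OF assms(1)]
  note c = complexD[OF assms(1)]
  have "ker C (d n) \<cdot> (boundary C d n \<cdot> y) = (ker C (d n) \<cdot> boundary C d n) \<cdot> y"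
    using b(1-3)[of n] c assms(2,3) by simp
  then have "ker C (d n) \<cdot> (boundary C d n \<cdot> y) = d (n + 1) \<cdot> y" unfolding b(4) .
  then have "homology_class C d n (d (n + 1) \<cdot> y) = homology_proj C d n \<cdot> (boundary C d n \<cdot> y)"
    by (intro homology_classI[OF assms(1)]) (use b[of n] assms in auto)
  also have "\<dots> = (homology_proj C d n \<cdot> boundary C d n) \<cdot> y"
    using b(1-3)[of n] h(1-4) assms(2,3) by simp
  also have "\<dots> = Zero C (Dom C y) (homology C d n)"
    unfolding h(6) using h assms(2,3) by simp
  finally show ?thesis .
qed

lemma homology_class_of_zero:
  assumes "is_complex C X d" "a \<in> Obj C"
  shows "homology_class C d n (Zero C a (X n)) = Zero C a (homology C d n)"
  using homology_class_boundary[OF assms(1), of "Zero C a (X (n + 1))" n] complexD[OF assms(1)] assms(2) by simp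

lemma homology_element:
  assumes "is_complex C X d" "h \<in> Arr C" "Cod C h = homology C d n"
  obtains e x where "is_epi C e" "Cod C e = Dom C h" "x \<in> Arr C" "Dom C x = Dom C e" "Cod C x = X n"
    "d n \<cdot> x = Zero C (Dom C e) (X (n - 1))" "h \<cdot> e = homology_class C d n x"
proof -
  note c = complexD[OF assms(1)] and p = homology_proj_simps[OF assms(1)]
  obtain e u where e: "is_epi C e" "Cod C e = Dom C h" "u \<in> Arr C" "Dom C u = Dom C e"
    "Cod C u = Dom C (homology_proj C d n)" "homology_proj C d n \<cdot> u = h \<cdot> e"
    by (rule epi_lift[OF p(5)[of n] assms(2)]) (use p assms in auto)
  have "d n \<cdot> ker C (d n) \<cdot> u = (d n \<cdot> ker C (d n)) \<cdot> u"
    using c e p by (simp del: ker_simps(3))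
  also have "\<dots> = Zero C (Dom C e) (X (n - 1))" using c e p by simp
  finally have "d n \<cdot> ker C (d n) \<cdot> u = Zero C (Dom C e) (X (n - 1))" .
  moreover have "h \<cdot> e = homology_class C d n (ker C (d n) \<cdot> u)"
    using homology_classI[OF assms(1) e(3), of n] e p by simp
  ultimately show ?thesis using that[of e "ker C (d n) \<cdot> u"] e c p by simp
qed

text \<open>The image of \<open>boundary C d n\<close> is the kernel of its cokernel, so a lift of \<open>x\<close> to the cycles whose
  class is zero locally comes from \<open>X (n + 1)\<close>.\<close>

lemma boundary_if_class_zero:
  assumes "is_complex C X d" "x \<in> Arr C" "Cod C x = X n" "d n \<cdot> x = Zero C (Dom C x) (X (n - 1))"
    "homology_class C d n x = Zero C (Dom C x) (homology C d n)"
  obtains e y where "is_epi C e" "Cod C e = Dom C x" "y \<in> Arr C" "Dom C y = Dom C e"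
    "Cod C y = X (n + 1)" "d (n + 1) \<cdot> y = x \<cdot> e"
proof -
  note c = complexD[OF assms(1)] and p = homology_proj_simps[OF assms(1), of n]
  note b = boundary_simps[OF assms(1), of n]
  obtain u where u: "u \<in> Arr C" "Dom C u = Dom C x" "Cod C u = Dom C (ker C (d n))" "ker C (d n) \<cdot> u = x"
    by (rule cycle_lift[OF assms(1-3) refl assms(4)])
  have pu: "homology_proj C d n \<cdot> u = Zero C (Dom C u) (Cod C (homology_proj C d n))"
    using homology_classI[OF assms(1) u(1,3,4)] assms(5) u p by simp
  have "exact_at C (boundary C d n) (homology_proj C d n)"
    unfolding exact_at_def is_image_def
    using homology_proj_cokernel[OF assms(1), of n] ker_is_kernel[OF p(1)] p b by auto
  from exact_atD(5)[OF this u(1) _ pu] u p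
  obtain e y where e: "is_epi C e" "Cod C e = Dom C u" "y \<in> Arr C" "Dom C y = Dom C e"
    "Cod C y = Dom C (boundary C d n)" "boundary C d n \<cdot> y = u \<cdot> e"
    by metis
  have "d (n + 1) \<cdot> y = ker C (d n) \<cdot> (boundary C d n \<cdot> y)"
    unfolding b(4)[symmetric] using b(1-3) e(1-5) c by simp
  also have "\<dots> = x \<cdot> e"
    unfolding e(6) u(4)[symmetric] using u(1-3) e(1-5) c by simp
  finally show ?thesis using that[of e y] e u b by simp
qed

lemma chain_map_cycle:
  assumes X: "is_complex C X d" and Y: "is_complex C Y d'" and f: "is_chain_map C X d Y d' f"
    and x: "x \<in> Arr C" "Cod C x = X n" "d n \<cdot> x = Zero C (Dom C x) (X (n - 1))"
  shows "d' n \<cdot> (f n \<cdot> x) = Zero C (Dom C x) (Y (n - 1))"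
proof -
  note c = complexD[OF X] and c' = complexD[OF Y] and fD = chain_mapD[OF f]
  have "d' n \<cdot> (f n \<cdot> x) = (d' n \<cdot> f n) \<cdot> x" using x(1,2) fD(1-3) c' by simp
  also have "\<dots> = f (n - 1) \<cdot> (d n \<cdot> x)" unfolding fD(4) using x(1,2) fD(1-3) c by simp
  also have "\<dots> = Zero C (Dom C x) (Y (n - 1))" unfolding x(3) using x(1) fD(1-3) by simp
  finally show ?thesis .
qed

text \<open>Both descriptions by \<open>THE\<close> are met by the arrows that the universal properties of kernel and
  cokernel provide; on classes the induced map is then application of \<open>f\<close>.\<close>

lemma homology_map_simps:
  assumes X: "is_complex C X d" and Y: "is_complex C Y d'" and f: "is_chain_map C X d Y d' f"
  shows "homology_map C d d' f n \<in> Arr C" "Dom C (homology_map C d d' f n) = homology C d n"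
    "Cod C (homology_map C d d' f n) = homology C d' n"
    and homology_map_class: "\<lbrakk>x \<in> Arr C; Cod C x = X n; d n \<cdot> x = Zero C (Dom C x) (X (n - 1))\<rbrakk>
      \<Longrightarrow> homology_map C d d' f n \<cdot> homology_class C d n x = homology_class C d' n (f n \<cdot> x)"
proof -
  note c = complexD[OF X] and c' = complexD[OF Y] and fD = chain_mapD[OF f]
  note p = homology_proj_simps[OF X, of n] and p' = homology_proj_simps[OF Y, of n]
  note b = boundary_simps[OF X, of n] and b' = boundary_simps[OF Y, of n]
  let ?k = "ker C (d n)" and ?k' = "ker C (d' n)"
  have k: "?k \<in> Arr C" "Cod C ?k = X n" "d n \<cdot> ?k = Zero C (Dom C ?k) (X (n - 1))"
    and k': "?k' \<in> Arr C" "Cod C ?k' = Y n" using c c' by simp_all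
  obtain z where z: "z \<in> Arr C" "Dom C z = Dom C ?k" "Cod C z = Dom C ?k'" "?k' \<cdot> z = f n \<cdot> ?k"
    by (rule cycle_lift[OF Y, of "f n \<cdot> ?k" n]) (use chain_map_cycle[OF X Y f k] k fD in auto)
  have cyc: "cycles_map C d d' f n = z"
    unfolding cycles_map_def by (rule the_lift) (use z c' in auto)
  have "?k' \<cdot> (z \<cdot> boundary C d n) = (?k' \<cdot> z) \<cdot> boundary C d n"
    using z(1-3) b(1-3) k' by simp
  also have "\<dots> = f n \<cdot> (?k \<cdot> boundary C d n)" unfolding z(4) using b(1-3) k fD(1-3) by simp
  also have "\<dots> = d' (n + 1) \<cdot> f (n + 1)" unfolding b(4) fD(5) ..
  also have "\<dots> = ?k' \<cdot> (boundary C d' n \<cdot> f (n + 1))"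
    unfolding b'(4)[symmetric] using b'(1-3) k' fD(1-3) by simp
  finally have eq: "?k' \<cdot> (z \<cdot> boundary C d n) = ?k' \<cdot> (boundary C d' n \<cdot> f (n + 1))" .
  have zb: "z \<cdot> boundary C d n = boundary C d' n \<cdot> f (n + 1)"
    by (rule mono_cancel[OF kernel_mono[OF ker_is_kernel[OF c'(2)]] eq])
      (use z(1-3) b(1-3) b'(1-3) k' fD(1-3) in auto)
  have "(homology_proj C d' n \<cdot> z) \<cdot> boundary C d n = homology_proj C d' n \<cdot> (z \<cdot> boundary C d n)"
    using z(1-3) b(1-3) p'(1-4) by simp
  also have "\<dots> = (homology_proj C d' n \<cdot> boundary C d' n) \<cdot> f (n + 1)"
    unfolding zb using b'(1-3) p'(1-4) fD(1-3) by simp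
  also have "\<dots> = Zero C (X (n + 1)) (homology C d' n)"
    unfolding p'(6) using p'(4) fD(1-3) by simp
  finally have 0: "(homology_proj C d' n \<cdot> z) \<cdot> boundary C d n = Zero C (X (n + 1)) (homology C d' n)" .
  obtain h where h: "h \<in> Arr C" "Dom C h = homology C d n" "Cod C h = homology C d' n"
    "h \<cdot> homology_proj C d n = homology_proj C d' n \<cdot> z"
    by (rule cokernel_lift[OF homology_proj_cokernel[OF X, of n], of "homology_proj C d' n \<cdot> z"])
      (use 0 z b p p' in auto)
  have hm: "homology_map C d d' f n = h"
    unfolding homology_map_def cyc
  proof (rule the_equality)
    fix g assume g: "g \<in> Hom C (homology C d n) (homology C d' n) \<and>
         g \<cdot> homology_proj C d n = homology_proj C d' n \<cdot> z"
    show "g = h" by (rule epi_cancel[OF p(5)]) (use g h p in auto)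
  qed (use h p p' in auto)
  show "homology_map C d d' f n \<in> Arr C" "Dom C (homology_map C d d' f n) = homology C d n"
    "Cod C (homology_map C d d' f n) = homology C d' n" using h hm by auto
  assume x: "x \<in> Arr C" "Cod C x = X n" "d n \<cdot> x = Zero C (Dom C x) (X (n - 1))"
  obtain u where u: "u \<in> Arr C" "Dom C u = Dom C x" "Cod C u = Dom C ?k" "?k \<cdot> u = x"
    by (rule cycle_lift[OF X x(1,2) refl x(3)])
  have "?k' \<cdot> (z \<cdot> u) = (?k' \<cdot> z) \<cdot> u" using u(1-3) z(1-3) k' by simp
  also have "\<dots> = f n \<cdot> (?k \<cdot> u)" unfolding z(4) using u(1-3) fD(1-3) k by simp
  finally have "?k' \<cdot> (z \<cdot> u) = f n \<cdot> x" unfolding u(4) .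
  then have "homology_class C d' n (f n \<cdot> x) = homology_proj C d' n \<cdot> (z \<cdot> u)"
    by (intro homology_classI[OF Y]) (use u(1-3) z(1-3) in auto)
  also have "\<dots> = (homology_proj C d' n \<cdot> z) \<cdot> u" using u(1-3) z(1-3) p' by simp
  also have "\<dots> = h \<cdot> (homology_proj C d n \<cdot> u)"
    unfolding h(4)[symmetric] using h(1-3) u(1-3) p by simp
  also have "\<dots> = h \<cdot> homology_class C d n x" unfolding homology_classI[OF X u(1,3,4)] ..
  finally show "homology_map C d d' f n \<cdot> homology_class C d n x = homology_class C d' n (f n \<cdot> x)" unfolding hm by simp
qed

text \<open>The chase condition is the acyclicity of the cone of \<open>f\<close>. For \<open>z = 0\<close> it lifts a cycle \<open>x\<close> to a cycle, so
  homology is hit; for a cycle \<open>z\<close> whose image is the boundary of \<open>x\<close> it exhibits \<open>z\<close> as a boundary.\<close>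

lemma quasi_isoI:
  assumes X: "is_complex C X d" and Y: "is_complex C Y d'" and f: "is_chain_map C X d Y d' f"
    and chase: "\<And>n x z. \<lbrakk>x \<in> Arr C; Cod C x = Y (n + 1); z \<in> Arr C; Dom C z = Dom C x; Cod C z = X n;
        d n \<cdot> z = Zero C (Dom C x) (X (n - 1)); f n \<cdot> z = d' (n + 1) \<cdot> x\<rbrakk> \<Longrightarrow>
      \<exists>e w. is_epi C e \<and> Cod C e = Dom C x \<and> w \<in> Hom C (Dom C e) (X (n + 1)) \<and>
        d (n + 1) \<cdot> w = z \<cdot> e \<and> f (n + 1) \<cdot> w = x \<cdot> e"
  shows "is_quasi_iso C X d Y d' f"
  unfolding is_quasi_iso_def
proof (intro conjI allI f)
  fix n
  note c = complexD[OF X] and c' = complexD[OF Y] and fD = chain_mapD[OF f]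
  note h = homology_map_simps[OF X Y f]
  let ?h = "homology_map C d d' f n"
  show "is_iso C ?h"
  proof (rule iso_if_mono_epi)
    show "is_mono C ?h"
    proof (rule monoI)
      fix v assume v: "v \<in> Arr C" "Cod C v = Dom C ?h" "?h \<cdot> v = Zero C (Dom C v) (Cod C ?h)"
      obtain e z where e: "is_epi C e" "Cod C e = Dom C v" and z: "z \<in> Arr C" "Dom C z = Dom C e" "Cod C z = X n"
        "d n \<cdot> z = Zero C (Dom C e) (X (n - 1))" "v \<cdot> e = homology_class C d n z"
        by (rule homology_element[OF X v(1), of n]) (use v h in auto)
      have dz: "d n \<cdot> z = Zero C (Dom C z) (X (n - 1))" using z by simp
      have "homology_class C d' n (f n \<cdot> z) = ?h \<cdot> (v \<cdot> e)"
        unfolding z(5) using homology_map_class[OF X Y f z(1,3) dz] by simp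
      also have "\<dots> = (?h \<cdot> v) \<cdot> e" using h(1-3) v(1,2) e by simp
      finally have "homology_class C d' n (f n \<cdot> z) = Zero C (Dom C (f n \<cdot> z)) (homology C d' n)"
        unfolding v(3) using h(1-3) v(1,2) e z fD homology_proj_simps[OF Y] by simp
      then obtain e' y where e': "is_epi C e'" "Cod C e' = Dom C z" and y: "y \<in> Arr C" "Dom C y = Dom C e'"
        "Cod C y = Y (n + 1)" "d' (n + 1) \<cdot> y = (f n \<cdot> z) \<cdot> e'"
        using boundary_if_class_zero[OF Y, of "f n \<cdot> z" n] chain_map_cycle[OF X Y f z(1,3) dz] z fD
        by (metis comp_simps)
      have "d n \<cdot> (z \<cdot> e') = (d n \<cdot> z) \<cdot> e'" using c z(1-3) e' by simp
      also have "\<dots> = Zero C (Dom C e') (X (n - 1))" unfolding z(4) using c z(1-3) e' by simp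
      finally have "\<exists>e'' w. is_epi C e'' \<and> Cod C e'' = Dom C y \<and> w \<in> Hom C (Dom C e'') (X (n + 1)) \<and>
        d (n + 1) \<cdot> w = (z \<cdot> e') \<cdot> e'' \<and> f (n + 1) \<cdot> w = y \<cdot> e''"
        by (intro chase) (use y z e' fD in auto)
      then obtain e'' w where e'': "is_epi C e''" "Cod C e'' = Dom C e'" "w \<in> Hom C (Dom C e'') (X (n + 1))"
        "d (n + 1) \<cdot> w = (z \<cdot> e') \<cdot> e''" using y by auto
      have "v \<cdot> (e \<cdot> (e' \<cdot> e'')) = (v \<cdot> e) \<cdot> (e' \<cdot> e'')"
        using v(1,2) h(1-3) e e' e'' z(1-4) by simp
      also have "\<dots> = homology_class C d n (z \<cdot> (e' \<cdot> e''))"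
        unfolding z(5) by (rule homology_class_comp[symmetric, OF X z(1,3) dz]) (use e' e'' in auto)
      also have "z \<cdot> (e' \<cdot> e'') = d (n + 1) \<cdot> w" using e'' e' z by simp
      also have "homology_class C d n (d (n + 1) \<cdot> w) = Zero C (Dom C e'') (Cod C v)"
        using homology_class_boundary[OF X, of w n] e'' v h by auto
      finally show "v = Zero C (Dom C v) (Dom C ?h)"
        using epi_cancel_zero[of "e \<cdot> (e' \<cdot> e'')" v] epi_comp[of e "e' \<cdot> e''"] epi_comp[of e' e'']
          v e e' e'' z by simp
    qed (use h in auto)
    show "is_epi C ?h"
    proof -
      have i: "Ident C (homology C d' n) \<in> Arr C" "Cod C (Ident C (homology C d' n)) = homology C d' n"
        using homology_proj_simps[OF Y] by auto
      obtain e x where e: "is_epi C e" "Cod C e = homology C d' n" and x: "x \<in> Arr C" "Dom C x = Dom C e" "Cod C x = Y n"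
        "d' n \<cdot> x = Zero C (Dom C e) (Y (n - 1))" "e = homology_class C d' n x"
        by (rule homology_element[OF Y i]) (use homology_proj_simps[OF Y] in auto)
      \<comment> \<open>The chase condition in degree \<open>n - 1\<close> for \<open>z = 0\<close>; the index is written in the form of the rule.\<close>
      have "\<exists>e' w. is_epi C e' \<and> Cod C e' = Dom C x \<and> w \<in> Hom C (Dom C e') (X (n - 1 + 1)) \<and>
        d (n - 1 + 1) \<cdot> w = Zero C (Dom C x) (X (n - 1)) \<cdot> e' \<and> f (n - 1 + 1) \<cdot> w = x \<cdot> e'"
        by (rule chase) (use x(1-4) e(1) c fD c'(3)[of "n - 1"] c(3,4)[of "n - 1"] in auto)
      then obtain e' w where e': "is_epi C e'" "Cod C e' = Dom C x" and w: "w \<in> Hom C (Dom C e') (X n)"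
        "d n \<cdot> w = Zero C (Dom C w) (X (n - 1))" "f n \<cdot> w = x \<cdot> e'"
        using c x by auto
      have "?h \<cdot> homology_class C d n w = homology_class C d' n (f n \<cdot> w)"
        by (rule homology_map_class[OF X Y f]) (use w in auto)
      also have "\<dots> = homology_class C d' n x \<cdot> e'"
        unfolding w(3) by (rule homology_class_comp[OF Y]) (use x e' in auto)
      also have "\<dots> = e \<cdot> e'" using x by simp
      finally have "is_epi C (?h \<cdot> homology_class C d n w)" using epi_comp[of e e'] e e' x by simp
      then show ?thesis
        by (rule epi_of_comp) (use h homology_class_simps[OF X, of w n] w in auto)
    qed
  qed
qed

text \<open>The boundary \<open>dB b\<close> in the chase is the freedom in the choice of a representative of the class
  of \<open>x\<close>, and \<open>y\<close> witnesses that the class of \<open>g x\<close> vanishes.\<close>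

lemma exact_homologyI:
  assumes A: "is_complex C A dA" and B: "is_complex C B dB" and D: "is_complex C D dD"
    and f: "is_chain_map C A dA B dB f" and g: "is_chain_map C B dB D dD g"
    and gf: "g n \<cdot> f n = Zero C (A n) (D n)"
    and chase: "\<And>x y. \<lbrakk>x \<in> Arr C; Cod C x = B n; dB n \<cdot> x = Zero C (Dom C x) (B (n - 1));
        y \<in> Arr C; Dom C y = Dom C x; Cod C y = D (n + 1); dD (n + 1) \<cdot> y = g n \<cdot> x\<rbrakk> \<Longrightarrow>
      \<exists>e a b. is_epi C e \<and> Cod C e = Dom C x \<and> a \<in> Hom C (Dom C e) (A n) \<and>
        dA n \<cdot> a = Zero C (Dom C e) (A (n - 1)) \<and> b \<in> Hom C (Dom C e) (B (n + 1)) \<and>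
        f n \<cdot> a = x \<cdot> e \<boxplus> dB (n + 1) \<cdot> b"
  shows "exact_at C (homology_map C dA dB f n) (homology_map C dB dD g n)"
proof (rule exact_atI)
  note cA = complexD[OF A] and cB = complexD[OF B] and cD = complexD[OF D]
  note fD = chain_mapD[OF f] and gD = chain_mapD[OF g]
  note hf = homology_map_simps[OF A B f] and hg = homology_map_simps[OF B D g]
  let ?f = "homology_map C dA dB f n" and ?g = "homology_map C dB dD g n"
  show "?f \<in> Arr C" "?g \<in> Arr C" "Dom C ?g = Cod C ?f" using hf hg by auto
  have i: "Ident C (homology C dA n) \<in> Arr C" "Cod C (Ident C (homology C dA n)) = homology C dA n"
    using homology_proj_simps[OF A] by auto
  obtain e x where e: "is_epi C e" "Cod C e = homology C dA n" and x: "x \<in> Arr C" "Dom C x = Dom C e" "Cod C x = A n"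
    "dA n \<cdot> x = Zero C (Dom C e) (A (n - 1))" "e = homology_class C dA n x"
    by (rule homology_element[OF A i]) (use homology_proj_simps[OF A] in auto)
  have dx: "dA n \<cdot> x = Zero C (Dom C x) (A (n - 1))" using x by simp
  have "(?g \<cdot> ?f) \<cdot> e = ?g \<cdot> (?f \<cdot> homology_class C dA n x)" using hf hg e x(5) by simp
  also have "\<dots> = ?g \<cdot> homology_class C dB n (f n \<cdot> x)" using homology_map_class[OF A B f x(1,3) dx] by simp
  also have "\<dots> = homology_class C dD n (g n \<cdot> (f n \<cdot> x))"
    by (rule homology_map_class[OF B D g])
      (use chain_map_cycle[OF A B f x(1,3) dx] x(1-3) fD in auto)
  also have "g n \<cdot> (f n \<cdot> x) = Zero C (Dom C e) (D n)"
    using rewrite_prefix[OF gf, of x] fD gD x cD by simp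
  finally have "(?g \<cdot> ?f) \<cdot> e = Zero C (Dom C e) (homology C dD n)"
    using homology_class_of_zero[OF D] e by simp
  then show "?g \<cdot> ?f = Zero C (Dom C ?f) (Cod C ?g)"
    using epi_cancel_zero[OF e(1), of "?g \<cdot> ?f"] hf(1-3) hg(1-3) e by simp
  fix v assume v: "v \<in> Arr C" "Cod C v = Dom C ?g" "?g \<cdot> v = Zero C (Dom C v) (Cod C ?g)"
  obtain e x where e: "is_epi C e" "Cod C e = Dom C v" and x: "x \<in> Arr C" "Dom C x = Dom C e" "Cod C x = B n"
    "dB n \<cdot> x = Zero C (Dom C e) (B (n - 1))" "v \<cdot> e = homology_class C dB n x"
    by (rule homology_element[OF B v(1), of n]) (use v hg in auto)
  have dx: "dB n \<cdot> x = Zero C (Dom C x) (B (n - 1))" using x by simp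
  have "homology_class C dD n (g n \<cdot> x) = ?g \<cdot> (v \<cdot> e)"
    unfolding x(5) using homology_map_class[OF B D g x(1,3) dx] by simp
  also have "\<dots> = (?g \<cdot> v) \<cdot> e" using hg(1-3) v(1,2) e by simp
  finally have "homology_class C dD n (g n \<cdot> x) = Zero C (Dom C (g n \<cdot> x)) (homology C dD n)"
    unfolding v(3) using hg(1-3) v(1,2) e x gD homology_proj_simps[OF D] by simp
  then obtain e' y where e': "is_epi C e'" "Cod C e' = Dom C x" and y: "y \<in> Arr C" "Dom C y = Dom C e'"
    "Cod C y = D (n + 1)" "dD (n + 1) \<cdot> y = (g n \<cdot> x) \<cdot> e'"
    using boundary_if_class_zero[OF D, of "g n \<cdot> x" n] chain_map_cycle[OF B D g x(1,3) dx] x gD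
    by (metis comp_simps)
  have "dB n \<cdot> (x \<cdot> e') = (dB n \<cdot> x) \<cdot> e'" using cB x(1-3) e' by simp
  also have "\<dots> = Zero C (Dom C e') (B (n - 1))" unfolding x(4) using cB x(1-3) e' by simp
  finally have dxe: "dB n \<cdot> (x \<cdot> e') = Zero C (Dom C (x \<cdot> e')) (B (n - 1))" using x e' by simp
  have "\<exists>e'' a b. is_epi C e'' \<and> Cod C e'' = Dom C (x \<cdot> e') \<and> a \<in> Hom C (Dom C e'') (A n) \<and>
        dA n \<cdot> a = Zero C (Dom C e'') (A (n - 1)) \<and> b \<in> Hom C (Dom C e'') (B (n + 1)) \<and>
        f n \<cdot> a = (x \<cdot> e') \<cdot> e'' \<boxplus> dB (n + 1) \<cdot> b"
    by (rule chase[of _ y]) (use y x(1-3) e' gD dxe in auto)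
  then obtain e'' a b where e'': "is_epi C e''" "Cod C e'' = Dom C e'" and a: "a \<in> Hom C (Dom C e'') (A n)"
    "dA n \<cdot> a = Zero C (Dom C a) (A (n - 1))" and b: "b \<in> Hom C (Dom C e'') (B (n + 1))"
    and fa: "f n \<cdot> a = (x \<cdot> e') \<cdot> e'' \<boxplus> dB (n + 1) \<cdot> b"
    using x e' by auto
  let ?e = "e \<cdot> (e' \<cdot> e'')"
  have ee: "is_epi C ?e" using epi_comp[of e "e' \<cdot> e''"] epi_comp[of e' e''] e e' e'' x by simp
  have ddb: "dB n \<cdot> (dB (n + 1) \<cdot> b) = Zero C (Dom C b) (B (n - 1))"
    using rewrite_prefix[OF cB(5)[of n], of b] cB b by simp
  have dxee: "dB n \<cdot> ((x \<cdot> e') \<cdot> e'') = Zero C (Dom C ((x \<cdot> e') \<cdot> e'')) (B (n - 1))"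
    using rewrite_prefix[OF dxe, of e''] cB x(1-3) e' e'' by simp
  have "?f \<cdot> homology_class C dA n a = homology_class C dB n (f n \<cdot> a)"
    by (rule homology_map_class[OF A B f]) (use a in auto)
  also have "\<dots> = homology_class C dB n ((x \<cdot> e') \<cdot> e'') \<boxplus> homology_class C dB n (dB (n + 1) \<cdot> b)"
    unfolding fa
  proof (rule homology_class_plus[OF B])
    show "dB n \<cdot> ((x \<cdot> e') \<cdot> e'') = Zero C (Dom C ((x \<cdot> e') \<cdot> e'')) (B (n - 1))" by (fact dxee)
    show "dB n \<cdot> dB (n + 1) \<cdot> b = Zero C (Dom C (dB (n + 1) \<cdot> b)) (B (n - 1))"
      using ddb b cB by simp
  qed (use x(1-3) e' e'' b cB in auto)
  also have "homology_class C dB n (dB (n + 1) \<cdot> b) = Zero C (Dom C b) (homology C dB n)"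
    by (rule homology_class_boundary[OF B]) (use b in auto)
  also have "homology_class C dB n ((x \<cdot> e') \<cdot> e'') = homology_class C dB n (x \<cdot> (e' \<cdot> e''))" using x(1-3) e' e'' by simp
  also have "\<dots> = homology_class C dB n x \<cdot> (e' \<cdot> e'')"
    by (rule homology_class_comp[OF B x(1,3) dx]) (use e' e'' in auto)
  also have "homology_class C dB n x \<cdot> (e' \<cdot> e'') = v \<cdot> ?e"
    unfolding x(5)[symmetric] using v(1,2) e e' e'' x(1-3) by simp
  finally have "?f \<cdot> homology_class C dA n a = v \<cdot> ?e"
    using v e e' e'' x(1-3) b hg by simp
  then show "\<exists>e a. is_epi C e \<and> Cod C e = Dom C v \<and> a \<in> Hom C (Dom C e) (Dom C ?f) \<and> ?f \<cdot> a = v \<cdot> e"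
    using ee e e' e'' x(1-3) a hf(1-3) homology_class_simps[OF A, of a n] homology_proj_simps[OF A]
    by (intro exI[of _ ?e] exI[of _ "homology_class C dA n a"]) auto
qed

lemma exact_homology_epiI:
  assumes A: "is_complex C A dA" and B: "is_complex C B dB"
    and f: "is_chain_map C A dA B dB f" and Z: "is_zero_obj C Z"
    and chase: "\<And>x. \<lbrakk>x \<in> Arr C; Cod C x = B n; dB n \<cdot> x = Zero C (Dom C x) (B (n - 1))\<rbrakk> \<Longrightarrow>
      \<exists>e a. is_epi C e \<and> Cod C e = Dom C x \<and> a \<in> Hom C (Dom C e) (A n) \<and>
        dA n \<cdot> a = Zero C (Dom C e) (A (n - 1)) \<and> f n \<cdot> a = x \<cdot> e"
  shows "exact_at C (homology_map C dA dB f n) (Zero C (Cod C (homology_map C dA dB f n)) Z)"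
proof (rule exact_atI)
  note cA = complexD[OF A] and cB = complexD[OF B]
  note fD = chain_mapD[OF f]
  note hf = homology_map_simps[OF A B f]
  have Z: "Z \<in> Obj C" using Z by (simp add: is_zero_obj_def)
  let ?f = "homology_map C dA dB f n" and ?g = "Zero C (Cod C (homology_map C dA dB f n)) Z"
  show "?f \<in> Arr C" "?g \<in> Arr C" "Dom C ?g = Cod C ?f" "?g \<cdot> ?f = Zero C (Dom C ?f) (Cod C ?g)"
    using hf Z homology_proj_simps[OF B] by auto
  fix v assume v: "v \<in> Arr C" "Cod C v = Dom C ?g"
  obtain e x where e: "is_epi C e" "Cod C e = Dom C v" and x: "x \<in> Arr C" "Dom C x = Dom C e" "Cod C x = B n"
    "dB n \<cdot> x = Zero C (Dom C e) (B (n - 1))" "v \<cdot> e = homology_class C dB n x"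
    by (rule homology_element[OF B v(1), of n]) (use v hf Z homology_proj_simps[OF B] in auto)
  have dx: "dB n \<cdot> x = Zero C (Dom C x) (B (n - 1))" using x by simp
  obtain e' a where e': "is_epi C e'" "Cod C e' = Dom C x" and a: "a \<in> Hom C (Dom C e') (A n)"
    "dA n \<cdot> a = Zero C (Dom C a) (A (n - 1))" and fa: "f n \<cdot> a = x \<cdot> e'"
    using chase[OF x(1,3) dx] by auto
  have "?f \<cdot> homology_class C dA n a = homology_class C dB n (f n \<cdot> a)"
    by (rule homology_map_class[OF A B f]) (use a in auto)
  also have "\<dots> = homology_class C dB n x \<cdot> e'"
    unfolding fa by (rule homology_class_comp[OF B x(1,3) dx]) (use e' in auto)
  also have "\<dots> = v \<cdot> (e \<cdot> e')"
    unfolding x(5)[symmetric] using v e e' x(1-3) hf Z homology_proj_simps[OF B] by simp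
  finally have "?f \<cdot> homology_class C dA n a = v \<cdot> (e \<cdot> e')" .
  then show "\<exists>e a. is_epi C e \<and> Cod C e = Dom C v \<and> a \<in> Hom C (Dom C e) (Dom C ?f) \<and> ?f \<cdot> a = v \<cdot> e"
    using epi_comp[of e e'] e e' x(1-3) a hf(1-3) homology_class_simps[OF A, of a n] homology_proj_simps[OF A]
      homology_proj_simps[OF B] Z v
    by (intro exI[of _ "e \<cdot> e'"] exI[of _ "homology_class C dA n a"]) auto
qed

end

section \<open>The total complex\<close>

context preadditive_category
begin

lemma zero_obj_arrows:
  assumes "is_zero_obj C Z"
  shows "Z \<in> Obj C" "f \<in> Arr C \<Longrightarrow> Cod C f = Z \<Longrightarrow> f = Zero C (Dom C f) Z"
    "f \<in> Arr C \<Longrightarrow> Dom C f = Z \<Longrightarrow> f = Zero C Z (Cod C f)"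
proof -
  show Z: "Z \<in> Obj C" using assms unfolding is_zero_obj_def by blast
  have u: "\<exists>!g. g \<in> Hom C X Z" "\<exists>!g. g \<in> Hom C Z X" if "X \<in> Obj C" for X
    using assms that unfolding is_zero_obj_def by blast+
  show "f = Zero C (Dom C f) Z" if "f \<in> Arr C" "Cod C f = Z"
  proof -
    have "f \<in> Hom C (Dom C f) Z" "Zero C (Dom C f) Z \<in> Hom C (Dom C f) Z" using that Z by auto
    then show ?thesis using u(1)[OF Dom_Obj[OF that(1)]] by blast
  qed
  show "f = Zero C Z (Cod C f)" if "f \<in> Arr C" "Dom C f = Z"
  proof -
    have "f \<in> Hom C Z (Cod C f)" "Zero C Z (Cod C f) \<in> Hom C Z (Cod C f)" using that Z by auto
    then show ?thesis using u(2)[OF Cod_Obj[OF that(1)]] by blast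
  qed
qed

end

locale augmented_bicomplex = abelian_category C
  for C :: "('o, 'm, 'b) precategory_scheme" (structure) +
  fixes X :: "int \<Rightarrow> 'o" and dX :: "int \<Rightarrow> 'm"
    and Q :: "int \<Rightarrow> nat \<Rightarrow> 'o" and d \<delta> :: "int \<Rightarrow> nat \<Rightarrow> 'm"
  assumes X: "is_nonneg_complex C X dX"
    and Q: "is_first_quadrant_bicomplex C Q d \<delta>"
    and augmentation: "is_chain_map C (\<lambda>s. Q s 0) (\<lambda>s. d s 0) X dX (\<lambda>s. \<delta> s 0)"
    and columns_exact: "s \<ge> 0 \<Longrightarrow> exact_augmented C (\<delta> s)"
begin

lemma X_complex: "is_complex C X dX" and X_neg: "n < 0 \<Longrightarrow> is_zero_obj C (X n)"
  using X unfolding is_nonneg_complex_def by auto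

lemma row: "is_complex C (\<lambda>s. Q s t) (\<lambda>s. d s t)"
  using Q unfolding is_first_quadrant_bicomplex_def is_nonneg_complex_def by auto

lemma \<delta>_map: "is_chain_map C (\<lambda>s. Q s (Suc t)) (\<lambda>s. d s (Suc t)) (\<lambda>s. Q s t) (\<lambda>s. d s t)
    (\<lambda>s. \<delta> s (Suc t))"
  using Q unfolding is_first_quadrant_bicomplex_def by auto

lemmas d_simps = complexD[OF row]
lemmas dX_simps = complexD[OF X_complex]
lemmas \<delta>_simps = chain_mapD[OF \<delta>_map]
lemmas aug_simps = chain_mapD[OF augmentation]

lemma \<delta>\<delta>: "\<delta> s (Suc t) \<cdot> \<delta> s (Suc (Suc t)) = Zero C (Q s (Suc (Suc t))) (Q s t)"
  using Q unfolding is_first_quadrant_bicomplex_def by auto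

lemma column_exact: "s \<ge> 0 \<Longrightarrow> exact_at C (\<delta> s (Suc t)) (\<delta> s t)"
  using columns_exact unfolding exact_augmented_def by auto

lemma augmentation_lift:
  assumes "s \<ge> 0" "x \<in> Arr C" "Cod C x = X s"
  obtains e a where "is_epi C e" "Cod C e = Dom C x" "a \<in> Arr C" "Dom C a = Dom C e"
    "Cod C a = Q s 0" "\<delta> s 0 \<cdot> a = x \<cdot> e"
proof -
  obtain Z where Z: "is_zero_obj C Z" "exact_at C (\<delta> s 0) (Zero C (Cod C (\<delta> s 0)) Z)"
    using columns_exact[OF assms(1)] unfolding exact_augmented_def by auto
  have Z': "Z \<in> Obj C" using zero_obj_arrows(1)[OF Z(1)] .
  show ?thesis
    by (rule exact_atD(5)[OF Z(2), of x])
      (use Z' assms aug_simps dX_simps that in auto)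
qed

text \<open>The vertical differential with the sign \<open>(-1)\<^sup>s\<close>; with it squares anticommute.\<close>

definition \<delta>' :: "int \<Rightarrow> nat \<Rightarrow> 'm" where
  "\<delta>' s t = (if even s then \<delta> s t else arr_neg C (\<delta> s t))"

lemma \<delta>'_simps:
  "\<delta>' s (Suc t) \<in> Arr C" "Dom C (\<delta>' s (Suc t)) = Q s (Suc t)" "Cod C (\<delta>' s (Suc t)) = Q s t"
  using \<delta>_simps(1-3)[where n=s and t=t] by (auto simp: \<delta>'_def)

lemma \<delta>'_\<delta>': "\<delta>' s (Suc t) \<cdot> \<delta>' s (Suc (Suc t)) = Zero C (Q s (Suc (Suc t))) (Q s t)"
  using \<delta>_simps(1-3) \<delta>\<delta>[of s t] d_simps(1) by (auto simp: \<delta>'_def)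

lemma d_\<delta>': "d (s + 1) t \<cdot> \<delta>' (s + 1) (Suc t) = arr_neg C (\<delta>' s (Suc t) \<cdot> d (s + 1) (Suc t))"
proof -
  have "d (s + 1) t \<cdot> \<delta> (s + 1) (Suc t) = \<delta> s (Suc t) \<cdot> d (s + 1) (Suc t)"
    using \<delta>_simps(4)[of "s + 1" t] by simp
  then show ?thesis
    using \<delta>_simps(1-3) d_simps(1-4)[of "s + 1"] by (auto simp: \<delta>'_def)
qed

end

locale total_complex = augmented_bicomplex +
  fixes T :: "int \<Rightarrow> 'a" and \<iota> \<pi> :: "int \<Rightarrow> int \<Rightarrow> 'b"
  assumes Tot: "is_Tot C Q T \<iota> \<pi>"
begin

abbreviation "D \<equiv> Tot_diff C d \<delta> T \<iota> \<pi>"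

lemma Tot_sum: "is_direct_sum C {0..n} (\<lambda>s. Q s (nat (n - s))) (T n) (\<iota> n) (\<pi> n)"
  using Tot unfolding is_Tot_def by blast

lemma T_obj: "T n \<in> Obj C"
  using Tot_sum[of n] unfolding is_direct_sum_def by blast

lemma \<pi>_simps:
  assumes "0 \<le> s" "n = s + int t"
  shows "\<pi> n s \<in> Arr C" "Dom C (\<pi> n s) = T n" "Cod C (\<pi> n s) = Q s t"
  using direct_sum_simps[OF Tot_sum[of n], of s] assms by auto

lemma \<iota>_simps:
  assumes "0 \<le> s" "n = s + int t"
  shows "\<iota> n s \<in> Arr C" "Dom C (\<iota> n s) = Q s t" "Cod C (\<iota> n s) = T n"
    "\<pi> n s \<cdot> \<iota> n s = Ident C (Q s t)"
  using direct_sum_simps[OF Tot_sum[of n], of s] assms by auto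

lemma \<pi>_\<iota>_zero:
  assumes "0 \<le> s" "n = s + int t" "0 \<le> r" "n = r + int u" "s \<noteq> r"
  shows "\<pi> n s \<cdot> \<iota> n r = Zero C (Q r u) (Q s t)"
proof -
  have "nat (n - r) = u" "nat (n - s) = t" "s \<in> {0..n}" "r \<in> {0..n}" using assms by auto
  then show ?thesis using direct_sum_simps(9)[OF Tot_sum[of n], of s r] assms(5) by simp
qed

lemma into_Tot_eqI:
  assumes "f \<in> Arr C" "g \<in> Arr C" "Dom C f = Dom C g" "Cod C f = T n" "Cod C g = T n"
    "\<And>s t. 0 \<le> s \<Longrightarrow> n = s + int t \<Longrightarrow> \<pi> n s \<cdot> f = \<pi> n s \<cdot> g"
  shows "f = g"
proof (rule into_direct_sum_eqI[OF Tot_sum[of n], of _ "Dom C g"])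
  fix s assume "s \<in> {0..n}"
  then show "\<pi> n s \<cdot> f = \<pi> n s \<cdot> g" using assms(6)[of s "nat (n - s)"] by auto
qed (use assms T_obj in auto)

definition h_part :: "int \<Rightarrow> int \<Rightarrow> 'b" where
  "h_part n s = (if s = 0 then Zero C (T n) (T (n - 1))
       else \<iota> (n - 1) (s - 1) \<cdot> d s (nat (n - s)) \<cdot> \<pi> n s)"

definition v_part :: "int \<Rightarrow> int \<Rightarrow> 'b" where
  "v_part n s = (if s = n then Zero C (T n) (T (n - 1))
       else if even s then \<iota> (n - 1) s \<cdot> \<delta> s (nat (n - s)) \<cdot> \<pi> n s
       else arr_neg C (\<iota> (n - 1) s \<cdot> \<delta> s (nat (n - s)) \<cdot> \<pi> n s))"

lemma D_alt: "D n = arr_sum C (T n) (T (n - 1)) (\<lambda>s. h_part n s \<boxplus> v_part n s) {0..n}"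
  unfolding Tot_diff_def h_part_def v_part_def ..

lemma h_part_eq:
  assumes "0 \<le> s" "n = s + 1 + int t"
  shows "h_part n (s + 1) = \<iota> (n - 1) s \<cdot> d (s + 1) t \<cdot> \<pi> n (s + 1)"
proof -
  have "nat (n - (s + 1)) = t" using assms by simp
  then show ?thesis using assms unfolding h_part_def by simp
qed

lemma v_part_eq:
  assumes "0 \<le> s" "n = s + 1 + int t"
  shows "v_part n s = \<iota> (n - 1) s \<cdot> \<delta>' s (Suc t) \<cdot> \<pi> n s"
proof -
  have n: "nat (n - s) = Suc t" using assms by simp
  show ?thesis
    using assms \<pi>_simps[of s n "Suc t"] \<iota>_simps(1-3)[of s "n - 1" t] \<delta>_simps(1-3)[of s t]
    unfolding v_part_def \<delta>'_def n by auto
qed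

lemma h_part_hom:
  assumes "s \<in> {0..n}"
  shows "h_part n s \<in> Hom C (T n) (T (n - 1))"
proof (cases "s = 0")
  case False
  define t where "t = nat (n - s)"
  have t: "n = (s - 1) + 1 + int t" "0 \<le> s - 1" using assms False by (auto simp: t_def)
  then show ?thesis
    using h_part_eq[OF t(2,1)] d_simps(1-4)[of s t] \<pi>_simps[of s n t] \<iota>_simps(1-3)[of "s - 1" "n - 1" t]
      T_obj by simp
qed (use T_obj in \<open>auto simp: h_part_def\<close>)

lemma v_part_hom:
  assumes "s \<in> {0..n}"
  shows "v_part n s \<in> Hom C (T n) (T (n - 1))"
proof (cases "s = n")
  case False
  define t where "t = nat (n - s - 1)"
  have t: "n = s + 1 + int t" "0 \<le> s" using assms False by (auto simp: t_def)
  then show ?thesis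
    using v_part_eq[OF t(2,1)] \<delta>'_simps[of s t] \<pi>_simps[of s n "Suc t"] \<iota>_simps(1-3)[of s "n - 1" t]
      T_obj by simp
qed (use T_obj in \<open>auto simp: v_part_def\<close>)

lemma D_simps: "D n \<in> Arr C" "Dom C (D n) = T n" "Cod C (D n) = T (n - 1)"
proof -
  have "D n \<in> Hom C (T n) (T (n - 1))"
    unfolding D_alt
  proof (rule arr_sum_closed)
    fix s assume "s \<in> {0..n}"
    from h_part_hom[OF this] v_part_hom[OF this]
    show "h_part n s \<boxplus> v_part n s \<in> Hom C (T n) (T (n - 1))" by simp
  qed (use T_obj in auto)
  then show "D n \<in> Arr C" "Dom C (D n) = T n" "Cod C (D n) = T (n - 1)" by auto
qed

text \<open>All later computations with \<open>D\<close> use only its components. In each of the two sums composition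
  with \<open>\<pi>\<close> leaves a single summand, with index \<open>s + 1\<close> for the horizontal and \<open>s\<close> for the vertical one.\<close>

lemma D_component:
  assumes "0 \<le> s" "n = s + 1 + int t"
  shows "\<pi> (n - 1) s \<cdot> D n = d (s + 1) t \<cdot> \<pi> n (s + 1) \<boxplus> \<delta>' s (Suc t) \<cdot> \<pi> n s"
proof -
  have p: "\<pi> (n - 1) s \<in> Hom C (T (n - 1)) (Q s t)"
    and i: "\<iota> (n - 1) s \<in> Hom C (Q s t) (T (n - 1))" "\<pi> (n - 1) s \<cdot> \<iota> (n - 1) s = Ident C (Q s t)"
    and p1: "\<pi> n s \<in> Hom C (T n) (Q s (Suc t))" "\<pi> n (s + 1) \<in> Hom C (T n) (Q (s + 1) t)"
    using \<pi>_simps[of s "n - 1" t] \<iota>_simps[of s "n - 1" t] \<pi>_simps[of s n "Suc t"]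
      \<pi>_simps[of "s + 1" n t] assms T_obj d_simps(1) by auto
  have pi: "\<pi> (n - 1) s \<cdot> \<iota> (n - 1) s \<cdot> f = f" if "f \<in> Arr C" "Cod C f = Q s t" for f
    using rewrite_prefix[OF i(2), of f] p i(1) that by simp
  have pi0: "\<pi> (n - 1) s \<cdot> \<iota> (n - 1) r \<cdot> f = Zero C (Dom C f) (Q s t)"
    if "f \<in> Arr C" "Cod C f = Q r u" "r \<noteq> s" "0 \<le> r" "n - 1 = r + int u" for f r u
  proof -
    have "\<pi> (n - 1) s \<cdot> \<iota> (n - 1) r = Zero C (Q r u) (Q s t)"
      by (rule \<pi>_\<iota>_zero) (use assms that in auto)
    from rewrite_prefix[OF this, of f] show ?thesis
      using p that \<iota>_simps[of r "n - 1" u] d_simps(1) by simp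
  qed
  have H: "arr_sum C (T n) (Q s t) (\<lambda>r. \<pi> (n - 1) s \<cdot> h_part n r) {0..n} = d (s + 1) t \<cdot> \<pi> n (s + 1)"
  proof -
    have "arr_sum C (T n) (Q s t) (\<lambda>r. \<pi> (n - 1) s \<cdot> h_part n r) {0..n} = \<pi> (n - 1) s \<cdot> h_part n (s + 1)"
    proof (rule arr_sum_single)
      show "\<pi> (n - 1) s \<cdot> h_part n (s + 1) \<in> Hom C (T n) (Q s t)"
        using h_part_hom[of "s + 1" n] p assms by auto
      fix r assume r: "r \<in> {0..n}" "r \<noteq> s + 1"
      show "\<pi> (n - 1) s \<cdot> h_part n r = Zero C (T n) (Q s t)"
      proof (cases "r = 0")
        case True then show ?thesis using p T_obj by (simp add: h_part_def)
      next
        case False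
        define u where "u = nat (n - r)"
        have u: "n = (r - 1) + 1 + int u" "0 \<le> r - 1" using r False by (auto simp: u_def)
        have "h_part n r = \<iota> (n - 1) (r - 1) \<cdot> d r u \<cdot> \<pi> n r" using h_part_eq[OF u(2,1)] by simp
        then show ?thesis
          using pi0[of "d r u \<cdot> \<pi> n r" "r - 1" u] u r d_simps(1-4)[of r u] \<pi>_simps[of r n u] by simp
      qed
    qed (use assms T_obj d_simps(1) in auto)
    also have "\<dots> = d (s + 1) t \<cdot> \<pi> n (s + 1)"
      using h_part_eq[OF assms] pi[of "d (s + 1) t \<cdot> \<pi> n (s + 1)"] p1 d_simps(1-4)[of "s + 1" t] by simp
    finally show ?thesis .
  qed
  have V: "arr_sum C (T n) (Q s t) (\<lambda>r. \<pi> (n - 1) s \<cdot> v_part n r) {0..n} = \<delta>' s (Suc t) \<cdot> \<pi> n s"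
  proof -
    have "arr_sum C (T n) (Q s t) (\<lambda>r. \<pi> (n - 1) s \<cdot> v_part n r) {0..n} = \<pi> (n - 1) s \<cdot> v_part n s"
    proof (rule arr_sum_single)
      show "\<pi> (n - 1) s \<cdot> v_part n s \<in> Hom C (T n) (Q s t)"
        using v_part_hom[of s n] p assms by auto
      fix r assume r: "r \<in> {0..n}" "r \<noteq> s"
      show "\<pi> (n - 1) s \<cdot> v_part n r = Zero C (T n) (Q s t)"
      proof (cases "r = n")
        case True then show ?thesis using p T_obj by (simp add: v_part_def)
      next
        case False
        define u where "u = nat (n - r - 1)"
        have u: "n = r + 1 + int u" "0 \<le> r" using r False by (auto simp: u_def)
        have "v_part n r = \<iota> (n - 1) r \<cdot> \<delta>' r (Suc u) \<cdot> \<pi> n r" using v_part_eq[OF u(2,1)] by simp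
        then show ?thesis
          using pi0[of "\<delta>' r (Suc u) \<cdot> \<pi> n r" r u] u r \<delta>'_simps[of r u] \<pi>_simps[of r n "Suc u"] by simp
      qed
    qed (use assms T_obj d_simps(1) in auto)
    also have "\<dots> = \<delta>' s (Suc t) \<cdot> \<pi> n s"
      using v_part_eq[OF assms] pi[of "\<delta>' s (Suc t) \<cdot> \<pi> n s"] p1 \<delta>'_simps[of s t] by simp
    finally show ?thesis .
  qed
  have "\<pi> (n - 1) s \<cdot> D n = arr_sum C (T n) (Q s t) (\<lambda>r. \<pi> (n - 1) s \<cdot> (h_part n r \<boxplus> v_part n r)) {0..n}"
    unfolding D_alt
  proof (rule comp_arr_sum)
    fix r assume "r \<in> {0..n}"
    from h_part_hom[OF this] v_part_hom[OF this]
    show "h_part n r \<boxplus> v_part n r \<in> Hom C (T n) (T (n - 1))" by simp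
  qed (use T_obj p in auto)
  also have "\<dots> = arr_sum C (T n) (Q s t) (\<lambda>r. \<pi> (n - 1) s \<cdot> h_part n r \<boxplus> \<pi> (n - 1) s \<cdot> v_part n r) {0..n}"
  proof (rule arr_sum_cong)
    fix r assume "r \<in> {0..n}"
    from h_part_hom[OF this] v_part_hom[OF this]
    show "\<pi> (n - 1) s \<cdot> (h_part n r \<boxplus> v_part n r) = \<pi> (n - 1) s \<cdot> h_part n r \<boxplus> \<pi> (n - 1) s \<cdot> v_part n r"
      "\<pi> (n - 1) s \<cdot> h_part n r \<boxplus> \<pi> (n - 1) s \<cdot> v_part n r \<in> Hom C (T n) (Q s t)"
      using p by auto
  qed (use T_obj d_simps(1) in auto)
  also have "\<dots> = arr_sum C (T n) (Q s t) (\<lambda>r. \<pi> (n - 1) s \<cdot> h_part n r) {0..n}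
      \<boxplus> arr_sum C (T n) (Q s t) (\<lambda>r. \<pi> (n - 1) s \<cdot> v_part n r) {0..n}"
  proof (rule arr_sum_plus)
    fix r assume "r \<in> {0..n}"
    from h_part_hom[OF this] v_part_hom[OF this]
    show "\<pi> (n - 1) s \<cdot> h_part n r \<in> Hom C (T n) (Q s t)" "\<pi> (n - 1) s \<cdot> v_part n r \<in> Hom C (T n) (Q s t)"
      using p by auto
  qed (use T_obj d_simps(1) in auto)
  finally show ?thesis unfolding H V .
qed

lemma D_D: "D (n - 1) \<cdot> D n = Zero C (T n) (T (n - 2))"
proof (rule into_Tot_eqI)
  fix s t assume s: "0 \<le> s" "n - 2 = s + int t"
  have n: "n - 1 = s + 1 + int t" "n = s + 1 + int (Suc t)" "n = (s + 1) + 1 + int t" using s by auto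
  note p = \<pi>_simps[OF s] \<pi>_simps[of "s + 1" "n - 1" t] \<pi>_simps[of s "n - 1" "Suc t"]
    \<pi>_simps[of "s + 1 + 1" n t] \<pi>_simps[of "s + 1" n "Suc t"] \<pi>_simps[of s n "Suc (Suc t)"]
  note t = s n p D_simps T_obj d_simps(1-4)[of "s + 1" t] d_simps(1-4)[of "s + 1 + 1" t]
    d_simps(1-4)[of "s + 1" "Suc t"] \<delta>'_simps[of s t] \<delta>'_simps[of "s + 1" t] \<delta>'_simps[of s "Suc t"]
    d_simps(1)[of _ t]
  have "\<pi> (n - 2) s \<cdot> (D (n - 1) \<cdot> D n) = (\<pi> (n - 1 - 1) s \<cdot> D (n - 1)) \<cdot> D n"
    using t by simp
  also have "\<dots> = d (s + 1) t \<cdot> (\<pi> (n - 1) (s + 1) \<cdot> D n) \<boxplus> \<delta>' s (Suc t) \<cdot> (\<pi> (n - 1) s \<cdot> D n)"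
    unfolding D_component[OF s(1) n(1)] using t by simp
  also have "\<dots> = d (s + 1) t \<cdot> (d (s + 1 + 1) t \<cdot> \<pi> n (s + 1 + 1) \<boxplus> \<delta>' (s + 1) (Suc t) \<cdot> \<pi> n (s + 1))
     \<boxplus> \<delta>' s (Suc t) \<cdot> (d (s + 1) (Suc t) \<cdot> \<pi> n (s + 1) \<boxplus> \<delta>' s (Suc (Suc t)) \<cdot> \<pi> n s)"
    using D_component[OF s(1) n(2)] D_component[OF _ n(3)] s by simp
  also have "\<dots> = (d (s + 1) t \<cdot> d (s + 1 + 1) t) \<cdot> \<pi> n (s + 1 + 1)
      \<boxplus> (d (s + 1) t \<cdot> \<delta>' (s + 1) (Suc t)) \<cdot> \<pi> n (s + 1)
      \<boxplus> ((\<delta>' s (Suc t) \<cdot> d (s + 1) (Suc t)) \<cdot> \<pi> n (s + 1)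
      \<boxplus> (\<delta>' s (Suc t) \<cdot> \<delta>' s (Suc (Suc t))) \<cdot> \<pi> n s)"
    using t by (simp add: add.commute[of 1 s])
  also have "\<dots> = Zero C (T n) (Q s t)"
    unfolding \<delta>'_\<delta>' d_\<delta>' d_simps(5) using t by simp
  also have "\<dots> = \<pi> (n - 2) s \<cdot> Zero C (T n) (T (n - 2))" using t by simp
  finally show "\<pi> (n - 2) s \<cdot> (D (n - 1) \<cdot> D n) = \<pi> (n - 2) s \<cdot> Zero C (T n) (T (n - 2))" .
qed (use D_simps T_obj in auto)

lemma Tot_complex: "is_complex C T D"
  unfolding is_complex_def using D_simps T_obj D_D by auto

abbreviation "aug \<equiv> Tot_aug C X \<delta> T \<pi>"

lemma aug_types: "aug n \<in> Arr C" "Dom C (aug n) = T n" "Cod C (aug n) = X n"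
  using \<pi>_simps[of n n 0] aug_simps(1-3)[of n] T_obj[of n] dX_simps(1)[of n] by (auto simp: Tot_aug_def)

lemma aug_map: "is_chain_map C T D X dX aug"
  unfolding is_chain_map_def
proof (intro allI conjI)
  fix n
  show "aug n \<in> Hom C (T n) (X n)" using aug_types T_obj dX_simps(1) by auto
  show "dX n \<cdot> aug n = aug (n - 1) \<cdot> D n"
  proof (cases "n \<ge> 1")
    case False
    then have Z: "is_zero_obj C (X (n - 1))" using X_neg by simp
    have "dX n \<cdot> aug n = Zero C (T n) (X (n - 1))"
      using zero_obj_arrows(2)[OF Z, of "dX n \<cdot> aug n"] dX_simps(2-4) aug_types by simp
    moreover have "aug (n - 1) \<cdot> D n = Zero C (T n) (X (n - 1))"
      using zero_obj_arrows(2)[OF Z, of "aug (n - 1) \<cdot> D n"] D_simps aug_types by simp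
    ultimately show ?thesis by simp
  next
    case True
    have c: "\<pi> (n - 1) (n - 1) \<cdot> D n = d n 0 \<cdot> \<pi> n n \<boxplus> \<delta>' (n - 1) (Suc 0) \<cdot> \<pi> n (n - 1)"
      using D_component[of "n - 1" n 0] True by simp
    note p = \<pi>_simps[of n n 0] \<pi>_simps[of "n - 1" n "Suc 0"] \<pi>_simps[of "n - 1" "n - 1" 0]
    note ty = p True aug_simps(1-3) d_simps(1-4)[of n 0] \<delta>'_simps[of "n - 1" 0] D_simps T_obj dX_simps(1-4)
    have "\<delta> (n - 1) 0 \<cdot> \<delta> (n - 1) (Suc 0) = Zero C (Q (n - 1) (Suc 0)) (X (n - 1))"
      using exact_atD(4)[OF column_exact[of "n - 1" 0]] True \<delta>_simps(2)[of "n - 1" 0] aug_simps(3) by simp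
    then have z: "\<delta> (n - 1) 0 \<cdot> \<delta>' (n - 1) (Suc 0) = Zero C (Q (n - 1) (Suc 0)) (X (n - 1))"
      using \<delta>_simps(1-3)[of "n - 1" 0] ty d_simps(1) by (auto simp: \<delta>'_def)
    have "aug (n - 1) \<cdot> D n = \<delta> (n - 1) 0 \<cdot> (\<pi> (n - 1) (n - 1) \<cdot> D n)"
      using ty by (simp add: Tot_aug_def)
    also have "\<dots> = (\<delta> (n - 1) 0 \<cdot> d n 0) \<cdot> \<pi> n n \<boxplus> (\<delta> (n - 1) 0 \<cdot> \<delta>' (n - 1) (Suc 0)) \<cdot> \<pi> n (n - 1)"
      unfolding c using ty by simp
    also have "\<dots> = (dX n \<cdot> \<delta> n 0) \<cdot> \<pi> n n"
      unfolding z aug_simps(4)[of n] using ty by simp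
    also have "\<dots> = dX n \<cdot> aug n" using ty by (simp add: Tot_aug_def)
    finally show ?thesis ..
  qed
qed

lemma column_step:
  assumes s: "0 \<le> s" and y: "y \<in> Arr C" "Cod C y = Q s t"
    and zero: "\<delta> s t \<cdot> y = Zero C (Dom C y) (Cod C (\<delta> s t))"
  obtains e a where "is_epi C e" "Cod C e = Dom C y" "a \<in> Arr C" "Dom C a = Dom C e"
    "Cod C a = Q s (Suc t)" "\<delta>' s (Suc t) \<cdot> a = y \<cdot> e"
proof -
  note E = exact_atD[OF column_exact[OF s, of t]]
  have D: "Dom C (\<delta> s t) = Q s t" using E(3) \<delta>_simps(3) by simp
  obtain e a where e: "is_epi C e" "Cod C e = Dom C y" and a: "a \<in> Arr C" "Dom C a = Dom C e"
    "Cod C a = Dom C (\<delta> s (Suc t))" "\<delta> s (Suc t) \<cdot> a = y \<cdot> e"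
    by (rule E(5)[OF y(1) _ zero]) (use y D in auto)
  show ?thesis
    by (rule that[of e "if even s then a else arr_neg C a"]) (use e a \<delta>_simps(1-3)[of s t] y in \<open>auto simp: \<delta>'_def\<close>)
qed

text \<open>The components \<open>w s\<close> of the primitive of \<open>z\<close> are constructed for the \<open>k + 1\<close> largest indices. At
  \<open>s = n + 1\<close> the augmentation lifts \<open>x\<close>. Below that, \<open>\<delta>' w\<^sub>s = \<pi>\<^sub>s z - d w\<^bsub>s+1\<^esub>\<close> has to be solved; the
  right-hand side is a cycle of the column because \<open>\<delta>' d w\<^bsub>s+1\<^esub> = - d \<delta>' w\<^bsub>s+1\<^esub> = - d \<pi>\<^bsub>s+1\<^esub> z\<close> by the equation
  at \<open>s + 1\<close> and \<open>d d = 0\<close>, while \<open>d \<pi>\<^bsub>s+1\<^esub> z + \<delta>' \<pi>\<^sub>s z\<close> is a component of \<open>D z = 0\<close>. For \<open>s = n\<close> this role is played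
  by \<open>\<epsilon> z = d x\<close>. Each stage passes to a further cover \<open>e\<close>, to which the components found before are
  restricted.\<close>

lemma descending_chase:
  assumes n: "n \<ge> -1" and x: "x \<in> Arr C" "Cod C x = X (n + 1)"
    and z: "z \<in> Arr C" "Dom C z = Dom C x" "Cod C z = T n" "D n \<cdot> z = Zero C (Dom C x) (T (n - 1))"
    and xz: "aug n \<cdot> z = dX (n + 1) \<cdot> x"
  shows "int k \<le> n + 1 \<Longrightarrow> \<exists>e w. is_epi C e \<and> Cod C e = Dom C x \<and>
    (\<forall>s t. n + 1 - int k \<le> s \<and> n + 1 = s + int t \<longrightarrow> w s \<in> Hom C (Dom C e) (Q s t)) \<and>
    \<delta> (n + 1) 0 \<cdot> w (n + 1) = x \<cdot> e \<and>
    (\<forall>s t. n + 1 - int k \<le> s \<and> n = s + int t \<longrightarrow>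
      d (s + 1) t \<cdot> w (s + 1) \<boxplus> \<delta>' s (Suc t) \<cdot> w s = \<pi> n s \<cdot> z \<cdot> e)"
proof (induction k)
  case 0
  obtain e a where e: "is_epi C e" "Cod C e = Dom C x" "a \<in> Arr C" "Dom C a = Dom C e"
    "Cod C a = Q (n + 1) 0" "\<delta> (n + 1) 0 \<cdot> a = x \<cdot> e"
    by (rule augmentation_lift[OF _ x]) (use n in auto)
  show ?case
    by (rule exI[of _ e], rule exI[of _ "\<lambda>_. a"]) (use e d_simps(1) in auto)
next
  case (Suc k)
  have "int k \<le> n + 1" using Suc.prems by simp
  from Suc.IH[OF this] obtain e w where e: "is_epi C e" "Cod C e = Dom C x"
    and w0: "\<forall>s t. n + 1 - int k \<le> s \<and> n + 1 = s + int t \<longrightarrow> w s \<in> Hom C (Dom C e) (Q s t)"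
    and wx: "\<delta> (n + 1) 0 \<cdot> w (n + 1) = x \<cdot> e"
    and wz0: "\<forall>s t. n + 1 - int k \<le> s \<and> n = s + int t \<longrightarrow>
      d (s + 1) t \<cdot> w (s + 1) \<boxplus> \<delta>' s (Suc t) \<cdot> w s = \<pi> n s \<cdot> z \<cdot> e"
    by blast
  have w: "w s \<in> Hom C (Dom C e) (Q s t)" if "n + 1 - int k \<le> s" "n + 1 = s + int t" for s t
    using w0 that by blast
  have wz: "d (s + 1) t \<cdot> w (s + 1) \<boxplus> \<delta>' s (Suc t) \<cdot> w s = \<pi> n s \<cdot> z \<cdot> e"
    if "n + 1 - int k \<le> s" "n = s + int t" for s t
    using wz0 that by blast
  define s where "s = n - int k"
  have s: "0 \<le> s" "n = s + int k" using Suc.prems by (auto simp: s_def)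
  define z' where "z' = z \<cdot> e"
  have z': "z' \<in> Arr C" "Dom C z' = Dom C e" "Cod C z' = T n" using z e by (auto simp: z'_def)
  have Dz': "D n \<cdot> z' = Zero C (Dom C e) (T (n - 1))"
    unfolding z'_def using rewrite_prefix[OF z(4), of e] z D_simps e T_obj x by simp
  have w1: "w (s + 1) \<in> Hom C (Dom C e) (Q (s + 1) k)" using w[of "s + 1" k] s by simp
  note p = \<pi>_simps[OF s] and ds = d_simps(1-4)[of "s + 1" k]
  define b where "b = \<pi> n s \<cdot> z'"
  define c where "c = d (s + 1) k \<cdot> w (s + 1)"
  have bc: "b \<in> Hom C (Dom C e) (Q s k)" "c \<in> Hom C (Dom C e) (Q s k)"
    using p z' w1 ds d_simps(1)[of s k] by (auto simp: b_def c_def)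
  have zero: "\<delta> s k \<cdot> (b \<boxplus> arr_neg C c) = Zero C (Dom C e) (Cod C (\<delta> s k))"
  proof (cases k)
    case 0
    then have sn: "s = n" using s by simp
    note ty = p z' w1 ds aug_simps(1-3) bc 0 sn x e dX_simps(1-4)
    have "\<delta> n 0 \<cdot> b = aug n \<cdot> z'" using ty s(1) by (simp add: Tot_aug_def b_def)
    also have "\<dots> = (aug n \<cdot> z) \<cdot> e" using z(1-3) e aug_types by (simp add: z'_def)
    also have "\<dots> = dX (n + 1) \<cdot> (\<delta> (n + 1) 0 \<cdot> w (n + 1))" unfolding xz wx using ty by simp
    also have "\<dots> = (dX (n + 1) \<cdot> \<delta> (n + 1) 0) \<cdot> w (n + 1)" using ty by simp
    also have "\<dots> = \<delta> n 0 \<cdot> c" unfolding aug_simps(5) c_def using ty by simp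
    finally have "\<delta> n 0 \<cdot> b = \<delta> n 0 \<cdot> c" .
    then show ?thesis using ty by simp
  next
    case k: (Suc t)
    have n': "n = s + 1 + int t" "n + 1 - int k \<le> s + 1" using s k by auto
    have w2: "w (s + 1 + 1) \<in> Hom C (Dom C e) (Q (s + 1 + 1) t)" using w[of "s + 1 + 1" t] n' by simp
    have "n - 1 = s + int t" using n' by simp
    note p' = \<pi>_simps[of "s + 1" n t] and p1 = \<pi>_simps[OF s(1) this]
    note ty = p p' z' w1 w2 ds bc k s(1) n'(1) e d_simps(1)[of _ t] d_simps(1-4)[of "s + 1" t]
      d_simps(1-4)[of "s + 1 + 1" t] \<delta>'_simps[of s t] \<delta>'_simps[of "s + 1" t]
    have "d (s + 1) t \<cdot> (\<pi> n (s + 1) \<cdot> z')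
        = d (s + 1) t \<cdot> (d (s + 1 + 1) t \<cdot> w (s + 1 + 1) \<boxplus> \<delta>' (s + 1) (Suc t) \<cdot> w (s + 1))"
      using wz[of "s + 1" t] n' unfolding z'_def by simp
    also have "\<dots> = (d (s + 1) t \<cdot> d (s + 1 + 1) t) \<cdot> w (s + 1 + 1) \<boxplus> (d (s + 1) t \<cdot> \<delta>' (s + 1) (Suc t)) \<cdot> w (s + 1)"
      using ty by (simp add: add.commute[of 1 s])
    also have "\<dots> = arr_neg C (\<delta>' s (Suc t) \<cdot> c)"
      unfolding d_simps(5) d_\<delta>' c_def using ty by simp
    finally have "arr_neg C (\<delta>' s (Suc t) \<cdot> c) = d (s + 1) t \<cdot> (\<pi> n (s + 1) \<cdot> z')" ..
    then have "\<delta>' s (Suc t) \<cdot> (b \<boxplus> arr_neg C c) = \<delta>' s (Suc t) \<cdot> b \<boxplus> d (s + 1) t \<cdot> (\<pi> n (s + 1) \<cdot> z')"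
      using ty by simp
    also have "\<dots> = d (s + 1) t \<cdot> (\<pi> n (s + 1) \<cdot> z') \<boxplus> \<delta>' s (Suc t) \<cdot> b"
      by (rule plus_comm) (use ty in auto)
    also have "\<dots> = (d (s + 1) t \<cdot> \<pi> n (s + 1) \<boxplus> \<delta>' s (Suc t) \<cdot> \<pi> n s) \<cdot> z'"
      using ty unfolding b_def by simp
    also have "\<dots> = (\<pi> (n - 1) s \<cdot> D n) \<cdot> z'" using D_component[OF s(1) n'(1)] by simp
    also have "\<dots> = \<pi> (n - 1) s \<cdot> (D n \<cdot> z')"
      using z' D_simps p1 by simp
    also have "\<dots> = Zero C (Dom C e) (Q s t)"
      unfolding Dz' using e p1 by simp
    finally have "\<delta>' s (Suc t) \<cdot> (b \<boxplus> arr_neg C c) = Zero C (Dom C e) (Q s t)" .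
    moreover have "\<delta> s (Suc t) = \<delta>' s (Suc t) \<or> \<delta> s (Suc t) = arr_neg C (\<delta>' s (Suc t))"
      using \<delta>_simps(1)[of s t] by (auto simp: \<delta>'_def)
    ultimately show ?thesis using ty by (auto simp del: comp_plus_right)
  qed
  obtain e' a where e': "is_epi C e'" "Cod C e' = Dom C (b \<boxplus> arr_neg C c)" and a: "a \<in> Arr C"
    "Dom C a = Dom C e'" "Cod C a = Q s (Suc k)" "\<delta>' s (Suc k) \<cdot> a = (b \<boxplus> arr_neg C c) \<cdot> e'"
    by (rule column_step[OF s(1), of "b \<boxplus> arr_neg C c" k]) (use bc zero in auto)
  have e'2: "Cod C e' = Dom C e" using e' bc by simp
  define w' where "w' r = (if r = s then a else w r \<cdot> e')" for r
  show ?case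
  proof (rule exI[of _ "e \<cdot> e'"], rule exI[of _ w'], intro conjI allI impI)
    show "is_epi C (e \<cdot> e')" using epi_comp e e' e'2 by simp
    show "Cod C (e \<cdot> e') = Dom C x" using e e' e'2 by simp
    show "w' r \<in> Hom C (Dom C (e \<cdot> e')) (Q r t)" if r: "n + 1 - int (Suc k) \<le> r \<and> n + 1 = r + int t" for r t
    proof (cases "r = s")
      case True
      then have "t = Suc k" using r s by simp
      then show ?thesis using True a e e' e'2 d_simps(1) by (auto simp: w'_def)
    next
      case False
      then have "w r \<in> Hom C (Dom C e) (Q r t)" using r s by (intro w) auto
      then show ?thesis using False e e' e'2 by (auto simp: w'_def)
    qed
    have wn: "w (n + 1) \<in> Hom C (Dom C e) (Q (n + 1) 0)" using w[of "n + 1" 0] by simp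
    have "\<delta> (n + 1) 0 \<cdot> w' (n + 1) = (\<delta> (n + 1) 0 \<cdot> w (n + 1)) \<cdot> e'"
      using wn aug_simps(1-3) e e' e'2 s by (simp add: w'_def)
    then show "\<delta> (n + 1) 0 \<cdot> w' (n + 1) = x \<cdot> e \<cdot> e'" unfolding wx using x e e' e'2 by simp
    show "d (r + 1) t \<cdot> w' (r + 1) \<boxplus> \<delta>' r (Suc t) \<cdot> w' r = \<pi> n r \<cdot> z \<cdot> (e \<cdot> e')"
      if r: "n + 1 - int (Suc k) \<le> r \<and> n = r + int t" for r t
    proof (cases "r = s")
      case True
      then have t: "t = k" using r s by simp
      note ty = e e'(1) e'2 bc
      have "w' (s + 1) = w (s + 1) \<cdot> e'" by (simp add: w'_def)
      then have "d (s + 1) k \<cdot> w' (s + 1) = c \<cdot> e'"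
        unfolding c_def using e e'(1) e'2 w1 ds by simp
      moreover have "\<delta>' s (Suc k) \<cdot> w' s = b \<cdot> e' \<boxplus> arr_neg C (c \<cdot> e')"
        using a ty by (simp add: w'_def)
      moreover have "c \<cdot> e' \<boxplus> (b \<cdot> e' \<boxplus> arr_neg C (c \<cdot> e')) = b \<cdot> e'"
        using ty by (subst plus_lcomm) auto
      moreover have "b \<cdot> e' = \<pi> n s \<cdot> z \<cdot> (e \<cdot> e')"
        unfolding b_def z'_def using z(1-3) e e'(1) e'2 p by simp
      ultimately show ?thesis using True t by simp
    next
      case False
      then have r': "n + 1 - int k \<le> r" "n = r + int t" using r s by auto
      have wr: "w r \<in> Hom C (Dom C e) (Q r (Suc t))" "w (r + 1) \<in> Hom C (Dom C e) (Q (r + 1) t)"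
        using w[of r "Suc t"] w[of "r + 1" t] r' by auto
      have rs: "r + 1 \<noteq> s" using r' s by simp
      have "d (r + 1) t \<cdot> w' (r + 1) \<boxplus> \<delta>' r (Suc t) \<cdot> w' r
          = (d (r + 1) t \<cdot> w (r + 1) \<boxplus> \<delta>' r (Suc t) \<cdot> w r) \<cdot> e'"
        using False rs wr d_simps(1-4)[of "r + 1" t] \<delta>'_simps[of r t] e e' e'2 by (simp add: w'_def)
      also have "\<dots> = (\<pi> n r \<cdot> z \<cdot> e) \<cdot> e'" unfolding wz[OF r'] ..
      also have "\<dots> = \<pi> n r \<cdot> z \<cdot> (e \<cdot> e')"
        using z(1-3) e e' e'2 \<pi>_simps[of r n t] r' s Suc.prems by simp
      finally show ?thesis .
    qed
  qed
qed

text \<open>For \<open>n < -1\<close> all objects involved are zero; otherwise the components of a complete descending chase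
  assemble to an element of the total complex.\<close>

theorem Tot_quasi_iso: "is_quasi_iso C T D X dX aug"
proof (rule quasi_isoI[OF Tot_complex X_complex aug_map])
  fix n x z
  assume x: "x \<in> Arr C" "Cod C x = X (n + 1)"
    and z: "z \<in> Arr C" "Dom C z = Dom C x" "Cod C z = T n" "D n \<cdot> z = Zero C (Dom C x) (T (n - 1))"
    and xz: "aug n \<cdot> z = dX (n + 1) \<cdot> x"
  show "\<exists>e w. is_epi C e \<and> Cod C e = Dom C x \<and> w \<in> Hom C (Dom C e) (T (n + 1)) \<and>
        D (n + 1) \<cdot> w = z \<cdot> e \<and> aug (n + 1) \<cdot> w = x \<cdot> e"
  proof (cases "n \<ge> -1")
    case False
    have "x = Zero C (Dom C x) (X (n + 1))"
      by (rule zero_obj_arrows(2)[OF X_neg]) (use x False in auto)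
    moreover have "z = Zero C (Dom C x) (T n)"
      by (rule into_Tot_eqI[of _ _ n]) (use z x T_obj False in auto)
    ultimately show ?thesis
      using x z D_simps[of "n + 1"] aug_types[of "n + 1"] T_obj epi_ident
      by (intro exI[of _ "Ident C (Dom C x)"] exI[of _ "Zero C (Dom C x) (T (n + 1))"]) auto
  next
    case True
    have "int (nat (n + 1)) \<le> n + 1" and 0: "n + 1 - int (nat (n + 1)) = 0" using True by auto
    from descending_chase[OF True x z xz this(1), unfolded 0]
    obtain e w where e: "is_epi C e" "Cod C e = Dom C x"
      and w0: "\<forall>s t. 0 \<le> s \<and> n + 1 = s + int t \<longrightarrow> w s \<in> Hom C (Dom C e) (Q s t)"
      and wx: "\<delta> (n + 1) 0 \<cdot> w (n + 1) = x \<cdot> e"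
      and wz0: "\<forall>s t. 0 \<le> s \<and> n = s + int t \<longrightarrow>
        d (s + 1) t \<cdot> w (s + 1) \<boxplus> \<delta>' s (Suc t) \<cdot> w s = \<pi> n s \<cdot> z \<cdot> e"
      by blast
    have w: "w s \<in> Hom C (Dom C e) (Q s t)" if "0 \<le> s" "n + 1 = s + int t" for s t
      using w0 that by blast
    have wz: "d (s + 1) t \<cdot> w (s + 1) \<boxplus> \<delta>' s (Suc t) \<cdot> w s = \<pi> n s \<cdot> z \<cdot> e"
      if "0 \<le> s" "n = s + int t" for s t
      using wz0 that by blast
    obtain W where W: "W \<in> Hom C (Dom C e) (T (n + 1))" "\<And>s. s \<in> {0..n+1} \<Longrightarrow> \<pi> (n + 1) s \<cdot> W = w s"
    proof (rule into_direct_sum[OF Tot_sum[of "n + 1"], of "Dom C e" w])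
      fix s assume "s \<in> {0..n+1}"
      then show "w s \<in> Hom C (Dom C e) (Q s (nat (n + 1 - s)))" by (intro w) auto
    qed (use e in auto)
    have "D (n + 1) \<cdot> W = z \<cdot> e"
    proof (rule into_Tot_eqI[of _ _ n])
      fix s t assume s: "0 \<le> s" "n = s + int t"
      then have n: "n + 1 = s + 1 + int t" by simp
      note p = \<pi>_simps[OF s] \<pi>_simps[of "s + 1" "n + 1" t] \<pi>_simps[of s "n + 1" "Suc t"]
      have "\<pi> n s \<cdot> D (n + 1) \<cdot> W = (\<pi> (n + 1 - 1) s \<cdot> D (n + 1)) \<cdot> W"
        using p W(1) D_simps[of "n + 1"] by simp
      also have "\<dots> = d (s + 1) t \<cdot> (\<pi> (n + 1) (s + 1) \<cdot> W) \<boxplus> \<delta>' s (Suc t) \<cdot> (\<pi> (n + 1) s \<cdot> W)"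
        unfolding D_component[OF s(1) n] using p W(1) s d_simps(1-4)[of "s + 1" t] \<delta>'_simps[of s t] by simp
      also have "\<dots> = \<pi> n s \<cdot> z \<cdot> e" using W(2)[of s] W(2)[of "s + 1"] s wz[OF s] by simp
      finally show "\<pi> n s \<cdot> D (n + 1) \<cdot> W = \<pi> n s \<cdot> z \<cdot> e" .
    qed (use W(1) D_simps[of "n + 1"] z e in auto)
    moreover have "aug (n + 1) \<cdot> W = x \<cdot> e"
      using W(1) W(2)[of "n + 1"] True wx aug_simps(1-3) \<pi>_simps[of "n + 1" "n + 1" 0]
      by (simp add: Tot_aug_def)
    ultimately show ?thesis using e W(1) by blast
  qed
qed

end

lemma (in augmented_bicomplex) Tot_exists: "\<exists>T \<iota> \<pi>. is_Tot C Q T \<iota> \<pi>"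
proof -
  have "\<exists>S i p. is_direct_sum C {0..n} (\<lambda>s. Q s (nat (n - s))) S i p" for n :: int
  proof -
    let ?N = "nat (n + 1)"
    obtain S i p where S: "is_direct_sum C {..<?N} (\<lambda>k. Q (int k) (nat (n - int k))) S i p"
      using has_direct_sums[of ?N "\<lambda>k. Q (int k) (nat (n - int k))"] d_simps(1) by blast
    note s = direct_sum_simps[OF S]
    have SO: "S \<in> Obj C" and id: "arr_sum C S S (\<lambda>k. i k \<cdot> p k) {..<?N} = Ident C S"
      using S unfolding is_direct_sum_def by auto
    interpret G: comm_group "hom_group C S S" using hom_comm_group SO by simp
    have I: "{0..n} = int ` {..<?N}"
    proof (intro Set.set_eqI iffI)
      fix s assume "s \<in> {0..n}"
      then have "s = int (nat s)" "nat s \<in> {..<?N}" by auto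
      then show "s \<in> int ` {..<?N}" by blast
    qed auto
    have "arr_sum C S S (\<lambda>s. i (nat s) \<cdot> p (nat s)) {0..n} = arr_sum C S S (\<lambda>k. i k \<cdot> p k) {..<?N}"
      unfolding arr_sum_def I
      by (subst G.finprod_reindex) (use s SO in auto)
    then have "is_direct_sum C {0..n} (\<lambda>s. Q s (nat (n - s))) S (\<lambda>s. i (nat s)) (\<lambda>s. p (nat s))"
      unfolding is_direct_sum_def
    proof (intro conjI ballI)
      fix r assume "r \<in> {0..n}"
      then have r: "nat r \<in> {..<?N}" "int (nat r) = r" by auto
      show "Q r (nat (n - r)) \<in> Obj C" by (rule d_simps(1))
      show "i (nat r) \<in> Hom C (Q r (nat (n - r))) S" "p (nat r) \<in> Hom C S (Q r (nat (n - r)))"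
        using s(1-7)[OF r(1)] SO unfolding r(2) by auto
      fix q assume "q \<in> {0..n}"
      then have q: "nat q \<in> {..<?N}" "int (nat q) = q" by auto
      show "p (nat r) \<cdot> i (nat q) = (if r = q then Ident C (Q r (nat (n - r)))
          else Zero C (Q q (nat (n - q))) (Q r (nat (n - r))))"
      proof (cases "r = q")
        case False
        then have "nat r \<noteq> nat q" using r(2) q(2) by metis
        then show ?thesis using s(9)[OF r(1) q(1)] False unfolding r(2) q(2) by simp
      qed (use s(8)[OF r(1)] r(2) in simp)
    qed (use SO id in auto)
    then show ?thesis by blast
  qed
  then show ?thesis unfolding is_Tot_def by metis
qed

section \<open>Existence of Cartan--Eilenberg resolutions\<close>

text \<open>Given by four arrows rather than indexed families because these sums get nested.\<close>

definition is_biproduct ::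
  "('o, 'm, 'b) precategory_scheme \<Rightarrow> 'o \<Rightarrow> 'o \<Rightarrow> 'o \<Rightarrow> 'm \<Rightarrow> 'm \<Rightarrow> 'm \<Rightarrow> 'm \<Rightarrow> bool" where
  "is_biproduct C A B S i\<^sub>1 i\<^sub>2 p\<^sub>1 p\<^sub>2 \<longleftrightarrow>
    i\<^sub>1 \<in> Hom C A S \<and> i\<^sub>2 \<in> Hom C B S \<and> p\<^sub>1 \<in> Hom C S A \<and> p\<^sub>2 \<in> Hom C S B \<and>
    p\<^sub>1 \<cdot>\<^bsub>C\<^esub> i\<^sub>1 = Ident C A \<and> p\<^sub>2 \<cdot>\<^bsub>C\<^esub> i\<^sub>2 = Ident C B \<and>
    p\<^sub>1 \<cdot>\<^bsub>C\<^esub> i\<^sub>2 = Zero C B A \<and> p\<^sub>2 \<cdot>\<^bsub>C\<^esub> i\<^sub>1 = Zero C A B \<and>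
    (i\<^sub>1 \<cdot>\<^bsub>C\<^esub> p\<^sub>1) \<boxplus>\<^bsub>C\<^esub> (i\<^sub>2 \<cdot>\<^bsub>C\<^esub> p\<^sub>2) = Ident C S"

context preadditive_category
begin

lemma zero_objI:
  assumes "Z \<in> Obj C" "Ident C Z = Zero C Z Z"
  shows "is_zero_obj C Z"
  unfolding is_zero_obj_def
proof (intro conjI ballI)
  fix X assume X: "X \<in> Obj C"
  show "\<exists>!f. f \<in> Hom C X Z"
  proof (rule ex1I[of _ "Zero C X Z"])
    fix f assume f: "f \<in> Hom C X Z"
    then have "f = Ident C Z \<cdot> f" by simp
    also have "\<dots> = Zero C X Z" unfolding assms(2) using f by auto
    finally show "f = Zero C X Z" .
  qed (use X assms in auto)
  show "\<exists>!f. f \<in> Hom C Z X"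
  proof (rule ex1I[of _ "Zero C Z X"])
    fix f assume f: "f \<in> Hom C Z X"
    then have "f = f \<cdot> Ident C Z" by simp
    also have "\<dots> = Zero C Z X" unfolding assms(2) using f by auto
    finally show "f = Zero C Z X" .
  qed (use X assms in auto)
qed fact

lemma mono_into_zero_obj:
  assumes "is_mono C m" "is_zero_obj C (Cod C m)"
  shows "is_zero_obj C (Dom C m)"
proof (rule zero_objI)
  have m: "m \<in> Arr C" using assms by simp
  show "Dom C m \<in> Obj C" using m by simp
  have "m = Zero C (Dom C m) (Cod C m)" using zero_obj_arrows(2)[OF assms(2) m] by simp
  then show "Ident C (Dom C m) = Zero C (Dom C m) (Dom C m)"
    using mono_cancel_zero[OF assms(1), of "Ident C (Dom C m)"] m by simp
qed

lemma biproductD: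
  assumes "is_biproduct C A B S i\<^sub>1 i\<^sub>2 p\<^sub>1 p\<^sub>2"
  shows "i\<^sub>1 \<in> Arr C" "Dom C i\<^sub>1 = A" "Cod C i\<^sub>1 = S" "i\<^sub>2 \<in> Arr C" "Dom C i\<^sub>2 = B" "Cod C i\<^sub>2 = S"
    "p\<^sub>1 \<in> Arr C" "Dom C p\<^sub>1 = S" "Cod C p\<^sub>1 = A" "p\<^sub>2 \<in> Arr C" "Dom C p\<^sub>2 = S" "Cod C p\<^sub>2 = B"
    "A \<in> Obj C" "B \<in> Obj C" "S \<in> Obj C"
    "p\<^sub>1 \<cdot> i\<^sub>1 = Ident C A" "p\<^sub>2 \<cdot> i\<^sub>2 = Ident C B" "p\<^sub>1 \<cdot> i\<^sub>2 = Zero C B A" "p\<^sub>2 \<cdot> i\<^sub>1 = Zero C A B"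
  using assms unfolding is_biproduct_def by auto

lemma biproduct_comp:
  assumes "is_biproduct C A B S i\<^sub>1 i\<^sub>2 p\<^sub>1 p\<^sub>2"
  shows "x \<in> Arr C \<Longrightarrow> Cod C x = A \<Longrightarrow> p\<^sub>1 \<cdot> i\<^sub>1 \<cdot> x = x"
    "x \<in> Arr C \<Longrightarrow> Cod C x = B \<Longrightarrow> p\<^sub>2 \<cdot> i\<^sub>2 \<cdot> x = x"
    "x \<in> Arr C \<Longrightarrow> Cod C x = B \<Longrightarrow> p\<^sub>1 \<cdot> i\<^sub>2 \<cdot> x = Zero C (Dom C x) A"
    "x \<in> Arr C \<Longrightarrow> Cod C x = A \<Longrightarrow> p\<^sub>2 \<cdot> i\<^sub>1 \<cdot> x = Zero C (Dom C x) B"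
  using biproductD[OF assms] rewrite_prefix[OF biproductD(16)[OF assms], of x]
    rewrite_prefix[OF biproductD(17)[OF assms], of x] rewrite_prefix[OF biproductD(18)[OF assms], of x]
    rewrite_prefix[OF biproductD(19)[OF assms], of x] by auto

lemma biproduct_decompose:
  assumes "is_biproduct C A B S i\<^sub>1 i\<^sub>2 p\<^sub>1 p\<^sub>2" "f \<in> Arr C" "Dom C f = S"
  shows "f = (f \<cdot> i\<^sub>1) \<cdot> p\<^sub>1 \<boxplus> (f \<cdot> i\<^sub>2) \<cdot> p\<^sub>2"
proof -
  note b = biproductD(1-15)[OF assms(1)]
  have "f = f \<cdot> Ident C S" using assms by simp
  also have "Ident C S = i\<^sub>1 \<cdot> p\<^sub>1 \<boxplus> i\<^sub>2 \<cdot> p\<^sub>2" using assms(1) unfolding is_biproduct_def by simp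
  also have "f \<cdot> \<dots> = (f \<cdot> i\<^sub>1) \<cdot> p\<^sub>1 \<boxplus> (f \<cdot> i\<^sub>2) \<cdot> p\<^sub>2"
    using b assms(2,3) by simp
  finally show ?thesis .
qed

lemma biproduct_proj_epi:
  assumes "is_biproduct C A B S i\<^sub>1 i\<^sub>2 p\<^sub>1 p\<^sub>2"
  shows "is_epi C p\<^sub>1" "is_epi C p\<^sub>2"
  using biproductD[OF assms] epi_of_comp[of p\<^sub>1 i\<^sub>1] epi_of_comp[of p\<^sub>2 i\<^sub>2] epi_ident by auto

lemma biproduct_zero:
  assumes "is_biproduct C A B S i\<^sub>1 i\<^sub>2 p\<^sub>1 p\<^sub>2" "is_zero_obj C A" "is_zero_obj C B"
  shows "is_zero_obj C S"
proof (rule zero_objI)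
  note b = biproductD[OF assms(1)]
  have "p\<^sub>1 = Zero C S A" "p\<^sub>2 = Zero C S B"
    using zero_obj_arrows(2)[OF assms(2), of p\<^sub>1] zero_obj_arrows(2)[OF assms(3), of p\<^sub>2] b by auto
  then have "Zero C S S = i\<^sub>1 \<cdot> p\<^sub>1 \<boxplus> i\<^sub>2 \<cdot> p\<^sub>2" using b by simp
  then show "Ident C S = Zero C S S" using assms(1) unfolding is_biproduct_def by simp
qed (use biproductD[OF assms(1)] in auto)

lemma chain_map_comp:
  assumes "is_complex C X d" "is_complex C Y d'" "is_complex C Z d''"
    "is_chain_map C X d Y d' f" "is_chain_map C Y d' Z d'' g"
  shows "is_chain_map C X d Z d'' (\<lambda>n. g n \<cdot> f n)"
  unfolding is_chain_map_def
proof (intro allI conjI)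
  fix n
  note c = complexD(1-4)[OF assms(1)] complexD(1-4)[OF assms(2)] complexD(1-4)[OF assms(3)]
  note f = chain_mapD[OF assms(4)] and g = chain_mapD[OF assms(5)]
  show "g n \<cdot> f n \<in> Hom C (X n) (Z n)" using c f(1-3) g(1-3) by simp
  have "d'' n \<cdot> g n \<cdot> f n = (d'' n \<cdot> g n) \<cdot> f n" using c f(1-3) g(1-3) by simp
  also have "\<dots> = g (n - 1) \<cdot> (d' n \<cdot> f n)" unfolding g(4) using c f(1-3) g(1-3) by simp
  also have "\<dots> = (g (n - 1) \<cdot> f (n - 1)) \<cdot> d n" unfolding f(4) using c f(1-3) g(1-3) by simp
  finally show "d'' n \<cdot> g n \<cdot> f n = (g (n - 1) \<cdot> f (n - 1)) \<cdot> d n" .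
qed

lemma subcategory_direct_sum:
  assumes "full_additive_subcategory C P" "\<And>i. i < n \<Longrightarrow> X i \<in> P"
  obtains S \<iota> \<pi> where "S \<in> P" "is_direct_sum C {..<n::nat} X S \<iota> \<pi>"
proof -
  let ?S = "full_subcategory C P"
  interpret S: additive_category ?S using assms(1) unfolding full_additive_subcategory_def by simp
  have simps: "Obj ?S = P" "Comp ?S = Comp C" "Zero ?S = Zero C" "Ident ?S = Ident C"
    "Plus ?S = Plus C"
    by (simp_all add: full_subcategory_def)
  have hom: "Hom ?S a b = Hom C a b" if "a \<in> P" "b \<in> P" for a b
    using that unfolding full_subcategory_def Hom_def by auto
  have sub: "P \<subseteq> Obj C" using assms(1) unfolding full_additive_subcategory_def by simp
  obtain S \<iota> \<pi> where S: "is_direct_sum ?S {..<n} X S \<iota> \<pi>"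
    using S.has_direct_sums[of n X] assms(2) simps by auto
  have SP: "S \<in> P" using S simps unfolding is_direct_sum_def by simp
  have "hom_group ?S S S = hom_group C S S" unfolding hom_group_def hom[OF SP SP] simps ..
  then have "is_direct_sum C {..<n} X S \<iota> \<pi>"
    using S SP sub hom[OF SP assms(2)] hom[OF assms(2) SP]
    unfolding is_direct_sum_def arr_sum_def simps by auto
  with SP that show ?thesis by blast
qed

lemma subcategory_zero:
  assumes "full_additive_subcategory C P"
  obtains Z where "Z \<in> P" "is_zero_obj C Z"
proof -
  obtain S \<iota> \<pi> where "S \<in> P" and S: "is_direct_sum C {..<0::nat} (\<lambda>_. undefined) S \<iota> \<pi>"
    using subcategory_direct_sum[OF assms, of 0] by blast
  have "S \<in> Obj C" using S unfolding is_direct_sum_def by simp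
  interpret comm_group "hom_group C S S" using hom_comm_group \<open>S \<in> Obj C\<close> by simp
  have "Ident C S = Zero C S S" using S unfolding is_direct_sum_def arr_sum_def by simp
  with \<open>S \<in> P\<close> \<open>S \<in> Obj C\<close> that zero_objI show ?thesis by blast
qed

end

context abelian_category
begin

lemma subcategory_biproduct:
  assumes "full_additive_subcategory C P" "A \<in> P" "B \<in> P"
  shows "\<exists>S i\<^sub>1 i\<^sub>2 p\<^sub>1 p\<^sub>2. S \<in> P \<and> is_biproduct C A B S i\<^sub>1 i\<^sub>2 p\<^sub>1 p\<^sub>2"
proof -
  define X where "X i = (if i = (0::nat) then A else B)" for i
  have XP: "X i \<in> P" for i using assms(2,3) by (simp add: X_def)
  obtain S \<iota> \<pi> where S: "S \<in> P" "is_direct_sum C {..<2::nat} X S \<iota> \<pi>"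
    by (rule subcategory_direct_sum[OF assms(1), of 2 X]) (use XP in auto)
  note s0 = direct_sum_simps[OF S(2), of 0, simplified] and s1 = direct_sum_simps[OF S(2), of 1, simplified]
  have [simp]: "X 0 = A" "X (Suc 0) = B" by (auto simp: X_def)
  have SO: "S \<in> Obj C" "arr_sum C S S (\<lambda>i. \<iota> i \<cdot> \<pi> i) {..<2} = Ident C S"
    using S(2) unfolding is_direct_sum_def by auto
  have 2: "{..<2::nat} = insert 0 (insert 1 {})" by auto
  have "arr_sum C S S (\<lambda>i. \<iota> i \<cdot> \<pi> i) {..<2} = (\<iota> 0 \<cdot> \<pi> 0) \<boxplus> arr_sum C S S (\<lambda>i. \<iota> i \<cdot> \<pi> i) {1}"
    unfolding 2 by (rule arr_sum_insert) (use s0 s1 SO in auto)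
  also have "arr_sum C S S (\<lambda>i. \<iota> i \<cdot> \<pi> i) {1} = \<iota> 1 \<cdot> \<pi> 1"
    by (rule arr_sum_single) (use s1 SO in auto)
  finally have id: "(\<iota> 0 \<cdot> \<pi> 0) \<boxplus> (\<iota> (Suc 0) \<cdot> \<pi> (Suc 0)) = Ident C S" using SO by simp
  have "is_biproduct C A B S (\<iota> 0) (\<iota> (Suc 0)) (\<pi> 0) (\<pi> (Suc 0))"
    unfolding is_biproduct_def using s0 s1 SO id
      direct_sum_simps(9)[OF S(2), of 0 "Suc 0"] direct_sum_simps(9)[OF S(2), of "Suc 0" 0] by simp
  then show ?thesis using S(1) by blast
qed

definition lifts_cycles :: "(int \<Rightarrow> 'a) \<Rightarrow> (int \<Rightarrow> 'b) \<Rightarrow> (int \<Rightarrow> 'a) \<Rightarrow> (int \<Rightarrow> 'b) \<Rightarrow> (int \<Rightarrow> 'b) \<Rightarrow> bool" where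
  "lifts_cycles Q d X dX p \<longleftrightarrow>
    (\<forall>s x. x \<in> Arr C \<longrightarrow> Cod C x = X s \<longrightarrow> dX s \<cdot> x = Zero C (Dom C x) (X (s - 1)) \<longrightarrow>
      (\<exists>e c. is_epi C e \<and> Cod C e = Dom C x \<and> c \<in> Hom C (Dom C e) (Q s) \<and>
        d s \<cdot> c = Zero C (Dom C e) (Q (s - 1)) \<and> p s \<cdot> c = x \<cdot> e))"

text \<open>For \<open>s \<ge> 0\<close> the arrow \<open>r s\<close> is an epimorphism from an object of \<open>P\<close> onto \<open>Ker (dX s)\<close>. In negative
  degrees a zero object of \<open>P\<close> is taken, because the resolution has to vanish there.\<close>

lemma cycle_cover:
  assumes P: "full_additive_subcategory C P" and gen: "generating C P"
    and X: "is_nonneg_complex C X dX"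
  obtains R r where "\<And>s. R s \<in> P" "\<And>s. r s \<in> Hom C (R s) (X s)"
    "\<And>s. dX s \<cdot> r s = Zero C (R s) (X (s - 1))" "\<And>s. s < 0 \<Longrightarrow> is_zero_obj C (R s)"
    "\<And>s x. x \<in> Arr C \<Longrightarrow> Cod C x = X s \<Longrightarrow> dX s \<cdot> x = Zero C (Dom C x) (X (s - 1)) \<Longrightarrow>
      \<exists>e c. is_epi C e \<and> Cod C e = Dom C x \<and> c \<in> Hom C (Dom C e) (R s) \<and> r s \<cdot> c = x \<cdot> e"
proof -
  have Xc: "is_complex C X dX" and Xn: "\<And>s. s < 0 \<Longrightarrow> is_zero_obj C (X s)"
    using X unfolding is_nonneg_complex_def by auto
  note c = complexD[OF Xc]
  obtain Z where Z: "Z \<in> P" "is_zero_obj C Z" by (rule subcategory_zero[OF P])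
  have "\<exists>R r. R \<in> P \<and> r \<in> Hom C R (X s) \<and> dX s \<cdot> r = Zero C R (X (s - 1)) \<and> (s < 0 \<longrightarrow> is_zero_obj C R) \<and>
    (\<forall>x. x \<in> Arr C \<longrightarrow> Cod C x = X s \<longrightarrow> dX s \<cdot> x = Zero C (Dom C x) (X (s - 1)) \<longrightarrow>
      (\<exists>e c. is_epi C e \<and> Cod C e = Dom C x \<and> c \<in> Hom C (Dom C e) R \<and> r \<cdot> c = x \<cdot> e))" for s
  proof (cases "s < 0")
    case True
    have "\<exists>e c. is_epi C e \<and> Cod C e = Dom C x \<and> c \<in> Hom C (Dom C e) Z \<and> Zero C Z (X s) \<cdot> c = x \<cdot> e"
      if "x \<in> Arr C" "Cod C x = X s" for x
      using zero_obj_arrows(2)[OF Xn[OF True] that] zero_obj_arrows(1)[OF Z(2)] that epi_ident c(1)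
      by (intro exI[of _ "Ident C (Dom C x)"] exI[of _ "Zero C (Dom C x) Z"]) auto
    then show ?thesis using Z zero_obj_arrows(1)[OF Z(2)] c
      by (intro exI[of _ Z] exI[of _ "Zero C Z (X s)"]) auto
  next
    case False
    let ?k = "ker C (dX s)"
    obtain R \<rho> where R: "R \<in> P" "\<rho> \<in> Hom C R (Dom C ?k)" "is_epi C \<rho>"
      using gen c(2)[of s] unfolding generating_def by (metis Dom_Obj ker_simps(1))
    have "dX s \<cdot> (?k \<cdot> \<rho>) = (dX s \<cdot> ?k) \<cdot> \<rho>" using R(2) c(2-4)[of s] by (simp del: ker_simps(3))
    also have "\<dots> = Zero C R (X (s - 1))" using R(2) c(1)[of "s - 1"] c(2-4)[of s] by simp
    finally have dr: "dX s \<cdot> (?k \<cdot> \<rho>) = Zero C R (X (s - 1))" .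
    have "\<exists>e c. is_epi C e \<and> Cod C e = Dom C x \<and> c \<in> Hom C (Dom C e) R \<and> (?k \<cdot> \<rho>) \<cdot> c = x \<cdot> e"
      if x: "x \<in> Arr C" "Cod C x = X s" "dX s \<cdot> x = Zero C (Dom C x) (X (s - 1))" for x
    proof -
      obtain u where u: "u \<in> Arr C" "Dom C u = Dom C x" "Cod C u = Dom C ?k" "?k \<cdot> u = x"
        by (rule cycle_lift[OF Xc x(1,2) refl x(3)])
      obtain e a where e: "is_epi C e" "Cod C e = Dom C u" "a \<in> Arr C" "Dom C a = Dom C e"
        "Cod C a = Dom C \<rho>" "\<rho> \<cdot> a = u \<cdot> e"
        by (rule epi_lift[OF R(3) u(1)]) (use u R in auto)
      have "(?k \<cdot> \<rho>) \<cdot> a = ?k \<cdot> (u \<cdot> e)" unfolding e(6)[symmetric] using e(1-5) u(1-3) R c(2)[of s] by simp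
      also have "\<dots> = x \<cdot> e" unfolding u(4)[symmetric] using e(1-5) u(1-3) c(2)[of s] by simp
      finally have "(?k \<cdot> \<rho>) \<cdot> a = x \<cdot> e" .
      then show ?thesis using e(1-5) u(2) R(2) by (intro exI[of _ e] exI[of _ a]) auto
    qed
    then show ?thesis using R dr False c[of s]
      by (intro exI[of _ R] exI[of _ "?k \<cdot> \<rho>"]) auto
  qed
  then obtain R r where "\<And>s. R s \<in> P \<and> r s \<in> Hom C (R s) (X s) \<and> dX s \<cdot> r s = Zero C (R s) (X (s - 1)) \<and>
    (s < 0 \<longrightarrow> is_zero_obj C (R s)) \<and>
    (\<forall>x. x \<in> Arr C \<longrightarrow> Cod C x = X s \<longrightarrow> dX s \<cdot> x = Zero C (Dom C x) (X (s - 1)) \<longrightarrow>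
      (\<exists>e c. is_epi C e \<and> Cod C e = Dom C x \<and> c \<in> Hom C (Dom C e) (R s) \<and> r s \<cdot> c = x \<cdot> e))"
    by metis
  then show ?thesis by (intro that[of R r]) blast+
qed

text \<open>The cover starts in degree \<open>1\<close>: its disks reach down one degree further, and a disk in degrees
  \<open>0\<close> and \<open>-1\<close> would leave the nonnegative range. In degree \<open>0\<close> all elements of \<open>X\<close> are cycles, which
  \<open>cycle_cover\<close> takes care of.\<close>

lemma object_cover:
  assumes P: "full_additive_subcategory C P" and gen: "generating C P"
    and X: "is_complex C X dX"
  obtains F q where "\<And>s. F s \<in> P" "\<And>s. q s \<in> Hom C (F s) (X s)"
    "\<And>s::int. s \<le> 0 \<Longrightarrow> is_zero_obj C (F s)" "\<And>s. s > 0 \<Longrightarrow> is_epi C (q s)"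
proof -
  note c = complexD[OF X]
  obtain Z where Z: "Z \<in> P" "is_zero_obj C Z" by (rule subcategory_zero[OF P])
  have "\<exists>F q. F \<in> P \<and> q \<in> Hom C F (X s) \<and> (s \<le> 0 \<longrightarrow> is_zero_obj C F) \<and> (s > 0 \<longrightarrow> is_epi C q)" for s :: int
  proof (cases "s \<le> 0")
    case True
    then show ?thesis using Z zero_obj_arrows(1)[OF Z(2)] c(1)[of s]
      by (intro exI[of _ Z] exI[of _ "Zero C Z (X s)"]) auto
  next
    case False
    then show ?thesis using gen c(1)[of s] unfolding generating_def by (meson not_le)
  qed
  then obtain F q where "\<And>s. F s \<in> P \<and> q s \<in> Hom C (F s) (X s) \<and> (s \<le> 0 \<longrightarrow> is_zero_obj C (F s)) \<and>
      (s > 0 \<longrightarrow> is_epi C (q s))" by metis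
  then show ?thesis by (intro that[of F q]) blast+
qed

text \<open>With \<open>U s = R s \<oplus> F s\<close> and \<open>Q s = U s \<oplus> F (s + 1)\<close>, the differential projects \<open>Q s\<close> onto \<open>F s\<close> and includes
  it as the second summand of \<open>Q (s - 1)\<close>, so its cokernel is the projection onto \<open>U (s - 1)\<close>. On the disk
  \<open>F s\<close> the map to \<open>X\<close> is \<open>q\<close> in degree \<open>s\<close> and therefore has to be \<open>dX q\<close> in degree \<open>s - 1\<close>. The summand
  \<open>R\<close> consists of cycles and covers the cycles of \<open>X\<close>.\<close>

lemma proj_complex_cover:
  assumes P: "full_additive_subcategory C P" and gen: "generating C P"
    and X: "is_nonneg_complex C X dX"
  shows "\<exists>Q d p. is_nonneg_complex C Q d \<and> is_proj_complex C P Q d \<and> is_chain_map C Q d X dX p \<and>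
    (\<forall>s. is_epi C (p s)) \<and> lifts_cycles Q d X dX p"
proof -
  have Xc: "is_complex C X dX" and Xn: "\<And>s. s < 0 \<Longrightarrow> is_zero_obj C (X s)"
    using X unfolding is_nonneg_complex_def by auto
  note c = complexD(1-4)[OF Xc]
  obtain R r where RP: "\<And>s. R s \<in> P" and r: "\<And>s. r s \<in> Hom C (R s) (X s)"
    and dr: "\<And>s. dX s \<cdot> r s = Zero C (R s) (X (s - 1))" and R0: "\<And>s. s < 0 \<Longrightarrow> is_zero_obj C (R s)"
    and rl: "\<And>s x. x \<in> Arr C \<Longrightarrow> Cod C x = X s \<Longrightarrow> dX s \<cdot> x = Zero C (Dom C x) (X (s - 1)) \<Longrightarrow>
      \<exists>e c. is_epi C e \<and> Cod C e = Dom C x \<and> c \<in> Hom C (Dom C e) (R s) \<and> r s \<cdot> c = x \<cdot> e"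
    by (rule cycle_cover[OF P gen X], rule that; blast)
  obtain F q where FP: "\<And>s. F s \<in> P" and q: "\<And>s. q s \<in> Hom C (F s) (X s)"
    and F0: "\<And>s::int. s \<le> 0 \<Longrightarrow> is_zero_obj C (F s)" and qe: "\<And>s. s > 0 \<Longrightarrow> is_epi C (q s)"
    by (rule object_cover[OF P gen Xc], rule that; blast)
  have "\<forall>s. \<exists>S i\<^sub>1 i\<^sub>2 p\<^sub>1 p\<^sub>2. S \<in> P \<and> is_biproduct C (R s) (F s) S i\<^sub>1 i\<^sub>2 p\<^sub>1 p\<^sub>2"
    using subcategory_biproduct[OF P RP FP] by blast
  then obtain U a1 a2 b1 b2 where UP: "\<And>s. U s \<in> P"
    and U: "\<And>s. is_biproduct C (R s) (F s) (U s) (a1 s) (a2 s) (b1 s) (b2 s)"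
    by metis
  have "\<forall>s. \<exists>S i\<^sub>1 i\<^sub>2 p\<^sub>1 p\<^sub>2. S \<in> P \<and> is_biproduct C (U s) (F (s + 1)) S i\<^sub>1 i\<^sub>2 p\<^sub>1 p\<^sub>2"
    using subcategory_biproduct[OF P UP FP] by blast
  then obtain Q c1 c2 e1 e2 where QP: "\<And>s. Q s \<in> P"
    and Q: "\<And>s. is_biproduct C (U s) (F (s + 1)) (Q s) (c1 s) (c2 s) (e1 s) (e2 s)"
    by metis
  note u = biproductD[OF U] and v = biproductD[OF Q]
  note uc = biproduct_comp[OF U] and vc = biproduct_comp[OF Q]
  define d where "d s = c2 (s - 1) \<cdot> (b2 s \<cdot> e1 s)" for s
  define p where "p s = (r s \<cdot> b1 s \<boxplus> q s \<cdot> b2 s) \<cdot> e1 s \<boxplus> dX (s + 1) \<cdot> q (s + 1) \<cdot> e2 s" for s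
  have c2: "Dom C (c2 (s - 1)) = F s" for s using v(5)[of "s - 1"] by simp
  have d: "d s \<in> Arr C" "Dom C (d s) = Q s" "Cod C (d s) = Q (s - 1)" for s
    using u(1-15) v(1-15) c2 by (auto simp: d_def)
  have "d (s - 1) \<cdot> d s = Zero C (Q s) (Q (s - 2))" for s
  proof -
    have "d (s - 1) \<cdot> d s = c2 (s - 1 - 1) \<cdot> b2 (s - 1) \<cdot> (e1 (s - 1) \<cdot> c2 (s - 1) \<cdot> (b2 s \<cdot> e1 s))"
      using u(1-15) v(1-15) c2[of "s - 1"] c2[of s] by (simp add: d_def)
    also have "\<dots> = Zero C (Q s) (Q (s - 2))"
      using vc(3)[of "b2 s \<cdot> e1 s" "s - 1"] u(1-15) v(1-15) c2[of "s - 1"] by simp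
    finally show ?thesis .
  qed
  then have Qc: "is_complex C Q d" unfolding is_complex_def using d v(15) by auto
  have Q0: "is_zero_obj C (Q s)" if "s < 0" for s
    by (rule biproduct_zero[OF Q], rule biproduct_zero[OF U]) (use R0 F0 that in auto)
  have Qn: "is_nonneg_complex C Q d" unfolding is_nonneg_complex_def using Qc Q0 by blast
  have p: "p s \<in> Arr C" "Dom C (p s) = Q s" "Cod C (p s) = X s" for s
    using u(1-15) v(1-15) r q c(1-3) c(4)[of "s + 1"] by (auto simp: p_def)
  have pc1: "p s \<cdot> c1 s = r s \<cdot> b1 s \<boxplus> q s \<cdot> b2 s" for s
    using u(1-15) v r q c(1-3) c(4)[of "s + 1"] by (simp add: p_def)
  have pc2: "p s \<cdot> c2 s = dX (s + 1) \<cdot> q (s + 1)" for s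
    using u(1-15) v r q c(1-3) c(4)[of "s + 1"] by (simp add: p_def)
  have pa1: "p s \<cdot> (c1 s \<cdot> a1 s) = r s" for s
  proof -
    have "p s \<cdot> (c1 s \<cdot> a1 s) = (p s \<cdot> c1 s) \<cdot> a1 s" using p v(1-15) u(1-15) by simp
    also have "\<dots> = r s" unfolding pc1 using u r q by simp
    finally show ?thesis .
  qed
  have pa2: "p s \<cdot> (c1 s \<cdot> a2 s) = q s" for s
  proof -
    have "p s \<cdot> (c1 s \<cdot> a2 s) = (p s \<cdot> c1 s) \<cdot> a2 s" using p v(1-15) u(1-15) by simp
    also have "\<dots> = q s" unfolding pc1 using u r q by simp
    finally show ?thesis .
  qed
  have pd: "dX s \<cdot> p s = p (s - 1) \<cdot> d s" for s
  proof -
    have ddq: "dX s \<cdot> dX (s + 1) \<cdot> q (s + 1) \<cdot> e2 s = Zero C (Q s) (X (s - 1))"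
      using rewrite_prefix[OF complexD(5)[OF Xc, of s], of "q (s + 1) \<cdot> e2 s"] q v(1-15) c(1-3) c(4)[of "s + 1"]
      by simp
    have drb: "dX s \<cdot> r s \<cdot> b1 s \<cdot> e1 s = Zero C (Q s) (X (s - 1))"
      using rewrite_prefix[OF dr[of s], of "b1 s \<cdot> e1 s"] r u(1-15) v(1-15) c(1-4) by simp
    have "dX s \<cdot> p s = dX s \<cdot> q s \<cdot> b2 s \<cdot> e1 s"
      using ddq drb u(1-15) v(1-15) r q c(1-3) c(4)[of s] c(4)[of "s + 1"] by (simp add: p_def)
    also have "\<dots> = (dX (s - 1 + 1) \<cdot> q (s - 1 + 1)) \<cdot> (b2 s \<cdot> e1 s)"
      using u(1-15) v(1-15) q c(1-4) by simp
    also have "\<dots> = p (s - 1) \<cdot> d s"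
      unfolding pc2[symmetric] d_def using p v(1-15) u(1-15) c2[of s] by simp
    finally show ?thesis .
  qed
  have pm: "is_chain_map C Q d X dX p"
    unfolding is_chain_map_def using p pd v(15) c(1) by auto
  have coker: "is_cokernel C (d s) (e1 (s - 1))" for s
  proof (rule cokernelI)
    show "is_epi C (e1 (s - 1))" by (rule biproduct_proj_epi(1)[OF Q])
    show "e1 (s - 1) \<cdot> d s = Zero C (Dom C (d s)) (Cod C (e1 (s - 1)))"
      using vc(3)[of "b2 s \<cdot> e1 s" "s - 1"] u(1-15) v(1-15) c2[of s] d by (simp add: d_def)
    fix h assume h: "h \<in> Arr C" "Dom C h = Cod C (d s)" "h \<cdot> d s = Zero C (Dom C (d s)) (Cod C h)"
    have e: "is_epi C (b2 s \<cdot> e1 s)"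
      using epi_comp biproduct_proj_epi(2)[OF U] biproduct_proj_epi(1)[OF Q] u(11) v(9) by metis
    have "(h \<cdot> c2 (s - 1)) \<cdot> (b2 s \<cdot> e1 s) = Zero C (Dom C (d s)) (Cod C h)"
      using h u(1-15) v(1-15) c2[of s] d by (simp add: d_def)
    then have hc: "h \<cdot> c2 (s - 1) = Zero C (F s) (Cod C h)"
      using epi_cancel_zero[OF e, of "h \<cdot> c2 (s - 1)"] h(1,2) d u(1-15) v(1-15) c2[of s] by simp
    have "h = (h \<cdot> c1 (s - 1)) \<cdot> e1 (s - 1) \<boxplus> (h \<cdot> c2 (s - 1)) \<cdot> e2 (s - 1)"
      by (rule biproduct_decompose[OF Q h(1)]) (use h d in simp)
    also have "\<dots> = (h \<cdot> c1 (s - 1)) \<cdot> e1 (s - 1)"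
      unfolding hc using h(1,2) d v(1-15) v(12)[of "s - 1"] by simp
    finally have "(h \<cdot> c1 (s - 1)) \<cdot> e1 (s - 1) = h" ..
    then show "\<exists>w. w \<in> Hom C (Cod C (e1 (s - 1))) (Cod C h) \<and> w \<cdot> e1 (s - 1) = h"
      using h(1,2) d v(1-15) by (intro exI[of _ "h \<cdot> c1 (s - 1)"]) auto
  qed (use d v in auto)
  have proj: "is_proj_complex C P Q d"
    unfolding is_proj_complex_def
  proof (intro conjI allI)
    show "\<exists>N. \<forall>s<N. is_zero_obj C (Q s)" using Q0 by blast
    show "\<exists>c. is_cokernel C (d s) c \<and> Cod C c \<in> P" for s
      using coker[of s] v(9) UP by (intro exI[of _ "e1 (s - 1)"]) auto
  qed (use Qc QP in auto)
  have pe: "is_epi C (p s)" for s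
  proof (cases "s > 0")
    case True
    then have "is_epi C (p s \<cdot> (c1 s \<cdot> a2 s))" unfolding pa2 by (rule qe)
    then show ?thesis by (rule epi_of_comp) (use p u v in auto)
  next
    case False
    let ?x = "Ident C (X s)"
    have "dX s \<cdot> ?x = Zero C (Dom C ?x) (X (s - 1))"
      using zero_obj_arrows(2)[OF Xn[of "s - 1"], of "dX s"] False c by simp
    then obtain e a where e: "is_epi C e" "Cod C e = X s" "a \<in> Hom C (Dom C e) (R s)" "r s \<cdot> a = ?x \<cdot> e"
      using rl[of ?x s] c(1)[of s] by auto
    then have "is_epi C (r s \<cdot> a)" by simp
    then have "is_epi C (r s)" by (rule epi_of_comp) (use e r in auto)
    then have "is_epi C (p s \<cdot> (c1 s \<cdot> a1 s))" unfolding pa1 .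
    then show ?thesis by (rule epi_of_comp) (use p u v in auto)
  qed
  have "lifts_cycles Q d X dX p"
    unfolding lifts_cycles_def
  proof (intro allI impI)
    fix s x assume "x \<in> Arr C" "Cod C x = X s" "dX s \<cdot> x = Zero C (Dom C x) (X (s - 1))"
    then obtain e a where e: "is_epi C e" "Cod C e = Dom C x" "a \<in> Hom C (Dom C e) (R s)" "r s \<cdot> a = x \<cdot> e"
      using rl by blast
    have "e1 s \<cdot> c1 s \<cdot> (a1 s \<cdot> a) = a1 s \<cdot> a" "b2 s \<cdot> a1 s \<cdot> a = Zero C (Dom C e) (F s)"
      using vc(1)[of "a1 s \<cdot> a" s] uc(4)[of a s] u(1-15) e by auto
    then have "d s \<cdot> (c1 s \<cdot> a1 s \<cdot> a) = Zero C (Dom C e) (Q (s - 1))"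
      using e u(1-15) v(1-15) c2[of s] by (simp add: d_def)
    moreover have "p s \<cdot> (c1 s \<cdot> a1 s \<cdot> a) = x \<cdot> e"
      using rewrite_prefix[OF pa1[of s], of a] e p u(1-15) v(1-15) by simp
    ultimately show "\<exists>e c. is_epi C e \<and> Cod C e = Dom C x \<and> c \<in> Hom C (Dom C e) (Q s) \<and>
        d s \<cdot> c = Zero C (Dom C e) (Q (s - 1)) \<and> p s \<cdot> c = x \<cdot> e"
      using e u(1-15) v(1-15) by (intro exI[of _ e] exI[of _ "c1 s \<cdot> a1 s \<cdot> a"]) auto
  qed
  then show ?thesis using Qn proj pm pe by blast
qed

lemma kernel_complex:
  assumes Q: "is_nonneg_complex C Q d" and X: "is_complex C X dX" and p: "is_chain_map C Q d X dX p"
  shows "\<exists>K dK j. is_nonneg_complex C K dK \<and> is_chain_map C K dK Q d j \<and> (\<forall>s. is_kernel C (p s) (j s))"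
proof -
  have Qc: "is_complex C Q d" and Qn: "\<And>s. s < 0 \<Longrightarrow> is_zero_obj C (Q s)"
    using Q unfolding is_nonneg_complex_def by auto
  note c = complexD[OF Qc] and cX = complexD[OF X] and pD = chain_mapD[OF p]
  define j where "j s = ker C (p s)" for s
  define K where "K s = Dom C (j s)" for s
  have k: "is_kernel C (p s) (j s)" for s unfolding j_def by (rule ker_is_kernel[OF pD(1)])
  have j: "j s \<in> Arr C" "Dom C (j s) = K s" "Cod C (j s) = Q s" "p s \<cdot> j s = Zero C (K s) (X s)" "K s \<in> Obj C" for s
    using kernelD[OF k[of s]] pD[of s] by (auto simp: K_def)
  have "\<exists>u. u \<in> Hom C (K s) (K (s - 1)) \<and> j (s - 1) \<cdot> u = d s \<cdot> j s" for s
  proof -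
    have "p (s - 1) \<cdot> d s \<cdot> j s = (p (s - 1) \<cdot> d s) \<cdot> j s" using pD(1-3) c j(1-3) by simp
    also have "\<dots> = dX s \<cdot> (p s \<cdot> j s)" unfolding pD(4)[symmetric] using pD(1-3) cX(1-4) j(1-3) by simp
    also have "\<dots> = Zero C (K s) (X (s - 1))" unfolding j(4) using cX(1-4) j by simp
    finally have 0: "p (s - 1) \<cdot> d s \<cdot> j s = Zero C (K s) (X (s - 1))" .
    obtain u where "u \<in> Arr C" "Dom C u = K s" "Cod C u = Dom C (j (s - 1))" "j (s - 1) \<cdot> u = d s \<cdot> j s"
      by (rule kernel_lift[OF k[of "s - 1"], of "d s \<cdot> j s" "K s"]) (use 0 pD(1-3) c j in auto)
    then show ?thesis using j by auto
  qed
  then obtain dK where dK: "\<And>s. dK s \<in> Hom C (K s) (K (s - 1))" "\<And>s. j (s - 1) \<cdot> dK s = d s \<cdot> j s"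
    by metis
  have jm: "is_mono C (j s)" for s by (rule kernel_mono[OF k])
  have "dK (s - 1) \<cdot> dK s = Zero C (K s) (K (s - 2))" for s
  proof -
    have "j (s - 2) \<cdot> dK (s - 1) \<cdot> dK s = (j (s - 1 - 1) \<cdot> dK (s - 1)) \<cdot> dK s" using j dK(1)[of "s - 1"] dK(1)[of s] by simp
    also have "\<dots> = d (s - 1) \<cdot> (j (s - 1) \<cdot> dK s)"
      unfolding dK(2)[of "s - 1"] using j(1-3) c(2-4)[of "s - 1"] dK(1)[of s] by simp
    also have "\<dots> = (d (s - 1) \<cdot> d (s - 1 + 1)) \<cdot> j s"
      unfolding dK(2) using j(1-3) c(2-4)[of "s - 1"] c(2-4)[of s] by simp
    also have "\<dots> = Zero C (K s) (Q (s - 2))"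
      unfolding c(5) using j c(1) by simp
    finally have "j (s - 2) \<cdot> (dK (s - 1) \<cdot> dK s) = Zero C (K s) (Q (s - 2))" .
    then show ?thesis
      using mono_cancel_zero[OF jm[of "s - 2"], of "dK (s - 1) \<cdot> dK s"] j dK(1)[of "s - 1"] dK(1)[of s] by simp
  qed
  then have Kc: "is_complex C K dK" unfolding is_complex_def using j(5) dK(1) by blast
  have "is_zero_obj C (K s)" if "s < 0" for s
    using mono_into_zero_obj[OF jm[of s]] Qn[OF that] j by simp
  then have "is_nonneg_complex C K dK" unfolding is_nonneg_complex_def using Kc by blast
  moreover have "is_chain_map C K dK Q d j"
    unfolding is_chain_map_def using j c(1) dK(2)[symmetric] by auto
  ultimately show ?thesis using k by blast
qed

text \<open>A short exact sequence \<open>0 \<leftarrow> X \<leftarrow> Q \<leftarrow> K \<leftarrow> 0\<close> of complexes whose homology sequence is also short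
  exact, thanks to \<open>lifts_cycles\<close>.\<close>

definition resolution_step ::
  "'a set \<Rightarrow> (int \<Rightarrow> 'a) \<Rightarrow> (int \<Rightarrow> 'b) \<Rightarrow> (int \<Rightarrow> 'a) \<Rightarrow> (int \<Rightarrow> 'b) \<Rightarrow> (int \<Rightarrow> 'b)
    \<Rightarrow> (int \<Rightarrow> 'a) \<Rightarrow> (int \<Rightarrow> 'b) \<Rightarrow> (int \<Rightarrow> 'b) \<Rightarrow> bool" where
  "resolution_step P X dX Q d p K dK j \<longleftrightarrow>
    is_nonneg_complex C X dX \<and> is_nonneg_complex C Q d \<and> is_nonneg_complex C K dK \<and>
    is_proj_complex C P Q d \<and> is_chain_map C Q d X dX p \<and> is_chain_map C K dK Q d j \<and>
    (\<forall>s. is_epi C (p s)) \<and> (\<forall>s. is_kernel C (p s) (j s)) \<and> lifts_cycles Q d X dX p"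

lemma resolution_step_exists:
  assumes P: "full_additive_subcategory C P" and gen: "generating C P"
    and X: "is_nonneg_complex C X dX"
  shows "\<exists>Q d p K dK j. resolution_step P X dX Q d p K dK j"
proof -
  obtain Q d p where Q: "is_nonneg_complex C Q d" "is_proj_complex C P Q d" "is_chain_map C Q d X dX p"
    "\<forall>s. is_epi C (p s)" "lifts_cycles Q d X dX p"
    using proj_complex_cover[OF assms] by blast
  have "is_complex C X dX" using X unfolding is_nonneg_complex_def by blast
  from kernel_complex[OF Q(1) this Q(3)] obtain K dK j where
    "is_nonneg_complex C K dK" "is_chain_map C K dK Q d j" "\<forall>s. is_kernel C (p s) (j s)"
    by blast
  then show ?thesis unfolding resolution_step_def using Q X by blast
qed

lemma resolution_stepD:
  assumes "resolution_step P X dX Q d p K dK j"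
  shows "is_complex C X dX" "is_complex C Q d" "is_complex C K dK" "is_nonneg_complex C Q d"
    "is_nonneg_complex C K dK" "is_proj_complex C P Q d"
    "is_chain_map C Q d X dX p" "is_chain_map C K dK Q d j" "is_epi C (p s)" "is_kernel C (p s) (j s)"
    "lifts_cycles Q d X dX p"
  using assms unfolding resolution_step_def is_nonneg_complex_def by auto

text \<open>If the image of a cycle of \<open>Q\<close> is the boundary of \<open>y\<close>, subtracting the boundary of a lift of \<open>y\<close> moves
  the cycle into \<open>K\<close>.\<close>

lemma step_homology_exact:
  assumes S: "resolution_step P X dX Q d p K dK j"
    and x: "x \<in> Arr C" "Cod C x = Q n" "d n \<cdot> x = Zero C (Dom C x) (Q (n - 1))"
    and y: "y \<in> Arr C" "Dom C y = Dom C x" "Cod C y = X (n + 1)" "dX (n + 1) \<cdot> y = p n \<cdot> x"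
  obtains e k b where "is_epi C e" "Cod C e = Dom C x" "k \<in> Hom C (Dom C e) (K n)"
    "dK n \<cdot> k = Zero C (Dom C e) (K (n - 1))" "b \<in> Hom C (Dom C e) (Q (n + 1))"
    "j n \<cdot> k = x \<cdot> e \<boxplus> d (n + 1) \<cdot> b"
proof -
  note S' = resolution_stepD[OF S]
  note cX = complexD[OF S'(1)] and cQ = complexD[OF S'(2)] and cK = complexD[OF S'(3)]
  note p = chain_mapD[OF S'(7)] and j = chain_mapD[OF S'(8)]
  obtain e y' where e: "is_epi C e" "Cod C e = Dom C y" and y': "y' \<in> Arr C" "Dom C y' = Dom C e"
    "Cod C y' = Dom C (p (n + 1))" "p (n + 1) \<cdot> y' = y \<cdot> e"
    by (rule epi_lift[OF S'(9)[of "n + 1"] y(1)]) (use y p in auto)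
  define b where "b = arr_neg C y'"
  have b: "b \<in> Arr C" "Dom C b = Dom C e" "Cod C b = Q (n + 1)" using y' p by (auto simp: b_def)
  define z where "z = x \<cdot> e \<boxplus> d (n + 1) \<cdot> b"
  have z: "z \<in> Arr C" "Dom C z = Dom C e" "Cod C z = Q n"
    using b x e y cQ(2-4)[of "n + 1"] by (auto simp: z_def)
  have "p n \<cdot> d (n + 1) \<cdot> b = (p n \<cdot> d (n + 1)) \<cdot> b" using b p(1-3) cQ(2-4)[of "n + 1"] by simp
  also have "\<dots> = arr_neg C (dX (n + 1) \<cdot> (p (n + 1) \<cdot> y'))"
    unfolding p(5)[symmetric] using y'(1-3) p(1-3) cX(2-4)[of "n + 1"] by (simp add: b_def)
  also have "\<dots> = arr_neg C ((dX (n + 1) \<cdot> y) \<cdot> e)"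
    unfolding y'(4) using y(1-3) e cX(2-4)[of "n + 1"] by simp
  also have "\<dots> = arr_neg C (p n \<cdot> x \<cdot> e)"
    unfolding y(4) using x(1,2) e y(2) p(1-3) by simp
  finally have "p n \<cdot> z = Zero C (Dom C e) (X n)"
    unfolding z_def using b x(1,2) e y(2) p(1-3) cQ(2-4)[of "n + 1"] by simp
  then obtain k where k: "k \<in> Arr C" "Dom C k = Dom C e" "Cod C k = Dom C (j n)" "j n \<cdot> k = z"
    using kernel_lift[OF S'(10)[of n], of z "Dom C e"] z p by metis
  have "d n \<cdot> z = (d n \<cdot> x) \<cdot> e \<boxplus> (d n \<cdot> d (n + 1)) \<cdot> b"
    unfolding z_def using b x(1,2) e y(2) cQ(2-4)[of "n + 1"] cQ(2-4)[of n] by simp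
  also have "\<dots> = Zero C (Dom C e) (Q (n - 1))"
    unfolding x(3) cQ(5) using b e y(2) cQ(1) by simp
  finally have dz: "d n \<cdot> z = Zero C (Dom C e) (Q (n - 1))" .
  have "j (n - 1) \<cdot> dK n \<cdot> k = (j (n - 1) \<cdot> dK n) \<cdot> k" using j(1-3) k(1-3) cK(2-4)[of n] by simp
  also have "\<dots> = d n \<cdot> (j n \<cdot> k)" unfolding j(4)[symmetric] using j(1-3) k(1-3) cQ(2-4)[of n] by simp
  also have "\<dots> = Zero C (Dom C e) (Q (n - 1))" unfolding k(4) dz ..
  finally have "dK n \<cdot> k = Zero C (Dom C e) (K (n - 1))"
    using mono_cancel_zero[OF kernel_mono[OF S'(10)[of "n - 1"]], of "dK n \<cdot> k"]
      k(1-3) j(1-3) cK(2-4)[of n] by simp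
  then show ?thesis
    using that[of e k b] e y(2) k j b cK(1) cQ(1) unfolding z_def by simp
qed

text \<open>The map \<open>H(K) \<rightarrow> H(Q)\<close> is a monomorphism: if an element of \<open>K\<close> is the boundary of \<open>y\<close> in \<open>Q\<close>, then
  \<open>p y\<close> is a cycle of \<open>X\<close>, and subtracting from \<open>y\<close> a cycle of \<open>Q\<close> over \<open>p y\<close> moves it into \<open>K\<close>.\<close>

lemma step_homology_mono:
  assumes S: "resolution_step P X dX Q d p K dK j"
    and k: "k \<in> Arr C" "Cod C k = K n"
    and y: "y \<in> Arr C" "Dom C y = Dom C k" "Cod C y = Q (n + 1)" "d (n + 1) \<cdot> y = j n \<cdot> k"
  obtains e k' where "is_epi C e" "Cod C e = Dom C k" "k' \<in> Hom C (Dom C e) (K (n + 1))"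
    "dK (n + 1) \<cdot> k' = k \<cdot> e"
proof -
  note S' = resolution_stepD[OF S]
  note cX = complexD[OF S'(1)] and cQ = complexD[OF S'(2)] and cK = complexD[OF S'(3)]
  note p = chain_mapD[OF S'(7)] and j = chain_mapD[OF S'(8)]
  have pj: "p n \<cdot> j n = Zero C (K n) (X n)" using kernelD(4)[OF S'(10)[of n]] j p by simp
  have "dX (n + 1) \<cdot> (p (n + 1) \<cdot> y) = (dX (n + 1) \<cdot> p (n + 1)) \<cdot> y"
    using y(1-3) p(1-3) cX(2-4)[of "n + 1"] by simp
  also have "\<dots> = p n \<cdot> (d (n + 1) \<cdot> y)" unfolding p(5) using y(1-3) p(1-3) cQ(2-4)[of "n + 1"] by simp
  also have "\<dots> = (p n \<cdot> j n) \<cdot> k" unfolding y(4) using k p(1-3) j(1-3) by simp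
  also have "\<dots> = Zero C (Dom C y) (X n)" unfolding pj using k y(2) cX(1) by simp
  finally have "\<exists>e c. is_epi C e \<and> Cod C e = Dom C (p (n + 1) \<cdot> y) \<and> c \<in> Hom C (Dom C e) (Q (n + 1)) \<and>
        d (n + 1) \<cdot> c = Zero C (Dom C e) (Q (n + 1 - 1)) \<and> p (n + 1) \<cdot> c = (p (n + 1) \<cdot> y) \<cdot> e"
    using S'(11)[unfolded lifts_cycles_def, rule_format, of "p (n + 1) \<cdot> y" "n + 1"] y(1-3) p(1-3)
    by simp
  then obtain e c where e: "is_epi C e" "Cod C e = Dom C k" and c: "c \<in> Hom C (Dom C e) (Q (n + 1))"
    "d (n + 1) \<cdot> c = Zero C (Dom C e) (Q n)" "p (n + 1) \<cdot> c = (p (n + 1) \<cdot> y) \<cdot> e"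
    using y(1-3) p(1-3) by auto
  define z where "z = y \<cdot> e \<boxplus> arr_neg C c"
  have z: "z \<in> Arr C" "Dom C z = Dom C e" "Cod C z = Q (n + 1)" using y(1-3) e c(1) by (auto simp: z_def)
  have "p (n + 1) \<cdot> z = Zero C (Dom C e) (X (n + 1))"
    unfolding z_def using y(1-3) e c(1) c(3) p(1-3) by simp
  then obtain k' where k': "k' \<in> Arr C" "Dom C k' = Dom C e" "Cod C k' = Dom C (j (n + 1))" "j (n + 1) \<cdot> k' = z"
    using kernel_lift[OF S'(10)[of "n + 1"], of z "Dom C e"] z p by metis
  have "j n \<cdot> dK (n + 1) \<cdot> k' = (j n \<cdot> dK (n + 1)) \<cdot> k'" using j(1-3) k'(1-3) cK(2-4)[of "n + 1"] by simp
  also have "\<dots> = d (n + 1) \<cdot> (j (n + 1) \<cdot> k')"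
    unfolding j(5)[symmetric] using j(1-3) k'(1-3) cQ(2-4)[of "n + 1"] by simp
  also have "\<dots> = (d (n + 1) \<cdot> y) \<cdot> e \<boxplus> arr_neg C (d (n + 1) \<cdot> c)"
    unfolding k'(4) z_def using y(1-3) e c(1) cQ(2-4)[of "n + 1"] by simp
  also have "\<dots> = j n \<cdot> k \<cdot> e" unfolding y(4) c(2) using k e j(1-3) cQ(1) by simp
  finally have "dK (n + 1) \<cdot> k' = k \<cdot> e"
    by (rule mono_cancel[OF kernel_mono[OF S'(10)[of n]]])
      (use k e k'(1-3) j(1-3) cK(2-4)[of "n + 1"] in auto)
  then show ?thesis using that[of e k'] e k' j cK(1) by simp
qed

text \<open>Iterated steps produce complexes \<open>Y 0 = X\<close> and \<open>Y (t + 1) = Ker (Q t \<rightarrow> Y t)\<close>, covered by the rows \<open>Q t\<close>;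
  the vertical differential is the splice \<open>Q (t + 1) \<rightarrow> Y (t + 1) \<rightarrow> Q t\<close>. As \<open>j\<close> is mono, both in each degree
  and on homology, exactness of columns and of homologies reduces to that of the steps.\<close>

theorem CE_resolution_exists:
  assumes P: "full_additive_subcategory C P" and gen: "generating C P"
    and X: "is_nonneg_complex C X dX"
  shows "\<exists>Q d \<delta>. is_CE_resolution C P X dX Q d \<delta>"
proof -
  obtain fQ fd fp fK fdK fj where step: "\<And>Y dY. is_nonneg_complex C Y dY \<Longrightarrow>
      resolution_step P Y dY (fQ Y dY) (fd Y dY) (fp Y dY) (fK Y dY) (fdK Y dY) (fj Y dY)"
    using resolution_step_exists[OF P gen] by metis
  define y where "y t = ((\<lambda>(Y, dY). (fK Y dY, fdK Y dY)) ^^ t) (X, dX)" for t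
  define Y where "Y t = fst (y t)" for t
  define dY where "dY t = snd (y t)" for t
  have Y0: "Y 0 = X" "dY 0 = dX" by (simp_all add: Y_def dY_def y_def)
  have YS: "Y (Suc t) = fK (Y t) (dY t)" "dY (Suc t) = fdK (Y t) (dY t)" for t
    by (simp_all add: Y_def dY_def y_def split_beta)
  define Q where "Q t = fQ (Y t) (dY t)" for t
  define d where "d t = fd (Y t) (dY t)" for t
  define p where "p t = fp (Y t) (dY t)" for t
  define j where "j t = fj (Y t) (dY t)" for t
  have "is_nonneg_complex C (Y t) (dY t)" for t
  proof (induction t)
    case (Suc t) then show ?case unfolding YS by (rule resolution_stepD(5)[OF step])
  qed (simp add: Y0 X)
  then have S: "resolution_step P (Y t) (dY t) (Q t) (d t) (p t) (Y (Suc t)) (dY (Suc t)) (j t)" for t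
    unfolding Q_def d_def p_def j_def YS by (rule step)
  note S' = resolution_stepD[OF S]
  note cY = complexD[OF S'(1)] and cQ = complexD[OF S'(2)]
  note pD = chain_mapD[OF S'(7)] and jD = chain_mapD[OF S'(8)]
  define \<delta> where "\<delta> s t = (case t of 0 \<Rightarrow> p 0 s | Suc t' \<Rightarrow> j t' s \<cdot> p (Suc t') s)" for s t
  have \<delta>0: "\<delta> s 0 = p 0 s" and \<delta>S: "\<delta> s (Suc t) = j t s \<cdot> p (Suc t) s" for s t
    by (auto simp: \<delta>_def)
  have \<delta>_map: "is_chain_map C (Q (Suc t)) (d (Suc t)) (Q t) (d t) (\<lambda>s. \<delta> s (Suc t))" for t
    unfolding \<delta>S by (rule chain_map_comp[OF S'(2) S'(1) S'(2) S'(7) S'(8)])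
  have pj: "p t s \<cdot> j t s = Zero C (Y (Suc t) s) (Y t s)" for s t
    using kernelD(4)[OF S'(10)[of t s]] jD pD by simp
  have pd: "p t s \<cdot> \<delta> s (Suc t) = Zero C (Q (Suc t) s) (Y t s)" for s t
    using rewrite_prefix[OF pj[of t s], of "p (Suc t) s"] pD(1-3) jD(1-3) cY(1) by (simp add: \<delta>S)
  have dd: "\<delta> s t \<cdot> \<delta> s (Suc t) = Zero C (Q (Suc t) s) (Cod C (\<delta> s t))" for s t
    using pd[of t s] pD(1-3) jD(1-3) cY(1) cQ(1) by (cases t) (simp_all add: \<delta>0 \<delta>S)
  have bicomplex: "is_first_quadrant_bicomplex C (\<lambda>s t. Q t s) (\<lambda>s t. d t s) \<delta>"
    unfolding is_first_quadrant_bicomplex_def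
  proof (intro conjI allI)
    show "is_nonneg_complex C (\<lambda>s. Q t s) (\<lambda>s. d t s)" for t using S'(4)[of t] .
    show "is_chain_map C (\<lambda>s. Q (Suc t) s) (\<lambda>s. d (Suc t) s) (\<lambda>s. Q t s) (\<lambda>s. d t s) (\<lambda>s. \<delta> s (Suc t))" for t
      using \<delta>_map .
    show "\<delta> s (Suc t) \<cdot> \<delta> s (Suc (Suc t)) = Zero C (Q (Suc (Suc t)) s) (Q t s)" for s t
      using dd[of s "Suc t"] pD(1-3) jD(1-3) by (simp add: \<delta>S)
  qed
  have ker: "p t s \<cdot> x = Zero C (Dom C x) (Y t s)"
    if "x \<in> Arr C" "Cod C x = Q t s" "\<delta> s t \<cdot> x = Zero C (Dom C x) (Cod C (\<delta> s t))" for s t x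
  proof (cases t)
    case 0 then show ?thesis using that pD by (simp add: \<delta>0)
  next
    case (Suc t')
    then have "j t' s \<cdot> (p t s \<cdot> x) = Zero C (Dom C x) (Q t' s)"
      using that pD(1-3) jD(1-3) by (simp add: \<delta>S)
    then show ?thesis
      using mono_cancel_zero[OF kernel_mono[OF S'(10)[of t' s]], of "p t s \<cdot> x"] that(1,2) Suc pD(1-3) jD(1-3) by simp
  qed
  obtain Z where Z: "is_zero_obj C Z" using subcategory_zero[OF P] by blast
  have ZO: "Z \<in> Obj C" by (rule zero_obj_arrows(1)[OF Z])
  have columns: "exact_augmented C (\<delta> s)" for s
    unfolding exact_augmented_def
  proof (intro conjI allI exI)
    show "is_zero_obj C Z" by fact
    show "exact_at C (\<delta> s 0) (Zero C (Cod C (\<delta> s 0)) Z)"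
    proof (rule exact_atI)
      fix x assume x: "x \<in> Arr C" "Cod C x = Dom C (Zero C (Cod C (\<delta> s 0)) Z)"
      then have x': "Cod C x = Cod C (p 0 s)" using ZO pD cY(1) by (simp add: \<delta>0)
      obtain e a where "is_epi C e" "Cod C e = Dom C x" "a \<in> Arr C" "Dom C a = Dom C e"
        "Cod C a = Dom C (p 0 s)" "p 0 s \<cdot> a = x \<cdot> e"
        by (rule epi_lift[OF S'(9)[of 0 s] x(1) x'])
      then show "\<exists>e a. is_epi C e \<and> Cod C e = Dom C x \<and> a \<in> Hom C (Dom C e) (Dom C (\<delta> s 0)) \<and> \<delta> s 0 \<cdot> a = x \<cdot> e"
        using pD(1)[of 0 s] by (intro exI[of _ e] exI[of _ a]) (simp add: \<delta>0)
    qed (use ZO pD cY in \<open>auto simp: \<delta>0\<close>)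
    fix t
    show "exact_at C (\<delta> s (Suc t)) (\<delta> s t)"
    proof (rule exact_atI)
      have ty: "\<delta> s t \<in> Arr C" "Dom C (\<delta> s t) = Q t s" "\<delta> s (Suc t) \<in> Arr C" "Dom C (\<delta> s (Suc t)) = Q (Suc t) s"
        "Cod C (\<delta> s (Suc t)) = Q t s"
        using pD(1-3) jD(1-3) by (cases t; simp add: \<delta>0 \<delta>S)+
      then show "\<delta> s (Suc t) \<in> Arr C" "\<delta> s t \<in> Arr C" "Dom C (\<delta> s t) = Cod C (\<delta> s (Suc t))"
        "\<delta> s t \<cdot> \<delta> s (Suc t) = Zero C (Dom C (\<delta> s (Suc t))) (Cod C (\<delta> s t))"
        using dd by auto
      fix x assume x: "x \<in> Arr C" "Cod C x = Dom C (\<delta> s t)" "\<delta> s t \<cdot> x = Zero C (Dom C x) (Cod C (\<delta> s t))"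
      have "p t s \<cdot> x = Zero C (Dom C x) (Cod C (p t s))" using ker[of x t s] x ty pD by simp
      then obtain u where u: "u \<in> Arr C" "Dom C u = Dom C x" "Cod C u = Dom C (j t s)" "j t s \<cdot> u = x"
        using kernel_lift[OF S'(10)[of t s], of x "Dom C x"] x ty pD by metis
      obtain e a where e: "is_epi C e" "Cod C e = Dom C u" "a \<in> Arr C" "Dom C a = Dom C e"
        "Cod C a = Dom C (p (Suc t) s)" "p (Suc t) s \<cdot> a = u \<cdot> e"
        by (rule epi_lift[OF S'(9)[of "Suc t" s] u(1)]) (use u jD pD in auto)
      have "\<delta> s (Suc t) \<cdot> a = j t s \<cdot> (u \<cdot> e)"
        unfolding e(6)[symmetric] using e(1-5) pD(1-3) jD(1-3) by (simp add: \<delta>S)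
      also have "\<dots> = x \<cdot> e" unfolding u(4)[symmetric] using u(1-3) e(1-5) jD(1-3) by simp
      finally show "\<exists>e a. is_epi C e \<and> Cod C e = Dom C x \<and> a \<in> Hom C (Dom C e) (Dom C (\<delta> s (Suc t))) \<and>
          \<delta> s (Suc t) \<cdot> a = x \<cdot> e"
        using e u ty pD cQ(1) by (intro exI[of _ e] exI[of _ a]) auto
    qed
  qed
  have lift_cycle: "\<exists>e a. is_epi C e \<and> Cod C e = Dom C x \<and> a \<in> Hom C (Dom C e) (Q t s) \<and>
      d t s \<cdot> a = Zero C (Dom C e) (Q t (s - 1)) \<and> p t s \<cdot> a = x \<cdot> e"
    if "x \<in> Arr C" "Cod C x = Y t s" "dY t s \<cdot> x = Zero C (Dom C x) (Y t (s - 1))" for x t s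
    using S'(11)[of t] that unfolding lifts_cycles_def by blast
  \<comment> \<open>For \<open>t > 0\<close> the next map on homology is \<open>j \<circ> p\<close>; its injective part \<open>j\<close> is removed before this is used.\<close>
  have final_chase: "\<exists>e a b. is_epi C e \<and> Cod C e = Dom C x \<and> a \<in> Hom C (Dom C e) (Q (Suc t) s) \<and>
        d (Suc t) s \<cdot> a = Zero C (Dom C e) (Q (Suc t) (s - 1)) \<and> b \<in> Hom C (Dom C e) (Q t (s + 1)) \<and>
        \<delta> s (Suc t) \<cdot> a = x \<cdot> e \<boxplus> d t (s + 1) \<cdot> b"
    if x: "x \<in> Arr C" "Cod C x = Q t s" "d t s \<cdot> x = Zero C (Dom C x) (Q t (s - 1))"
      and y: "y \<in> Arr C" "Dom C y = Dom C x" "Cod C y = Y t (s + 1)" "dY t (s + 1) \<cdot> y = p t s \<cdot> x" for x y s t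
  proof -
    obtain e k b where e: "is_epi C e" "Cod C e = Dom C x" and k: "k \<in> Hom C (Dom C e) (Y (Suc t) s)"
      "dY (Suc t) s \<cdot> k = Zero C (Dom C e) (Y (Suc t) (s - 1))" and b: "b \<in> Hom C (Dom C e) (Q t (s + 1))"
      "j t s \<cdot> k = x \<cdot> e \<boxplus> d t (s + 1) \<cdot> b"
      by (rule step_homology_exact[OF S x y])
    obtain e' a where e': "is_epi C e'" "Cod C e' = Dom C e" and a: "a \<in> Hom C (Dom C e') (Q (Suc t) s)"
      "d (Suc t) s \<cdot> a = Zero C (Dom C e') (Q (Suc t) (s - 1))" "p (Suc t) s \<cdot> a = k \<cdot> e'"
      using lift_cycle[of k "Suc t" s] k by auto
    have "\<delta> s (Suc t) \<cdot> a = (j t s \<cdot> k) \<cdot> e'"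
      using a k(1) e' pD(1-3) jD(1-3) by (simp add: \<delta>S)
    also have "\<dots> = x \<cdot> (e \<cdot> e') \<boxplus> d t (s + 1) \<cdot> (b \<cdot> e')"
      unfolding b(2) using b(1) x(1,2) e e' cQ(2-4)[of t "s + 1"] by simp
    finally show ?thesis
      using epi_comp[of e e'] e e' a b(1)
      by (intro exI[of _ "e \<cdot> e'"] exI[of _ a] exI[of _ "b \<cdot> e'"]) auto
  qed
  define h where "h s t = (case t of 0 \<Rightarrow> homology_map C (d 0) dX (\<lambda>s. \<delta> s 0) s
      | Suc t' \<Rightarrow> homology_map C (d t) (d t') (\<lambda>s. \<delta> s t) s)" for s t
  have homology: "exact_augmented C (h s)" for s
    unfolding exact_augmented_def
  proof (intro conjI allI exI)
    show "is_zero_obj C Z" by fact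
    have "exact_at C (homology_map C (d 0) (dY 0) (p 0) s) (Zero C (Cod C (homology_map C (d 0) (dY 0) (p 0) s)) Z)"
      by (rule exact_homology_epiI[OF S'(2) S'(1) S'(7) Z]) (use lift_cycle in blast)
    then show "exact_at C (h s 0) (Zero C (Cod C (h s 0)) Z)"
      unfolding h_def \<delta>0 Y0 by simp
    fix t
    show "exact_at C (h s (Suc t)) (h s t)"
    proof (cases t)
      case 0
      have "exact_at C (homology_map C (d (Suc 0)) (d 0) (\<lambda>s. \<delta> s (Suc 0)) s) (homology_map C (d 0) (dY 0) (p 0) s)"
      proof (rule exact_homologyI[OF S'(2) S'(2) S'(1) \<delta>_map S'(7)])
        show "p 0 s \<cdot> \<delta> s (Suc 0) = Zero C (Q (Suc 0) s) (Y 0 s)" by (rule pd)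
      qed (rule final_chase)
      then show ?thesis unfolding 0 h_def \<delta>0 Y0 by simp
    next
      case (Suc t')
      have "exact_at C (homology_map C (d (Suc t)) (d t) (\<lambda>s. \<delta> s (Suc t)) s)
        (homology_map C (d t) (d t') (\<lambda>s. \<delta> s t) s)"
      proof (rule exact_homologyI[OF S'(2) S'(2) S'(2) \<delta>_map])
        show "is_chain_map C (Q t) (d t) (Q t') (d t') (\<lambda>s. \<delta> s t)" unfolding Suc by (rule \<delta>_map)
        show "\<delta> s t \<cdot> \<delta> s (Suc t) = Zero C (Q (Suc t) s) (Q t' s)"
          using dd[of s t] pD(1-3) jD(1-3) unfolding Suc by (simp add: \<delta>S)
        fix x y assume x: "x \<in> Arr C" "Cod C x = Q t s" "d t s \<cdot> x = Zero C (Dom C x) (Q t (s - 1))"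
          and y: "y \<in> Arr C" "Dom C y = Dom C x" "Cod C y = Q t' (s + 1)" "d t' (s + 1) \<cdot> y = \<delta> s t \<cdot> x"
        have "d t' (s + 1) \<cdot> y = j t' s \<cdot> (p t s \<cdot> x)"
          unfolding y(4) Suc \<delta>S using x(1,2) pD(1-3) jD(1-3) unfolding Suc by simp
        then obtain e k where e: "is_epi C e" "Cod C e = Dom C (p t s \<cdot> x)" and k: "k \<in> Hom C (Dom C e) (Y (Suc t') (s + 1))"
          "dY (Suc t') (s + 1) \<cdot> k = (p t s \<cdot> x) \<cdot> e"
          using step_homology_mono[OF S[of t'], of "p t s \<cdot> x" s y] x(1,2) y(1-3) pD(1-3) unfolding Suc
          by (metis comp_simps)
        have e2: "Cod C e = Dom C x" using e x pD(1-3) by simp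
        have xe: "d t s \<cdot> (x \<cdot> e) = Zero C (Dom C (x \<cdot> e)) (Q t (s - 1))"
          using rewrite_prefix[OF x(3), of e] x(1,2) e(1) e2 cQ(1-4)[of t] by simp
        have "\<exists>e' a b. is_epi C e' \<and> Cod C e' = Dom C (x \<cdot> e) \<and> a \<in> Hom C (Dom C e') (Q (Suc t) s) \<and>
            d (Suc t) s \<cdot> a = Zero C (Dom C e') (Q (Suc t) (s - 1)) \<and> b \<in> Hom C (Dom C e') (Q t (s + 1)) \<and>
            \<delta> s (Suc t) \<cdot> a = (x \<cdot> e) \<cdot> e' \<boxplus> d t (s + 1) \<cdot> b"
          by (rule final_chase[of _ _ _ k]) (use x(1,2) xe e(1) e2 k pD(1-3) Suc in auto)
        then obtain e' a b where e': "is_epi C e'" "Cod C e' = Dom C e" "a \<in> Hom C (Dom C e') (Q (Suc t) s)"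
          "d (Suc t) s \<cdot> a = Zero C (Dom C e') (Q (Suc t) (s - 1))" "b \<in> Hom C (Dom C e') (Q t (s + 1))"
          "\<delta> s (Suc t) \<cdot> a = (x \<cdot> e) \<cdot> e' \<boxplus> d t (s + 1) \<cdot> b"
          using x(1,2) e(1) e2 by auto
        then show "\<exists>e a b. is_epi C e \<and> Cod C e = Dom C x \<and> a \<in> Hom C (Dom C e) (Q (Suc t) s) \<and>
            d (Suc t) s \<cdot> a = Zero C (Dom C e) (Q (Suc t) (s - 1)) \<and> b \<in> Hom C (Dom C e) (Q t (s + 1)) \<and>
            \<delta> s (Suc t) \<cdot> a = x \<cdot> e \<boxplus> d t (s + 1) \<cdot> b"
          using epi_comp[of e e'] e(1) e2 x(1,2)
          by (intro exI[of _ "e \<cdot> e'"] exI[of _ a] exI[of _ b]) auto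
      qed
      then show ?thesis unfolding h_def Suc by simp
    qed
  qed
  have "is_CE_resolution C P X dX (\<lambda>s t. Q t s) (\<lambda>s t. d t s) \<delta>"
    unfolding is_CE_resolution_def
  proof (intro conjI allI impI)
    show "Q t s \<in> P" for s t using S'(6)[of t] unfolding is_proj_complex_def by blast
    show "is_chain_map C (\<lambda>s. Q 0 s) (\<lambda>s. d 0 s) X dX (\<lambda>s. \<delta> s 0)"
      using S'(7)[of 0] unfolding \<delta>0 Y0 .
    show "is_proj_complex C P (\<lambda>s. Q t s) (\<lambda>s. d t s)" for t using S'(6)[of t] .
    show "exact_augmented C (\<lambda>t. case t of
        0 \<Rightarrow> homology_map C (\<lambda>s. d 0 s) dX (\<lambda>s. \<delta> s 0) s
      | Suc t' \<Rightarrow> homology_map C (\<lambda>s. d t s) (\<lambda>s. d t' s) (\<lambda>s. \<delta> s t) s)" for s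
      using homology[of s] unfolding h_def .
  qed (use bicomplex columns in auto)
  then show ?thesis by blast
qed

end

theorem propositionB10:
  fixes C :: "('o, 'm) precategory" and P :: "'o set"
  assumes "abelian_category C" and "full_additive_subcategory C P"
  shows "(generating C P \<longrightarrow>
      (\<forall>X dX. is_nonneg_complex C X dX \<longrightarrow> (\<exists>Q d \<delta>. is_CE_resolution C P X dX Q d \<delta>))) \<and>
    (\<forall>X dX Q d \<delta>. is_nonneg_complex C X dX \<and> is_CE_resolution C P X dX Q d \<delta> \<longrightarrow>
      (\<exists>T \<iota> \<pi>. is_Tot C Q T \<iota> \<pi>) \<and>
      (\<forall>T \<iota> \<pi>. is_Tot C Q T \<iota> \<pi> \<longrightarrow>
        is_complex C T (Tot_diff C d \<delta> T \<iota> \<pi>) \<and>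
        is_quasi_iso C T (Tot_diff C d \<delta> T \<iota> \<pi>) X dX (Tot_aug C X \<delta> T \<pi>)))"
proof (intro conjI impI allI, goal_cases)
  case (1 X dX)
  then show ?case using abelian_category.CE_resolution_exists[OF assms(1,2)] by blast
next
  case (2 X dX Q d \<delta>)
  then interpret augmented_bicomplex C X dX Q d \<delta>
    using assms(1) by (auto simp: augmented_bicomplex_def augmented_bicomplex_axioms_def is_CE_resolution_def)
  show ?case by (rule Tot_exists)
next
  case (3 X dX Q d \<delta> T \<iota> \<pi>)
  then interpret total_complex C X dX Q d \<delta> T \<iota> \<pi>
    using assms(1) by (auto simp: total_complex_def total_complex_axioms_def
      augmented_bicomplex_def augmented_bicomplex_axioms_def is_CE_resolution_def)
  show ?case by (rule Tot_complex)
next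
  case (4 X dX Q d \<delta> T \<iota> \<pi>)
  then interpret total_complex C X dX Q d \<delta> T \<iota> \<pi>
    using assms(1) by (auto simp: total_complex_def total_complex_axioms_def
      augmented_bicomplex_def augmented_bicomplex_axioms_def is_CE_resolution_def)
  show ?case by (rule Tot_quasi_iso)
qed

end
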